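(* Suppose that exceptional zeros exist. Then \[ \liminf_{y\to\infty} \frac{W_y}{y/\log y} = 0 \quad\text{and}\quad \limsup_{u\to \infty} \frac{g(u)}{u} = \infty. \] Hence, almost surely, \[ \limsup_{x\to \infty} \frac{G_{\mathcal{R}}(x)}{\log^2 x} = \infty, \] and the conjecture that $g((\xi-o(1))\log^2 x) \lesssim G_{\mathcal{P}}(x) \lesssim g((\xi+o(1))\log^2 x)$ as $x\to\infty$ (with $\xi=2e^{-\gamma}$) implies that \[ \limsup_{x\to \infty} \frac{G_{\mathcal{P}}(x)}{\log^2 x} = \infty. \]
   Context: Exceptional zeros are said to exist if there is an infinite set $\mathcal{E}\subset \mathbb{N}$ such that for every $q\in \mathcal{E}$ there is a real Dirichlet character $\chi_q$ modulo $q$ and a zero $1-\delta_q$ with $L(1-\delta_q,\chi_q)=0$ and $\delta_q = o(1/\log q)$ as $q\to\infty$. For a choice of residue classes $a_p \bmod p$ (one for each prime $p$), let $\mathcal{S}_z \defeq \mathbb{Z}\setminus \bigcup_{p\le z}(a_p \bmod p)$. For $y\ge 2$, $W_y \defeq \min\big|[0,y]\cap\mathcal{S}_{(y/\log y)^{1/2}}\big|$, the minimum taken over all choices of residue classes $a_p \bmod p$ for primes $p\le (y/\log y)^{1/2}$. Define $g(u)\defeq \max\{y : W_y\log y \le u\}$. For a set $\mathcal{A}\subset\mathbb{N}$, $G_{\mathcal{A}}(x)\defeq\max\{b-a : [a,b]\subset[1,x],\ [a,b]\cap\mathcal{A}=\varnothing\}$. $\mathcal{P}$ denotes the set of primes.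 The random set $\mathcal{R}$ is defined as follows: choose residue classes $a_p \bmod p$ uniformly at random, independently for each prime $p$; let $z(t)$ be the largest prime with $\prod_{p\le z(t)}(1-1/p)^{-1}\le \log t$ (defined for $t\ge e^2$); and set $\mathcal{R}\defeq\{n\ge e^2 : n\in \mathcal{S}_{z(n)}\}$. "Almost surely" refers to this random choice. $\gamma$ is Euler's constant and $\xi\defeq 2e^{-\gamma}$. *)

theory Defs
  imports
    "HOL-Probability.Probability"
    "HOL-Complex_Analysis.Complex_Analysis"
    "HOL-Number_Theory.Cong"
    "HOL-Library.Landau_Symbols"
begin

definition dirichlet_character :: "nat \<Rightarrow> (nat \<Rightarrow> complex) \<Rightarrow> bool" where
  "dirichlet_character q chi \<longleftrightarrow>
     q > 0 \<and>
     (\<forall>m n. chi (m * n) = chi m * chi n) \<and>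
     (\<forall>n. chi (n + q) = chi n) \<and>
     (\<forall>n. chi n \<noteq> 0 \<longleftrightarrow> coprime n q)"

definition real_dirichlet_character :: "nat \<Rightarrow> (nat \<Rightarrow> complex) \<Rightarrow> bool" where
  "real_dirichlet_character q chi \<longleftrightarrow> dirichlet_character q chi \<and> (\<forall>n. chi n \<in> \<real>)"

definition principal_character :: "nat \<Rightarrow> (nat \<Rightarrow> complex) \<Rightarrow> bool" where
  "principal_character q chi \<longleftrightarrow> (\<forall>n. chi n = (if coprime n q then 1 else 0))"

text \<open>The $L$-function of a principal character has a pole at 1; all others are entire.\<close>

definition L_domain :: "nat \<Rightarrow> (nat \<Rightarrow> complex) \<Rightarrow> complex set" where
  "L_domain q chi = (if principal_character q chi then - {1} else UNIV)"

text \<open>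
  \<open>L\<close> is the analytic continuation of the Dirichlet series of \<open>chi\<close>. It is characterised by a
  relation because the library has no Dirichlet $L$-functions; by \<open>dirichlet_L_unique\<close> there is
  at most one such \<open>L\<close> on \<open>L_domain q chi\<close>.
\<close>

definition is_dirichlet_L ::
    "nat \<Rightarrow> (nat \<Rightarrow> complex) \<Rightarrow> (complex \<Rightarrow> complex) \<Rightarrow> bool" where
  "is_dirichlet_L q chi L \<longleftrightarrow>
     L holomorphic_on L_domain q chi \<and>
     (\<forall>s. Re s > 1 \<longrightarrow> (\<lambda>n. chi (Suc n) / of_nat (Suc n) powr s) sums L s)"

lemma dirichlet_L_unique:
  assumes "is_dirichlet_L q chi L" "is_dirichlet_L q chi L'" "s \<in> L_domain q chi"
  shows "L s = L' s"
proof (rule analytic_continuation_open[of "{s. Re s > 1}" "L_domain q chi" L L'])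
  show "open {s::complex. Re s > 1}"
    by (rule open_halfspace_Re_gt)
  show "open (L_domain q chi)"
    by (auto simp: L_domain_def)
  have "(2::complex) \<in> {s. Re s > 1}"
    by simp
  then show "{s::complex. Re s > 1} \<noteq> {}"
    by blast
  show "connected (L_domain q chi)"
    by (auto simp: L_domain_def intro!: connected_punctured_universe)
  show "{s. Re s > 1} \<subseteq> L_domain q chi"
    by (auto simp: L_domain_def)
  show "L holomorphic_on L_domain q chi" "L' holomorphic_on L_domain q chi"
    using assms by (auto simp: is_dirichlet_L_def)
  show "s \<in> L_domain q chi"
    by fact
  show "L z = L' z" if "z \<in> {s. Re s > 1}" for z
    using assms that by (auto simp: is_dirichlet_L_def intro: sums_unique2)
qed

definition dirichlet_L_zero :: "nat \<Rightarrow> (nat \<Rightarrow> complex) \<Rightarrow> complex \<Rightarrow> bool" where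
  "dirichlet_L_zero q chi s \<longleftrightarrow>
     s \<in> L_domain q chi \<and> (\<exists>L. is_dirichlet_L q chi L \<and> L s = 0)"

definition exceptional_zeros_exist :: bool where
  "exceptional_zeros_exist \<longleftrightarrow>
     (\<exists>(E :: nat set) (chi :: nat \<Rightarrow> nat \<Rightarrow> complex) (\<delta> :: nat \<Rightarrow> real).
        infinite E \<and>
        (\<forall>q\<in>E. real_dirichlet_character q (chi q) \<and>
               dirichlet_L_zero q (chi q) (complex_of_real (1 - \<delta> q))) \<and>
        \<delta> \<in> o[inf at_top (principal E)](\<lambda>q. 1 / ln (real q)))"

text \<open>
  A choice of residue classes is a function \<open>a :: nat \<Rightarrow> int\<close>, of which only the values at
  primes matter.
\<close>

definition sifted_set :: "(nat \<Rightarrow> int) \<Rightarrow> real \<Rightarrow> int set" where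
  "sifted_set a z = UNIV - (\<Union>p\<in>{p. prime p \<and> real p \<le> z}. {n. [n = a p] (mod int p)})"

text \<open>The infimum of a nonempty set of natural numbers is its minimum.\<close>

definition W :: "real \<Rightarrow> nat" where
  "W y = (INF a. card ({n. 0 \<le> n \<and> real_of_int n \<le> y} \<inter> sifted_set a (sqrt (y / ln y))))"

text \<open>
  The maximum over real \<open>y\<close> need not be attained (\<open>W\<close> can jump up at an integer), so it is read
  as a supremum. Taking it in \<^typ>\<open>ereal\<close> avoids the junk value that \<open>Sup\<close> has on unbounded
  sets of reals.
\<close>

definition g :: "real \<Rightarrow> ereal" where
  "g u = (SUP y\<in>{y. 2 \<le> y \<and> real (W y) * ln y \<le> u}. ereal y)"

text \<open>
  The endpoints are real, so the maximum is again read as a supremum (the complement of \<open>A\<close> is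
  open). The set is nonempty for \<open>x > 1\<close> and bounded by \<open>x - 1\<close>.
\<close>

definition largest_gap :: "nat set \<Rightarrow> real \<Rightarrow> real" where
  "largest_gap A x =
     Sup {b - a | a b. a \<le> b \<and> {a..b} \<subseteq> {1..x} \<and> {a..b} \<inter> real ` A = {}}"

definition random_residues :: "(nat \<Rightarrow> int) measure" where
  "random_residues = Pi\<^sub>M {p. prime p} (\<lambda>p. measure_pmf (pmf_of_set {0..<int p}))"

definition sieve_limit :: "real \<Rightarrow> nat" where
  "sieve_limit t =
     (GREATEST q. prime q \<and> (\<Prod>p | prime p \<and> p \<le> q. inverse (1 - 1 / real p)) \<le> ln t)"

definition random_set :: "(nat \<Rightarrow> int) \<Rightarrow> nat set" where
  "random_set a =
     {n. exp 2 \<le> real n \<and> int n \<in> sifted_set a (real (sieve_limit (real n)))}"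

definition \<xi> :: real where
  "\<xi> = 2 * exp (- euler_mascheroni)"

definition asymp_le :: "(real \<Rightarrow> ereal) \<Rightarrow> (real \<Rightarrow> ereal) \<Rightarrow> bool"  (infix "\<lesssim>" 50) where
  "f \<lesssim> h \<longleftrightarrow> Limsup at_top (\<lambda>x. f x / h x) \<le> 1"

text \<open>The two \<open>o(1)\<close> terms are unrelated and may have either sign.\<close>

definition prime_gap_conjecture :: bool where
  "prime_gap_conjecture \<longleftrightarrow>
     (\<exists>\<epsilon>\<^sub>1 \<epsilon>\<^sub>2 :: real \<Rightarrow> real.
        \<epsilon>\<^sub>1 \<in> o(\<lambda>_. 1) \<and> \<epsilon>\<^sub>2 \<in> o(\<lambda>_. 1) \<and>
        (\<lambda>x. g ((\<xi> - \<epsilon>\<^sub>1 x) * (ln x)\<^sup>2)) \<lesssim> (\<lambda>x. ereal (largest_gap {p. prime p} x)) \<and>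
        (\<lambda>x. ereal (largest_gap {p. prime p} x)) \<lesssim> (\<lambda>x. g ((\<xi> + \<epsilon>\<^sub>2 x) * (ln x)\<^sup>2)))"

end

theory Submission
  imports Defs "HOL-Number_Theory.Residues" "HOL-Real_Asymp.Real_Asymp"
begin

text \<open>The sifting level \<open>sqrt (y / ln y)\<close> has to meet two opposite demands. It is
  so close to \<open>sqrt y\<close> that, when \<open>y\<close> is a large power of
  \<open>q\<close>, a survivor below \<open>X = q * (y + 1)\<close> has at most two prime factors;
  those with exactly two are counted by Chebyshev and Mertens bounds over the logarithmically short
  range from the level to \<open>sqrt X\<close>. It is also so low that the primes up to it have
  product \<open>exp (o (ln x))\<close> when \<open>y = K * (ln x)\<^sup>2\<close>, so that many of
  its periods fit into the window.

  Rarity of the primes with \<open>chi p = 1\<close> comes as a bound for the sum of their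
  reciprocals, which says nothing at one given scale. A pigeonhole over powers of 2 finds a good
  \<open>X\<close>; hence \<open>y\<close> cannot be prescribed, and the \<open>x\<close> of a large
  gap is computed from \<open>y\<close>.

  The zero enters in a single way: the real series vanishes, so its partial sums are minus its
  tails. The definition of exceptional zeros admits zeros to the right of 1 and principal
  characters; these are excluded beforehand, by a finite Euler product and by the alternating zeta
  series.\<close>

text \<open>
  Let \<open>chi\<close> be a nonprincipal real character mod \<open>q\<close> with a zero at \<open>1 - \<delta>\<close>, and let
  \<open>lam = 1 * chi \<ge> 0\<close>. By the hyperbola method the sums \<open>S(x) = \<Sum>n\<le>x. lam n * n powr (\<delta> - 1)\<close>
  grow like \<open>x powr \<delta>\<close> for \<open>x \<ge> q ^ 6\<close>, hence hardly at all while \<open>\<delta> * ln x\<close> is small. A prime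
  \<open>p > x\<close> with \<open>chi p = 1\<close> turns every \<open>m \<le> x\<close> into \<open>m * p\<close> with \<open>lam (m * p) = 2 * lam m\<close>, so such
  primes are rare up to any fixed power of \<open>q\<close>. To make \<open>W y\<close> small, sieve \<open>q * n + b\<close> for
  \<open>n \<le> y\<close>, where \<open>b\<close> is the best class with \<open>chi b = 1\<close>, by the primes not dividing \<open>q\<close>. What
  survives is mostly prime if \<open>y\<close> is a large power of \<open>q\<close>. The primes dividing \<open>q\<close> are then used
  greedily.

  For the random set, the Chinese remainder theorem provides many disjoint intervals of length
  \<open>y = K * (ln x)\<^sup>2\<close> in a window of length \<open>U\<close>, a small power of \<open>x\<close>, in which the primes up to
  \<open>sqrt (y / ln y)\<close> leave only \<open>W y\<close> integers. The primes up to \<open>U\<close> reduce this number to a small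
  multiple of \<open>ln x\<close> in at least half of the intervals (Markov's inequality), and the primes above
  \<open>U\<close>, which see the integers of the window in distinct classes, then clear one of these intervals by
  a second moment argument.
\<close>

section \<open>Chebyshev and Mertens bounds\<close>

lemma prod_primes_dvd:
  fixes N :: nat
  assumes "finite S" "\<And>p. p \<in> S \<Longrightarrow> prime p" "\<And>p. p \<in> S \<Longrightarrow> p dvd N"
  shows "\<Prod>S dvd N"
  using assms
proof (induction S rule: finite_induct)
  case (insert p S)
  have "coprime p (\<Prod>S)"
    using insert by (intro prod_coprime_right) (auto intro!: primes_coprime)
  with insert show ?case by (auto intro: divides_mult)
qed simp

text \<open>A prime in \<open>(n, 2 * n]\<close> divides \<open>fact (2 * n)\<close> but not
  \<open>fact n\<close>, hence divides the central binomial coefficient.\<close>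

lemma prod_primes_double_le: "\<Prod>{p. prime p \<and> n < p \<and> p \<le> 2 * n} \<le> 4 ^ n" for n :: nat
proof -
  have "\<Prod>{p. prime p \<and> n < p \<and> p \<le> 2 * n} dvd (2 * n choose n)"
  proof (rule prod_primes_dvd)
    show "p dvd (2 * n choose n)" if "p \<in> {p. prime p \<and> n < p \<and> p \<le> 2 * n}" for p
    proof -
      have p: "prime p" "n < p" "p \<le> 2 * n" using that by auto
      have "p dvd fact (2 * n)" using p by (simp add: prime_dvd_fact_iff)
      also have "fact (2 * n) = fact n * fact n * (2 * n choose n)"
        using binomial_fact_lemma[of n "2 * n"] by (simp add: mult_2)
      finally show ?thesis using p by (simp add: prime_dvd_mult_iff prime_dvd_fact_iff)
    qed
  qed auto
  then have "\<Prod>{p. prime p \<and> n < p \<and> p \<le> 2 * n} \<le> (2 * n choose n)"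
    by (rule dvd_imp_le) simp
  also have "\<dots> \<le> 2 ^ (2 * n)" by (rule binomial_le_pow2)
  finally show ?thesis by (simp add: power_mult)
qed

lemma sum_ln_primes_double_le:
  "(\<Sum>p | prime p \<and> n < p \<and> p \<le> 2 * n. ln (real p)) \<le> real n * ln 4" for n :: nat
proof -
  let ?S = "{p. prime p \<and> n < p \<and> p \<le> 2 * n}"
  have "(\<Sum>p\<in>?S. ln (real p)) = ln (\<Prod>p\<in>?S. real p)"
    by (subst ln_prod) (auto dest: prime_gt_0_nat)
  also have "(\<Prod>p\<in>?S. real p) = real (\<Prod>?S)" by simp
  also have "ln \<dots> \<le> ln (real (4 ^ n))"
    using prod_primes_double_le[of n]
    by (intro ln_mono) (auto simp del: of_nat_prod of_nat_power intro!: prod_pos dest: prime_gt_0_nat)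
  also have "\<dots> = real n * ln 4" by (simp add: ln_realpow)
  finally show ?thesis .
qed

lemma sum_ln_primes_le: "(\<Sum>p | prime p \<and> p \<le> n. ln (real p)) \<le> 2 * ln 4 * real n" for n :: nat
proof -
  have "(\<Sum>p | prime p \<and> p \<le> n. ln (real p)) \<le> 2 * ln 4 * (real n - 1)" if "n \<ge> 1" for n :: nat
    using that
  proof (induction n rule: less_induct)
    case (less n)
    consider "n = 1" | "n = 2" | "n \<ge> 3" using less.prems by linarith
    then show ?case
    proof cases
      case 1
      then have "{p. prime p \<and> p \<le> n} = {}" by (auto dest: prime_ge_2_nat)
      then show ?thesis using 1 by (simp only: sum.empty) simp
    next
      case 2
      have "{p. prime p \<and> p \<le> n} = {2}"
      proof (intro equalityI subsetI)
        fix p assume "p \<in> {p. prime p \<and> p \<le> n}"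
        then show "p \<in> {2}" using 2 prime_ge_2_nat[of p] by simp
      qed (use 2 in auto)
      moreover have "ln (2::real) \<le> 2 * ln 4"
        using ln_mono[of 2 "4::real"] ln_ge_zero[of "4::real"] by linarith
      ultimately show ?thesis using 2 by simp
    next
      case 3
      define m where "m = (n + 1) div 2"
      have m: "m < n" "1 \<le> m" "n \<le> 2 * m" "2 * m \<le> n + 1" using 3 by (auto simp: m_def)
      have "(\<Sum>p | prime p \<and> p \<le> n. ln (real p)) \<le> (\<Sum>p | prime p \<and> p \<le> 2 * m. ln (real p))"
        using m by (intro sum_mono2) (auto dest: prime_ge_1_nat)
      also have "{p. prime p \<and> p \<le> 2 * m} = {p. prime p \<and> p \<le> m} \<union> {p. prime p \<and> m < p \<and> p \<le> 2 * m}"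
        by auto
      also have "(\<Sum>p\<in>\<dots>. ln (real p)) = (\<Sum>p | prime p \<and> p \<le> m. ln (real p)) +
                   (\<Sum>p | prime p \<and> m < p \<and> p \<le> 2 * m. ln (real p))"
        by (intro sum.union_disjoint) auto
      also have "\<dots> \<le> 2 * ln 4 * (real m - 1) + real m * ln 4"
        using less.IH[of m] m sum_ln_primes_double_le[of m] by linarith
      also have "\<dots> = ln 4 * (3 * real m - 2)" by (simp add: algebra_simps)
      also have "\<dots> \<le> ln 4 * (2 * (real n - 1))"
        using m(4) 3 by (intro mult_left_mono) auto
      finally show ?thesis by (simp add: algebra_simps)
    qed
  qed
  moreover have "2 * ln 4 * (real n - 1) \<le> 2 * ln 4 * real n" by (intro mult_left_mono) auto
  moreover have "(\<Sum>p | prime p \<and> p \<le> n. ln (real p)) \<le> 2 * ln 4 * real n" if "n = 0"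
  proof -
    have "{p. prime p \<and> p \<le> n} = {}" using that by auto
    then show ?thesis by (simp only: sum.empty) simp
  qed
  ultimately show ?thesis by (meson less_one not_le order_trans)
qed

lemma prod_primes_le: "real (\<Prod>{p. prime p \<and> p \<le> n}) \<le> exp (2 * ln 4 * real n)" for n :: nat
proof -
  have "real (\<Prod>{p. prime p \<and> p \<le> n}) = exp (\<Sum>p | prime p \<and> p \<le> n. ln (real p))"
    by (auto simp: exp_sum dest: prime_gt_0_nat intro!: prod.cong)
  with sum_ln_primes_le[of n] show ?thesis by simp
qed

lemma finite_primes_le_real: "finite {p::nat. P p \<and> real p \<le> x}"
proof (rule finite_subset)
  show "{p. P p \<and> real p \<le> x} \<subseteq> {..nat \<lfloor>x\<rfloor>}" using le_nat_floor by auto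
qed simp

text \<open>Split at \<open>sqrt x\<close>: below it the trivial count suffices, and above it every
  prime contributes at least \<open>ln x / 2\<close> to the Chebyshev sum.\<close>

lemma card_primes_le:
  assumes "x \<ge> 2"
  shows "real (card {p::nat. prime p \<and> real p \<le> x}) \<le> 8 * x / ln x"
proof -
  let ?A = "{p::nat. prime p \<and> real p \<le> sqrt x}" and ?B = "{p::nat. prime p \<and> sqrt x < real p \<and> real p \<le> x}"
  have lnx: "ln x > 0" and s1: "sqrt x > 1" using assms by auto
  have fB: "finite ?B" by (rule finite_subset[OF _ finite_primes_le_real[of prime x]]) auto
  have "?A \<subseteq> {1..nat \<lfloor>sqrt x\<rfloor>}" using prime_ge_1_nat le_nat_floor by auto
  then have "card ?A \<le> card {1..nat \<lfloor>sqrt x\<rfloor>}" by (intro card_mono) auto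
  then have "real (card ?A) \<le> real (nat \<lfloor>sqrt x\<rfloor>)" by simp
  also have "\<dots> \<le> sqrt x" using s1 by (intro of_nat_floor) auto
  finally have "real (card ?A) \<le> sqrt x" .
  moreover have "sqrt x \<le> 2 * x / ln x"
  proof -
    have "ln x = 2 * ln (sqrt x)" using assms by (simp add: ln_sqrt)
    also have "\<dots> \<le> 2 * sqrt x" using ln_bound[of "sqrt x"] s1 by linarith
    finally have "sqrt x * ln x \<le> sqrt x * (2 * sqrt x)" using s1 by (intro mult_left_mono) auto
    also have "\<dots> = 2 * x" using assms by simp
    finally show ?thesis using lnx by (simp add: field_simps)
  qed
  moreover have "real (card ?B) \<le> 6 * x / ln x"
  proof -
    have "real (card ?B) * (ln x / 2) = (\<Sum>p\<in>?B. ln x / 2)" by simp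
    also have "\<dots> \<le> (\<Sum>p\<in>?B. ln (real p))"
    proof (rule sum_mono)
      fix p assume "p \<in> ?B"
      then have "ln (sqrt x) \<le> ln (real p)" using s1 by (intro ln_mono) auto
      then show "ln x / 2 \<le> ln (real p)" using assms by (simp add: ln_sqrt)
    qed
    also have "\<dots> \<le> (\<Sum>p | prime p \<and> p \<le> nat \<lfloor>x\<rfloor>. ln (real p))"
      using prime_ge_1_nat le_nat_floor by (intro sum_mono2) auto
    also have "\<dots> \<le> 2 * ln 4 * real (nat \<lfloor>x\<rfloor>)" by (rule sum_ln_primes_le)
    also have "\<dots> \<le> 2 * ln 4 * x" using assms by (intro mult_left_mono) auto
    also have "\<dots> \<le> 3 * x"
    proof -
      have "ln (4::real) = 2 * ln 2" using ln_realpow[of 2 2] by simp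
      then show ?thesis using ln2_le_25_over_36 assms by (intro mult_right_mono) linarith+
    qed
    finally show ?thesis using lnx by (simp add: field_simps)
  qed
  moreover have "card {p::nat. prime p \<and> real p \<le> x} \<le> card ?A + card ?B"
  proof -
    have "{p::nat. prime p \<and> real p \<le> x} \<subseteq> ?A \<union> ?B" by auto
    then have "card {p::nat. prime p \<and> real p \<le> x} \<le> card (?A \<union> ?B)"
      using fB finite_primes_le_real[of prime "sqrt x"] by (intro card_mono) auto
    also have "\<dots> \<le> card ?A + card ?B" by (rule card_Un_le)
    finally show ?thesis .
  qed
  ultimately have "real (card {p::nat. prime p \<and> real p \<le> x}) \<le> 2 * x / ln x + 6 * x / ln x"
    by linarith
  then show ?thesis by (simp add: add_divide_distrib[symmetric])
qed

lemma sum_ln_over_primes_dyadic: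
  fixes n :: nat
  assumes "n \<ge> 1"
  shows "(\<Sum>p | prime p \<and> n < p \<and> p \<le> 2 ^ k * n. ln (real p) / real p) \<le> real k * ln 4"
proof (induction k)
  case 0
  have "{p. prime p \<and> n < p \<and> p \<le> 2 ^ 0 * n} = {}" by auto
  then show ?case by (simp only: sum.empty)
next
  case (Suc k)
  let ?m = "2 ^ k * n"
  let ?S = "{p. prime p \<and> ?m < p \<and> p \<le> 2 * ?m}"
  have m: "n \<le> ?m" "0 < ?m" using assms by auto
  have "(\<Sum>p\<in>?S. ln (real p) / real p) \<le> (\<Sum>p\<in>?S. ln (real p) / real ?m)"
    using m by (intro sum_mono divide_left_mono) (auto dest: prime_gt_0_nat prime_ge_1_nat simp del: of_nat_mult)
  also have "\<dots> = (\<Sum>p\<in>?S. ln (real p)) / real ?m" by (simp add: sum_divide_distrib)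
  also have "\<dots> \<le> (real ?m * ln 4) / real ?m"
    by (intro divide_right_mono sum_ln_primes_double_le) auto
  also have "\<dots> = ln 4" using m by simp
  finally have 1: "(\<Sum>p\<in>?S. ln (real p) / real p) \<le> ln 4" .
  have "{p. prime p \<and> n < p \<and> p \<le> 2 ^ Suc k * n} = {p. prime p \<and> n < p \<and> p \<le> ?m} \<union> ?S"
    using le_less_trans[OF m(1)] by auto
  then have "(\<Sum>p | prime p \<and> n < p \<and> p \<le> 2 ^ Suc k * n. ln (real p) / real p) =
     (\<Sum>p | prime p \<and> n < p \<and> p \<le> ?m. ln (real p) / real p) + (\<Sum>p\<in>?S. ln (real p) / real p)"
    by (simp only:) (intro sum.union_disjoint, auto)
  then show ?case using 1 Suc by (simp add: algebra_simps)
qed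

text \<open>An upper Mertens bound in which only the ratio \<open>v / z\<close> matters: the range
  is covered by dyadic blocks, each contributing at most \<open>ln 4\<close>.\<close>

lemma sum_ln_over_primes_le:
  assumes "1 \<le> z" "z \<le> v"
  shows "(\<Sum>p | prime p \<and> z < real p \<and> real p \<le> v. ln (real p) / real p) \<le> 2 * ln (v / z) + 4 * ln 2"
proof -
  define n where "n = nat \<lfloor>z\<rfloor>"
  have n: "n \<ge> 1" "real n \<le> z" "z < real n + 1" using assms unfolding n_def by linarith+
  \<comment> \<open>The factor 2 inside the logarithm pays for replacing \<open>z\<close> by
    \<open>n\<close>, its floor, which is at least \<open>z / 2\<close>.\<close>
  define k where "k = nat \<lceil>log 2 (2 * v / z)\<rceil>"
  have l0: "log 2 (2 * v / z) \<ge> 0" using assms by (subst zero_le_log_cancel_iff) (auto simp: field_simps)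
  have k: "log 2 (2 * v / z) \<le> real k" "real k \<le> log 2 (2 * v / z) + 1"
    using l0 unfolding k_def by linarith+
  have "v / real n \<le> 2 * v / z"
    using assms n by (auto simp: field_simps)
  also have "\<dots> = 2 powr log 2 (2 * v / z)" using assms by (subst powr_log_cancel) auto
  also have "\<dots> \<le> 2 powr real k" using k by (intro powr_mono) auto
  also have "\<dots> = 2 ^ k" by (simp add: powr_realpow)
  finally have vk: "v \<le> 2 ^ k * real n" using n by (simp add: field_simps)
  have "{p. prime p \<and> z < real p \<and> real p \<le> v} \<subseteq> {p. prime p \<and> n < p \<and> p \<le> 2 ^ k * n}"
  proof safe
    fix p assume "z < real p" "real p \<le> v"
    with n vk have "real n < real p" "real p \<le> real (2 ^ k * n)" by auto
    then show "n < p" "p \<le> 2 ^ k * n" by (simp_all only: of_nat_less_iff of_nat_le_iff)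
  qed
  then have "(\<Sum>p | prime p \<and> z < real p \<and> real p \<le> v. ln (real p) / real p)
       \<le> (\<Sum>p | prime p \<and> n < p \<and> p \<le> 2 ^ k * n. ln (real p) / real p)"
    by (intro sum_mono2) (auto dest: prime_ge_1_nat)
  also have "\<dots> \<le> real k * ln 4" by (rule sum_ln_over_primes_dyadic) fact
  also have "\<dots> \<le> (log 2 (2 * v / z) + 1) * ln 4" using k by (intro mult_right_mono) auto
  also have "log 2 (2 * v / z) = 1 + ln (v / z) / ln 2"
    using assms by (auto simp: log_def ln_mult ln_div field_simps)
  also have "ln (4::real) = 2 * ln 2" using ln_realpow[of 2 2] by simp
  also have "(1 + ln (v / z) / ln 2 + 1) * (2 * ln 2) = 2 * ln (v / z) + 4 * ln (2::real)"
    by (simp add: field_simps)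
  finally show ?thesis .
qed

text \<open>One prime is sieved out at a time: the multiples of \<open>p\<close> in
  \<open>?S\<close> are \<open>p\<close> times \<open>?S\<close>, and complete multiplicativity
  pulls \<open>h p\<close> out. The general field lets this serve real power sums and complex
  Dirichlet series alike.\<close>

lemma infsum_euler_factors:
  fixes h :: "nat \<Rightarrow> 'a :: {banach, real_normed_field}"
  assumes mult: "\<And>m n. h (m * n) = h m * h n" and sum: "h summable_on UNIV"
    and "finite P" "\<And>p. p \<in> P \<Longrightarrow> prime p"
  shows "infsum h {n. \<forall>p\<in>P. \<not> p dvd n} = (\<Prod>p\<in>P. 1 - h p) * infsum h UNIV"
  using assms(3,4)
proof (induction P rule: finite_induct)
  case (insert p P)
  let ?S = "{n. \<forall>p\<in>P. \<not> p dvd n}"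
  have p: "prime p" using insert by auto
  have sub: "h summable_on A" for A using sum summable_on_subset_banach by blast
  have eq: "{n. \<forall>q\<in>insert p P. \<not> q dvd n} = ?S - (*) p ` ?S"
  proof (intro equalityI subsetI)
    fix n assume n: "n \<in> ?S - (*) p ` ?S"
    have "\<not> p dvd n"
    proof
      assume "p dvd n"
      then obtain m where m: "n = p * m" by blast
      then have "m \<in> ?S" using n by auto
      then show False using n m by auto
    qed
    then show "n \<in> {n. \<forall>q\<in>insert p P. \<not> q dvd n}" using n by auto
  qed auto
  have subset: "(*) p ` ?S \<subseteq> ?S"
  proof safe
    fix m q assume "q \<in> P" "q dvd p * m" and m: "\<forall>p\<in>P. \<not> p dvd m"
    moreover have "prime q" "q \<noteq> p" using insert \<open>q \<in> P\<close> by auto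
    ultimately show False using p by (auto simp: prime_dvd_mult_iff primes_dvd_imp_eq)
  qed
  have "infsum h {n. \<forall>q\<in>insert p P. \<not> q dvd n} = infsum h ?S - infsum h ((*) p ` ?S)"
    unfolding eq by (intro infsum_Diff sub subset)
  also have "infsum h ((*) p ` ?S) = infsum (\<lambda>m. h (p * m)) ?S"
    using p by (subst infsum_reindex) (auto simp: inj_on_def o_def dest: prime_gt_0_nat)
  also have "\<dots> = h p * infsum h ?S" by (simp add: mult infsum_cmult_right sub)
  finally show ?case using insert by (simp add: algebra_simps)
qed simp

text \<open>The integral of \<open>s powr (\<delta> - 1)\<close> from 1 to \<open>t\<close>, with
  its limiting value \<open>ln t\<close> at \<open>\<delta> = 0\<close>.\<close>

definition pint :: "real \<Rightarrow> real \<Rightarrow> real" where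
  "pint \<delta> t = (if \<delta> = 0 then ln t else (t powr \<delta> - 1) / \<delta>)"

lemma DERIV_pint: "t > 0 \<Longrightarrow> (pint \<delta> has_real_derivative t powr (\<delta> - 1)) (at t)"
proof (cases "\<delta> = 0")
  case True
  assume "t > 0"
  then show ?thesis unfolding pint_def[abs_def] using True
    by (auto intro!: derivative_eq_intros simp: powr_minus inverse_eq_divide)
next
  case False
  assume "t > 0"
  then show ?thesis unfolding pint_def[abs_def] using False
    by (auto intro!: derivative_eq_intros)
qed

text \<open>Split the integral at \<open>a\<close> and rescale the second piece by
  \<open>a\<close>.\<close>

lemma pint_mult:
  assumes "a > 0" "b > 0"
  shows "pint \<delta> (a * b) = pint \<delta> a + a powr \<delta> * pint \<delta> b"
  using assms by (auto simp: pint_def ln_mult powr_mult field_simps)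

lemma pint_diff_bounds:
  assumes "0 < s" "s \<le> t" "\<delta> \<le> 1"
  shows "(t - s) * t powr (\<delta> - 1) \<le> pint \<delta> t - pint \<delta> s"
    and "pint \<delta> t - pint \<delta> s \<le> (t - s) * s powr (\<delta> - 1)"
proof -
  have "(t - s) * t powr (\<delta> - 1) \<le> pint \<delta> t - pint \<delta> s \<and>
        pint \<delta> t - pint \<delta> s \<le> (t - s) * s powr (\<delta> - 1)"
  proof (cases "s = t")
    case False
    then have "\<exists>z>s. z < t \<and> pint \<delta> t - pint \<delta> s = (t - s) * z powr (\<delta> - 1)"
      using assms by (intro MVT2 DERIV_pint) auto
    then obtain z where z: "s < z" "z < t" "pint \<delta> t - pint \<delta> s = (t - s) * z powr (\<delta> - 1)"
      by blast
    have "t powr (\<delta> - 1) \<le> z powr (\<delta> - 1)" "z powr (\<delta> - 1) \<le> s powr (\<delta> - 1)"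
      using z assms by (auto intro!: powr_mono2')
    then show ?thesis using z assms by (auto intro!: mult_left_mono)
  qed simp
  then show "(t - s) * t powr (\<delta> - 1) \<le> pint \<delta> t - pint \<delta> s"
    and "pint \<delta> t - pint \<delta> s \<le> (t - s) * s powr (\<delta> - 1)" by auto
qed

lemma pint_1 [simp]: "pint \<delta> 1 = 0"
  by (simp add: pint_def)

lemma sum_powr_le_pint:
  assumes "\<delta> \<le> 1" "N \<ge> 1"
  shows "(\<Sum>n=1..N. real n powr (\<delta> - 1)) \<le> 1 + pint \<delta> (real N)"
  using assms(2)
proof (induction N rule: dec_induct)
  case (step N)
  have "real (Suc N) powr (\<delta> - 1) \<le> pint \<delta> (real (Suc N)) - pint \<delta> (real N)"
    using pint_diff_bounds(1)[of "real N" "real (Suc N)" \<delta>] step assms by simp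
  then show ?case using step by simp
qed simp

lemma summable_on_powr:
  assumes "s > 1"
  shows "(\<lambda>n::nat. real n powr - s) summable_on A"
proof -
  have "summable (\<lambda>n::nat. real n powr - s)"
    using assms by (subst summable_real_powr_iff) auto
  then have "(\<lambda>n::nat. real n powr - s) summable_on UNIV"
    by (subst summable_on_UNIV_nonneg_real_iff) auto
  then show ?thesis by (rule summable_on_subset_banach) auto
qed

lemma infsum_powr_le:
  assumes "\<sigma> > 0"
  shows "(\<Sum>\<^sub>\<infinity>n::nat. real n powr - (1 + \<sigma>)) \<le> 1 + 1 / \<sigma>"
proof (rule infsum_le_finite_sums)
  show "(\<lambda>n::nat. real n powr - (1 + \<sigma>)) summable_on UNIV"
    using assms by (intro summable_on_powr) auto
next
  fix F :: "nat set" assume "finite F"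
  then obtain N where N: "F \<subseteq> {..N}" by (meson finite_nat_iff_bounded_le)
  \<comment> \<open>The index 0 costs nothing, because \<open>0 powr _ = 0\<close>.\<close>
  have "(\<Sum>n\<in>F. real n powr - (1 + \<sigma>)) \<le> (\<Sum>n\<in>insert 0 {1..Suc N}. real n powr - (1 + \<sigma>))"
    using N by (intro sum_mono2) (auto simp: subset_iff Suc_le_eq)
  also have "\<dots> = (\<Sum>n=1..Suc N. real n powr (- \<sigma> - 1))"
  proof -
    have eq: "- (1 + \<sigma>) = - \<sigma> - 1" by simp
    show ?thesis unfolding eq by (subst sum.insert) auto
  qed
  also have "\<dots> \<le> 1 + pint (- \<sigma>) (real (Suc N))" using assms by (intro sum_powr_le_pint) auto
  also have "\<dots> \<le> 1 + 1 / \<sigma>" using assms by (simp add: pint_def field_simps)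
  finally show "(\<Sum>n\<in>F. real n powr - (1 + \<sigma>)) \<le> 1 + 1 / \<sigma>" .
qed

section \<open>Two-sided bounds for the Mertens product\<close>

definition euler_prod :: "nat \<Rightarrow> real" where
  "euler_prod u = (\<Prod>p | prime p \<and> p \<le> u. inverse (1 - 1 / real p))"

lemma prime_real_bounds: "prime (p::nat) \<Longrightarrow> 2 \<le> real p"
  using prime_ge_2_nat by fastforce

lemma prime_factor_bounds:
  assumes "prime (p::nat)"
  shows "1 / 2 \<le> 1 - 1 / real p" "1 - 1 / real p < 1"
  using prime_real_bounds[OF assms] by (auto simp: field_simps)

(* Rankin's trick: moving the exponent from 1 to 1 + 1/ln u changes the product by a bounded factor. *)
lemma euler_prod_le:
  assumes "u \<ge> 2"
  shows "euler_prod u \<le> 3 * exp 24 * ln (real u)"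
proof -
  define \<sigma> where "\<sigma> = 1 / ln (real u)"
  let ?P = "{p. prime p \<and> p \<le> u}"
  have fin: "finite ?P" by simp
  have lnu: "ln (real u) \<ge> 1 / 2"
    using ln_mono[of 2 "real u"] ln2_ge_two_thirds assms by linarith
  have \<sigma>: "\<sigma> > 0" using lnu by (auto simp: \<sigma>_def)
  define h where "h n = real n powr - (1 + \<sigma>)" for n :: nat
  have hsum: "h summable_on A" for A unfolding h_def using \<sigma> by (intro summable_on_powr) auto
  \<comment> \<open>Keeping only the term \<open>n = 1\<close> of the sieved series turns the exact
    identity into a lower bound for the product of the \<open>1 - h p\<close>.\<close>
  have "1 = sum h {1}" by (simp add: h_def)
  also have "\<dots> \<le> infsum h {n. \<forall>p\<in>?P. \<not> p dvd n}"
    by (intro finite_sum_le_infsum hsum) (auto simp: h_def dest: not_prime_unit)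
  also have "\<dots> = (\<Prod>p\<in>?P. 1 - h p) * infsum h UNIV"
    by (intro infsum_euler_factors hsum fin) (auto simp: h_def powr_mult)
  also have "\<dots> \<le> (\<Prod>p\<in>?P. 1 - h p) * (1 + ln (real u))"
  proof (intro mult_left_mono prod_nonneg)
    show "infsum h UNIV \<le> 1 + ln (real u)"
      using infsum_powr_le[OF \<sigma>] lnu by (simp add: h_def[abs_def] \<sigma>_def)
    show "1 - h p \<ge> 0" if "p \<in> ?P" for p
      using that \<sigma> powr_mono[of "- (1 + \<sigma>)" 0 "real p"] by (auto simp: h_def dest: prime_ge_1_nat)
  qed
  finally have 1: "1 \<le> (\<Prod>p\<in>?P. 1 - h p) * (1 + ln (real u))" .
  have hp: "(1 - h p) * inverse (1 - 1 / real p) \<le> exp (2 * \<sigma> * (ln (real p) / real p))"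
    if p: "p \<in> ?P" for p
  proof -
    have p2: "real p \<ge> 2" using p prime_real_bounds by auto
    have "h p = (1 / real p) * exp (- (\<sigma> * ln (real p)))"
      using p2 unfolding h_def powr_def by (simp add: algebra_simps exp_diff exp_minus field_simps)
    moreover have "1 - \<sigma> * ln (real p) \<le> exp (- (\<sigma> * ln (real p)))"
      using exp_ge_add_one_self[of "- (\<sigma> * ln (real p))"] by simp
    ultimately have "h p \<ge> (1 / real p) * (1 - \<sigma> * ln (real p))"
      using p2 by (simp add: divide_right_mono)
    then have A: "1 / real p - h p \<le> \<sigma> * (ln (real p) / real p)" by (simp add: algebra_simps)
    have "(1 - h p) * inverse (1 - 1 / real p) = 1 + (1 / real p - h p) * inverse (1 - 1 / real p)"
      using p2 by (simp add: field_simps)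
    also have "\<dots> \<le> 1 + (\<sigma> * (ln (real p) / real p)) * inverse (1 - 1 / real p)"
      using A p2 by (intro add_left_mono mult_right_mono) auto
    also have "\<dots> \<le> 1 + (\<sigma> * (ln (real p) / real p)) * 2"
      using \<sigma> p2 by (intro add_left_mono mult_left_mono) (auto simp: field_simps)
    also have "\<dots> \<le> exp (2 * \<sigma> * (ln (real p) / real p))"
      using exp_ge_add_one_self[of "2 * \<sigma> * (ln (real p) / real p)"] by (simp add: mult_ac)
    finally show ?thesis .
  qed
  have eq: "?P = {p. prime p \<and> 1 < real p \<and> real p \<le> real u}"
    by (auto dest: prime_gt_1_nat)
  have "euler_prod u \<le> euler_prod u * ((\<Prod>p\<in>?P. 1 - h p) * (1 + ln (real u)))"
  proof -
    have "0 \<le> euler_prod u" unfolding euler_prod_def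
      by (intro prod_nonneg) (auto dest: prime_ge_1_nat)
    from mult_left_mono[OF 1 this] show ?thesis by simp
  qed
  also have "\<dots> = (\<Prod>p\<in>?P. (1 - h p) * inverse (1 - 1 / real p)) * (1 + ln (real u))"
    by (simp add: euler_prod_def prod.distrib)
  also have "\<dots> \<le> (\<Prod>p\<in>?P. exp (2 * \<sigma> * (ln (real p) / real p))) * (1 + ln (real u))"
  proof (intro mult_right_mono prod_mono conjI hp)
    show "0 \<le> (1 - h p) * inverse (1 - 1 / real p)" if "p \<in> ?P" for p
      using that \<sigma> powr_mono[of "- (1 + \<sigma>)" 0 "real p"]
      by (auto simp: h_def dest: prime_ge_1_nat intro!: mult_nonneg_nonneg)
  qed (use lnu in auto)
  also have "(\<Prod>p\<in>?P. exp (2 * \<sigma> * (ln (real p) / real p))) = exp (2 * \<sigma> * (\<Sum>p\<in>?P. ln (real p) / real p))"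
    by (simp add: exp_sum sum_distrib_left)
  also have "2 * \<sigma> * (\<Sum>p\<in>?P. ln (real p) / real p) \<le> 2 * \<sigma> * (2 * ln (real u) + 4 * ln 2)"
    using sum_ln_over_primes_le[of 1 "real u"] assms \<sigma> unfolding eq
    by (intro mult_left_mono) auto
  also have "\<dots> \<le> 24"
    using lnu ln2_le_25_over_36 by (simp add: \<sigma>_def field_simps)
  also have "exp 24 * (1 + ln (real u)) \<le> exp 24 * (3 * ln (real u))"
    using lnu by (intro mult_left_mono) auto
  finally show ?thesis using lnu by simp
qed

text \<open>A number divisible by \<open>p\<close> is \<open>p\<close> times a smaller admissible
  number, so the sum \<open>S\<close> for \<open>insert p P\<close> and the sum \<open>S'\<close>
  for \<open>P\<close> satisfy \<open>S \<le> S' + S / p\<close>. Truncation at \<open>N\<close>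
  keeps both finite.\<close>

lemma sum_inverse_smooth_le:
  assumes "finite P" "\<And>p. p \<in> P \<Longrightarrow> prime (p::nat)"
  shows "(\<Sum>n | n \<in> {1..N} \<and> prime_factors n \<subseteq> P. 1 / real n) \<le> (\<Prod>p\<in>P. inverse (1 - 1 / real p))"
  using assms
proof (induction P arbitrary: N rule: finite_induct)
  case empty
  have "{n. n \<in> {1..N} \<and> prime_factors n \<subseteq> {}} \<subseteq> {1}"
    by (auto simp: prime_factorization_empty_iff)
  then have "(\<Sum>n | n \<in> {1..N} \<and> prime_factors n \<subseteq> {}. 1 / real n) \<le> (\<Sum>n\<in>{1}. 1 / real n)"
    by (intro sum_mono2) auto
  then show ?case by simp
next
  case (insert p P)
  let ?S = "\<lambda>N P. {n. n \<in> {1..N} \<and> prime_factors n \<subseteq> P}"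
  have p: "prime p" using insert by auto
  have "?S N (insert p P) \<subseteq> ?S N P \<union> (*) p ` ?S N (insert p P)"
  proof
    fix n assume n: "n \<in> ?S N (insert p P)"
    show "n \<in> ?S N P \<union> (*) p ` ?S N (insert p P)"
    proof (cases "p dvd n")
      case True
      then obtain m where m: "n = p * m" by blast
      have "prime_factors m \<subseteq> prime_factors n" using m n by (intro dvd_prime_factors) auto
      moreover have "m \<le> n" "m \<ge> 1" using m n p by (auto dest: prime_gt_0_nat)
      ultimately have "m \<in> ?S N (insert p P)" using n by auto
      then show ?thesis using m by blast
    next
      case False
      then show ?thesis using n by (auto simp: in_prime_factors_iff)
    qed
  qed
  then have "(\<Sum>n\<in>?S N (insert p P). 1 / real n) \<le> (\<Sum>n\<in>?S N P \<union> (*) p ` ?S N (insert p P). 1 / real n)"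
    by (intro sum_mono2) auto
  also have "\<dots> \<le> (\<Sum>n\<in>?S N P. 1 / real n) + (\<Sum>n\<in>(*) p ` ?S N (insert p P). 1 / real n)"
    by (subst sum_Un) (auto intro!: sum_nonneg)
  also have "(\<Sum>n\<in>(*) p ` ?S N (insert p P). 1 / real n) = (\<Sum>n\<in>?S N (insert p P). 1 / real (p * n))"
    using p by (subst sum.reindex) (auto simp: inj_on_def dest: prime_gt_0_nat)
  also have "\<dots> = 1 / real p * (\<Sum>n\<in>?S N (insert p P). 1 / real n)"
    by (simp add: sum_distrib_left)
  finally have "(\<Sum>n\<in>?S N (insert p P). 1 / real n) * (1 - 1 / real p) \<le> (\<Sum>n\<in>?S N P. 1 / real n)"
    by (simp add: algebra_simps)
  also have "\<dots> \<le> (\<Prod>p\<in>P. inverse (1 - 1 / real p))" using insert by auto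
  finally have "(\<Sum>n\<in>?S N (insert p P). 1 / real n) \<le> (\<Prod>p\<in>P. inverse (1 - 1 / real p)) / (1 - 1 / real p)"
    using prime_factor_bounds[OF p] by (subst pos_le_divide_eq) auto
  then show ?case using insert by (simp add: field_simps)
qed

text \<open>Every \<open>n\<close> up to \<open>u\<close> has all its prime factors up to
  \<open>u\<close>, so the product dominates the harmonic sum.\<close>

lemma euler_prod_ge: "ln (real u + 1) \<le> euler_prod u"
proof -
  have "ln (real u + 1) \<le> harm u" using ln_le_harm .
  also have "harm u = (\<Sum>n | n \<in> {1..u} \<and> prime_factors n \<subseteq> {p. prime p \<and> p \<le> u}. 1 / real n)"
    unfolding harm_def
  proof (intro sum.cong)
    show "{1..u} = {n \<in> {1..u}. prime_factors n \<subseteq> {p. prime p \<and> p \<le> u}}"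
    proof (intro equalityI subsetI CollectI conjI)
      fix n p assume "n \<in> {1..u}" "p \<in> prime_factors n"
      then show "prime p" "p \<le> u"
        by (auto simp: in_prime_factors_iff intro: order_trans[OF dvd_imp_le])
    qed auto
  qed (auto simp: field_simps)
  also have "\<dots> \<le> euler_prod u"
    unfolding euler_prod_def by (rule sum_inverse_smooth_le) auto
  finally show ?thesis .
qed

section \<open>Real characters and the hyperbola method\<close>

text \<open>Abel summation: the differences of \<open>f\<close> are nonnegative and telescope, which
  leaves only its first value.\<close>

lemma sum_mult_antimono_le:
  fixes c f :: "nat \<Rightarrow> real"
  assumes B: "\<And>k. \<bar>\<Sum>n\<in>{a..<k}. c n\<bar> \<le> B"
    and anti: "\<And>n. n \<ge> a \<Longrightarrow> f (Suc n) \<le> f n" and nonneg: "\<And>n. n \<ge> a \<Longrightarrow> f n \<ge> 0"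
  shows "\<bar>\<Sum>n\<in>{a..<b}. c n * f n\<bar> \<le> B * f a"
proof (cases "a \<le> b")
  case True
  define C where "C k = (\<Sum>n\<in>{a..<k}. c n)" for k
  have eq: "(\<Sum>n\<in>{a..<b}. c n * f n) = C b * f b + (\<Sum>n\<in>{a..<b}. C (Suc n) * (f n - f (Suc n)))"
    using True
  proof (induction b rule: dec_induct)
    case base
    then show ?case by (simp add: C_def)
  next
    case (step b)
    then show ?case by (simp add: C_def algebra_simps)
  qed
  have "\<bar>\<Sum>n\<in>{a..<b}. c n * f n\<bar> \<le> \<bar>C b * f b\<bar> + \<bar>\<Sum>n\<in>{a..<b}. C (Suc n) * (f n - f (Suc n))\<bar>"
    unfolding eq by (rule abs_triangle_ineq)
  also have "\<dots> \<le> B * f b + (\<Sum>n\<in>{a..<b}. B * (f n - f (Suc n)))"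
  proof (intro add_mono order_trans[OF sum_abs] sum_mono)
    show "\<bar>C b * f b\<bar> \<le> B * f b"
      using B[of b] nonneg[of b] True by (simp add: abs_mult C_def mult_right_mono)
    show "\<bar>C (Suc n) * (f n - f (Suc n))\<bar> \<le> B * (f n - f (Suc n))" if "n \<in> {a..<b}" for n
      using B[of "Suc n"] anti[of n] that by (simp only: abs_mult C_def) (intro mult_mono, auto)
  qed
  also have "(\<Sum>n\<in>{a..<b}. B * (f n - f (Suc n))) = B * (f a - f b)"
    using True by (simp add: sum_distrib_left[symmetric] sum_Suc_diff'[where f = "\<lambda>n. - f n", simplified])
  finally show ?thesis by (simp add: algebra_simps)
next
  case False
  then show ?thesis using B[of a] nonneg[of a] by simp
qed

text \<open>The character with values in the reals, where the estimates by inequalities take place;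
  \<open>real_char_Re\<close> provides the passage from the complex-valued one.\<close>

locale real_char =
  fixes q :: nat and chi :: "nat \<Rightarrow> real"
  assumes q_pos: "q > 0"
    and mult: "chi (m * n) = chi m * chi n"
    and periodic: "chi (n + q) = chi n"
    and nonzero: "chi n \<noteq> 0 \<longleftrightarrow> coprime n q"
begin

lemma chi_1 [simp]: "chi 1 = 1"
proof -
  have "chi 1 \<noteq> 0" by (subst nonzero) auto
  moreover have "chi 1 = chi 1 * chi 1" using mult[of 1 1] by simp
  ultimately show ?thesis by simp
qed

lemma chi_Suc_0 [simp]: "chi (Suc 0) = 1" using chi_1 by simp

lemma chi_add_mult: "chi (n + k * q) = chi n"
proof (induction k)
  case (Suc k)
  have eq: "n + Suc k * q = (n + k * q) + q" by simp
  show ?case unfolding eq periodic by (rule Suc)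
qed simp

lemma chi_mod [simp]: "chi (n mod q) = chi n"
  using chi_add_mult[of "n mod q" "n div q"] by simp

lemma chi_cong: "[m = n] (mod q) \<Longrightarrow> chi m = chi n"
  by (metis chi_mod cong_def)

lemma chi_power: "chi (n ^ k) = chi n ^ k"
  by (induction k) (auto simp: mult)

lemma chi_cases: "chi n = 0 \<or> chi n = 1 \<or> chi n = -1"
proof (cases "coprime n q")
  case True
  have "chi (n ^ totient q) = chi 1" using euler_theorem[OF True] by (rule chi_cong)
  then have "chi n ^ totient q = 1" by (simp add: chi_power)
  moreover have "totient q > 0" using q_pos by simp
  ultimately have "\<bar>chi n\<bar> = 1" using power_eq_1_iff[of "chi n" "totient q"] by auto
  then show ?thesis by linarith
qed (use nonzero in auto)

lemma abs_chi_le: "\<bar>chi n\<bar> \<le> 1"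
  using chi_cases[of n] by auto

definition lam :: "nat \<Rightarrow> real" where
  "lam n = (\<Sum>d | d dvd n. chi d)"

lemma lam_1 [simp]: "lam 1 = 1"
  by (simp add: lam_def)

lemma lam_mult:
  assumes "coprime a b" "a > 0" "b > 0"
  shows "lam (a * b) = lam a * lam b"
proof -
  let ?f = "\<lambda>(x::nat, y). x * y"
  have "{d. d dvd a * b} = ?f ` ({x. x dvd a} \<times> {y. y dvd b})"
    using division_decomp[of _ a b] by (auto intro: mult_dvd_mono)
  moreover have "inj_on ?f ({x. x dvd a} \<times> {y. y dvd b})"
  proof (rule inj_onI, clarify)
    fix x y x' y' assume *: "x dvd a" "y dvd b" "x' dvd a" "y' dvd b" "x * y = x' * y'"
    have cop: "coprime x y'" "coprime x' y"
      using assms(1) * coprime_divisors by blast+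
    have "x dvd x'" using * cop by (metis coprime_dvd_mult_left_iff dvd_triv_left)
    moreover have "x' dvd x" using * cop by (metis coprime_dvd_mult_left_iff dvd_triv_left)
    ultimately have "x = x'" by (rule dvd_antisym)
    moreover have "x > 0" using *(1) assms(2) by (auto intro: Nat.gr0I)
    ultimately show "x = x' \<and> y = y'" using * by auto
  qed
  ultimately have "lam (a * b) = (\<Sum>(x, y)\<in>{x. x dvd a} \<times> {y. y dvd b}. chi (x * y))"
    unfolding lam_def by (simp only: sum.reindex) (simp add: case_prod_unfold o_def)
  then show ?thesis
    by (simp add: lam_def mult sum_product sum.cartesian_product)
qed

lemma lam_prime_power: "prime p \<Longrightarrow> lam (p ^ k) = (\<Sum>i\<le>k. chi p ^ i)"
proof -
  assume p: "prime p"
  have "{d. d dvd p ^ k} = (\<lambda>i. p ^ i) ` {..k}"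
    using p by (auto simp: divides_primepow_nat)
  moreover have "inj_on (\<lambda>i. p ^ i) {..k}"
    using prime_gt_1_nat[OF p] by (auto simp: inj_on_def)
  ultimately show ?thesis by (simp add: lam_def sum.reindex chi_power)
qed

lemma lam_mult_prime:
  assumes "prime p" "\<not> p dvd m" "m > 0" "chi p = 1"
  shows "lam (m * p) = 2 * lam m"
proof -
  have "coprime m p" using assms prime_imp_coprime[of p m] by (simp add: coprime_commute)
  then have "lam (m * p) = lam m * lam p"
    using assms by (intro lam_mult) (auto dest: prime_gt_0_nat)
  also have "lam p = 2" using lam_prime_power[of p 1] assms by simp
  finally show ?thesis by simp
qed

text \<open>By multiplicativity it suffices to look at prime powers, where \<open>lam\<close> is 1,
  \<open>k + 1\<close> or an alternating sum equal to 0 or 1, according to \<open>chi p\<close>. The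
  divisors of 0 form an infinite set, so \<open>lam 0\<close> is the default value 0.\<close>

lemma lam_nonneg: "lam n \<ge> 0"
proof (cases "n = 0")
  case False
  then show ?thesis
  proof (induction n rule: less_induct)
    case (less n)
    show ?case
    proof (cases "n = 1")
      case False
      then obtain p where p: "prime p" "p dvd n" using prime_factor_nat by blast
      obtain m where m: "n = p ^ multiplicity p n * m" "\<not> p dvd m"
        using multiplicity_decompose'[of n p] p less.prems by (metis not_prime_unit)
      define k where "k = multiplicity p n"
      have "coprime (p ^ k) m" using p m(2) by (simp add: prime_imp_coprime)
      then have "lam n = lam (p ^ k) * lam m"
        using m less.prems p unfolding k_def[symmetric]
        by (metis lam_mult mult_eq_0_iff neq0_conv)
      moreover have "lam (p ^ k) \<ge> 0"
      proof -
        have "(\<Sum>i\<le>k. (-1::real) ^ i) = (if even k then 1 else 0)" by (induction k) auto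
        then show ?thesis using chi_cases[of p] p(1)
          by (auto simp: lam_prime_power sum_nonneg)
      qed
      moreover have "lam m \<ge> 0"
      proof (rule less.IH)
        have "k > 0" using p less.prems by (simp add: k_def prime_multiplicity_gt_zero_iff)
        then have "p ^ k > 1" using p(1) prime_gt_1_nat one_less_power by blast
        moreover have "m > 0" using m less.prems by (cases m) auto
        ultimately show "m < n" using m(1) unfolding k_def[symmetric]
          by (metis mult.commute nat_mult_less_cancel1 nat_mult_1_right)
        show "m \<noteq> 0" using \<open>m > 0\<close> by simp
      qed
      ultimately show ?thesis by simp
    qed (simp del: One_nat_def)
  qed
qed (simp add: lam_def)

end

locale nonprincipal_real_char = real_char +
  assumes nonprincipal: "\<exists>n. coprime n q \<and> chi n \<noteq> 1"
begin

lemma ex_minus_1: obtains b where "coprime b q" "chi b = -1"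
proof -
  from nonprincipal obtain n where n: "coprime n q" "chi n \<noteq> 1" by blast
  then have "chi n = -1" using chi_cases[of n] nonzero[of n] by auto
  with n that show ?thesis by blast
qed

text \<open>Multiplication by some \<open>b\<close> with \<open>chi b = -1\<close> permutes the
  residues and flips the sign of the sum.\<close>

lemma sum_chi_period: "(\<Sum>n<q. chi n) = 0"
proof -
  obtain b where b: "coprime b q" "chi b = -1" by (rule ex_minus_1)
  have inj: "inj_on (\<lambda>n. b * n mod q) {..<q}"
  proof (rule inj_onI)
    fix x y assume "x \<in> {..<q}" "y \<in> {..<q}" "b * x mod q = b * y mod q"
    then have "[b * x = b * y] (mod q)" by (simp add: cong_def)
    then have "[x = y] (mod q)" using b by (simp add: cong_mult_lcancel_nat)
    then show "x = y" using \<open>x \<in> _\<close> \<open>y \<in> _\<close> by (simp add: cong_def)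
  qed
  have "(\<lambda>n. b * n mod q) ` {..<q} = {..<q}"
    using inj q_pos by (intro endo_inj_surj) auto
  then have "(\<Sum>n<q. chi n) = (\<Sum>n\<in>(\<lambda>n. b * n mod q) ` {..<q}. chi n)" by simp
  also have "\<dots> = (\<Sum>n<q. chi b * chi n)" using inj by (simp add: sum.reindex mult)
  also have "\<dots> = - (\<Sum>n<q. chi n)" using b by (simp add: sum_negf)
  finally show ?thesis by simp
qed

lemma sum_chi_mult_period: "(\<Sum>n<k * q. chi n) = 0"
proof (induction k)
  case (Suc k)
  have "(\<Sum>n<Suc k * q. chi n) = (\<Sum>n<k * q. chi n) + (\<Sum>n\<in>{k * q..<k * q + q}. chi n)"
    using sum.atLeastLessThan_concat[of 0 "k * q" "k * q + q" chi]
    by (simp add: atLeast0LessThan add.commute)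
  also have "(\<Sum>n\<in>{k * q..<k * q + q}. chi n) = (\<Sum>n\<in>{0..<q}. chi (n + k * q))"
    using sum.shift_bounds_nat_ivl[of chi 0 "k * q" q] by (simp add: add.commute)
  finally show ?case using Suc sum_chi_period by (simp add: chi_add_mult atLeast0LessThan)
qed simp

lemma abs_sum_chi_le: "\<bar>\<Sum>n<N. chi n\<bar> \<le> real q"
proof -
  define k where "k = N div q"
  have N: "k * q \<le> N" "N < k * q + q"
    using q_pos by (auto simp: k_def) (metis dividend_less_div_times mult.commute add.commute)
  have "(\<Sum>n<N. chi n) = (\<Sum>n<k * q. chi n) + (\<Sum>n\<in>{k * q..<N}. chi n)"
    using sum.atLeastLessThan_concat[of 0 "k * q" N chi] N by (simp add: atLeast0LessThan)
  then have "\<bar>\<Sum>n<N. chi n\<bar> = \<bar>\<Sum>n\<in>{k * q..<N}. chi n\<bar>" by (simp add: sum_chi_mult_period)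
  also have "\<dots> \<le> (\<Sum>n\<in>{k * q..<N}. 1)"
    by (intro order_trans[OF sum_abs] sum_mono abs_chi_le)
  also have "\<dots> = real (card {k * q..<N})" by (simp only: real_of_card)
  also have "\<dots> \<le> real q" using N by (simp only: card_atLeastLessThan of_nat_le_iff)
  finally show ?thesis .
qed

lemma abs_sum_chi_interval_le: "\<bar>\<Sum>n\<in>{a..<b}. chi n\<bar> \<le> 2 * real q"
proof (cases "a \<le> b")
  case True
  then have "(\<Sum>n\<in>{a..<b}. chi n) = (\<Sum>n<b. chi n) - (\<Sum>n<a. chi n)"
    using sum_diff_nat_ivl[of 0 a b chi] by (simp add: atLeast0LessThan)
  then show ?thesis using abs_sum_chi_le[of a] abs_sum_chi_le[of b] by linarith
qed auto

lemma abs_sum_chi_powr_le: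
  assumes "\<beta> \<ge> 0" "a \<ge> 1"
  shows "\<bar>\<Sum>n\<in>{a..<b}. chi n * real n powr - \<beta>\<bar> \<le> 2 * real q * real a powr - \<beta>"
proof (rule sum_mult_antimono_le[where f = "\<lambda>n. real n powr - \<beta>"])
  show "real (Suc n) powr - \<beta> \<le> real n powr - \<beta>" if "a \<le> n" for n
    using that assms by (intro powr_mono2') auto
qed (use abs_sum_chi_interval_le in auto)

text \<open>As the series sums to 0, a partial sum is minus its tail, and tails are small by Abel
  summation. This is how the zero of the L-function enters the real-variable argument.\<close>

lemma abs_partial_sum_le:
  assumes "\<beta> \<ge> 0" "a \<ge> 1" and zero: "(\<lambda>N. \<Sum>n<N. chi n * real n powr - \<beta>) \<longlonglongrightarrow> 0"
  shows "\<bar>\<Sum>n<a. chi n * real n powr - \<beta>\<bar> \<le> 2 * real q * real a powr - \<beta>"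
proof -
  let ?f = "\<lambda>n. chi n * real n powr - \<beta>"
  have "(\<lambda>N. (\<Sum>n<N. ?f n) - (\<Sum>n<a. ?f n)) \<longlonglongrightarrow> 0 - (\<Sum>n<a. ?f n)"
    by (intro tendsto_intros zero)
  then have "(\<lambda>N. \<bar>(\<Sum>n<N. ?f n) - (\<Sum>n<a. ?f n)\<bar>) \<longlonglongrightarrow> \<bar>0 - (\<Sum>n<a. ?f n)\<bar>"
    by (rule tendsto_rabs)
  moreover have "\<forall>\<^sub>F N in sequentially. \<bar>(\<Sum>n<N. ?f n) - (\<Sum>n<a. ?f n)\<bar> \<le> 2 * real q * real a powr - \<beta>"
    using eventually_ge_at_top[of a]
  proof eventually_elim
    case (elim N)
    then have "(\<Sum>n<N. ?f n) - (\<Sum>n<a. ?f n) = (\<Sum>n\<in>{a..<N}. ?f n)"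
      using sum_diff_nat_ivl[of 0 a N ?f] by (simp add: atLeast0LessThan)
    then show ?case using abs_sum_chi_powr_le[OF assms(1,2), of N] by simp
  qed
  ultimately have "\<bar>0 - (\<Sum>n<a. ?f n)\<bar> \<le> 2 * real q * real a powr - \<beta>"
    by (rule tendsto_upperbound) simp
  then show ?thesis by simp
qed

end

section \<open>Growth of the sums of \<open>lam\<close> and the primes with
  \<open>chi p = 1\<close>\<close>

definition zsum :: "real \<Rightarrow> nat \<Rightarrow> real" where
  "zsum \<delta> N = (\<Sum>n=1..N. real n powr (\<delta> - 1))"

text \<open>Euler-Maclaurin to first order: sum minus integral decreases, and it increases once the
  last term is taken away. Its values at \<open>k\<close> and \<open>l\<close> hence differ by at
  most \<open>k powr (\<delta> - 1)\<close>.\<close>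

lemma zsum_minus_pint:
  assumes "\<delta> \<le> 1" "1 \<le> k" "k \<le> l"
  shows "zsum \<delta> l - pint \<delta> (real l) \<le> zsum \<delta> k - pint \<delta> (real k)"
    and "zsum \<delta> k - pint \<delta> (real k) - real k powr (\<delta> - 1) \<le>
         zsum \<delta> l - pint \<delta> (real l) - real l powr (\<delta> - 1)"
proof -
  have step': "zsum \<delta> (Suc n) - pint \<delta> (real (Suc n)) \<le> zsum \<delta> n - pint \<delta> (real n) \<and>
     zsum \<delta> n - pint \<delta> (real n) - real n powr (\<delta> - 1) \<le>
     zsum \<delta> (Suc n) - pint \<delta> (real (Suc n)) - real (Suc n) powr (\<delta> - 1)" if "n \<ge> 1" for n
  proof -
    have "zsum \<delta> (Suc n) = zsum \<delta> n + real (Suc n) powr (\<delta> - 1)" by (simp add: zsum_def)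
    moreover have "real (Suc n) powr (\<delta> - 1) \<le> pint \<delta> (real (Suc n)) - pint \<delta> (real n)"
      using pint_diff_bounds(1)[of "real n" "real (Suc n)" \<delta>] that assms by simp
    moreover have "pint \<delta> (real (Suc n)) - pint \<delta> (real n) \<le> real n powr (\<delta> - 1)"
      using pint_diff_bounds(2)[of "real n" "real (Suc n)" \<delta>] that assms by simp
    ultimately show ?thesis by linarith
  qed
  have "zsum \<delta> l - pint \<delta> (real l) \<le> zsum \<delta> k - pint \<delta> (real k) \<and>
     zsum \<delta> k - pint \<delta> (real k) - real k powr (\<delta> - 1) \<le>
         zsum \<delta> l - pint \<delta> (real l) - real l powr (\<delta> - 1)"
    using assms(3)
  proof (induction l rule: dec_induct)
    case (step n)
    then show ?case using step' [of n] assms(2) by linarith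
  qed simp
  then show "zsum \<delta> l - pint \<delta> (real l) \<le> zsum \<delta> k - pint \<delta> (real k)"
    and "zsum \<delta> k - pint \<delta> (real k) - real k powr (\<delta> - 1) \<le>
         zsum \<delta> l - pint \<delta> (real l) - real l powr (\<delta> - 1)" by auto
qed

lemma zsum_minus_pint_bounds:
  assumes "\<delta> \<le> 1" "1 \<le> k"
  shows "0 \<le> zsum \<delta> k - pint \<delta> (real k)" "zsum \<delta> k - pint \<delta> (real k) \<le> 1"
proof -
  have "zsum \<delta> 1 - pint \<delta> (real 1) = 1" by (simp add: zsum_def)
  moreover have "real 1 powr (\<delta> - 1) = 1" "real k powr (\<delta> - 1) \<ge> 0" by auto
  ultimately show "zsum \<delta> k - pint \<delta> (real k) \<le> 1" "0 \<le> zsum \<delta> k - pint \<delta> (real k)"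
    using zsum_minus_pint[OF assms(1) order_refl assms(2)] by linarith+
qed

text \<open>The constant in the asymptotics of \<open>zsum\<close> is never named; the value of sum
  minus integral at \<open>X\<close> stands in for it. Rounding \<open>X / d\<close> down to
  \<open>X div d\<close> costs about one term of the sum.\<close>

lemma zsum_div_approx:
  assumes "0 \<le> \<delta>" "\<delta> \<le> 1" "1 \<le> d" "d \<le> X"
  shows "\<bar>zsum \<delta> (X div d) - pint \<delta> (real X / real d) - (zsum \<delta> X - pint \<delta> (real X))\<bar>
         \<le> 2 * real d powr (1 - \<delta>) * real X powr (\<delta> - 1)"
proof -
  define k where "k = X div d"
  have k1: "k \<ge> 1" using assms by (simp add: k_def div_greater_zero_iff Suc_le_eq)
  have kX: "k \<le> X" by (simp add: k_def)
  have kd: "k * d \<le> X" "X < (k + 1) * d"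
    using assms by (auto simp: k_def dividend_less_times_div algebra_simps)
  then have "real k * real d \<le> real X" "real X < (real k + 1) * real d"
    by (metis of_nat_le_iff of_nat_mult, metis of_nat_less_iff of_nat_mult of_nat_add of_nat_1)
  then have t: "real k \<le> real X / real d" "real X / real d \<le> real k + 1"
    using assms by (auto simp: field_simps)
  have "pint \<delta> (real X / real d) - pint \<delta> (real k) \<le> (real X / real d - real k) * real k powr (\<delta> - 1)"
    using t k1 assms by (intro pint_diff_bounds) auto
  also have "\<dots> \<le> 1 * real k powr (\<delta> - 1)" using t by (intro mult_right_mono) auto
  finally have 1: "pint \<delta> (real X / real d) - pint \<delta> (real k) \<le> real k powr (\<delta> - 1)" by simp
  have "(real X / real d - real k) * (real X / real d) powr (\<delta> - 1) \<ge> 0" using t by simp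
  then have 2: "0 \<le> pint \<delta> (real X / real d) - pint \<delta> (real k)"
    using pint_diff_bounds(1)[of "real k" "real X / real d" \<delta>] t k1 assms by linarith
  have "real X powr (\<delta> - 1) \<ge> 0" by simp
  then have "\<bar>zsum \<delta> k - pint \<delta> (real X / real d) - (zsum \<delta> X - pint \<delta> (real X))\<bar> \<le> real k powr (\<delta> - 1)"
    using 1 2 zsum_minus_pint[OF assms(2) k1 kX] by linarith
  \<comment> \<open>From \<open>X / d \<le> k + 1 \<le> 2 * k\<close>.\<close>
  also have "real k powr (\<delta> - 1) \<le> (real X / (2 * real d)) powr (\<delta> - 1)"
  proof (rule powr_mono2')
    have "real X / (2 * real d) = real X / real d / 2" by simp
    then show "real X / (2 * real d) \<le> real k" using t k1 by linarith
  qed (use assms in auto)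
  also have "\<dots> = real X powr (\<delta> - 1) * (2 * real d) powr (1 - \<delta>)"
    using assms by (simp add: powr_divide powr_diff field_simps)
  also have "\<dots> \<le> real X powr (\<delta> - 1) * (2 * real d powr (1 - \<delta>))"
    using assms powr_mono[of "1 - \<delta>" 1 "2::real"]
    by (intro mult_left_mono) (simp_all add: powr_mult mult_right_mono)
  finally show ?thesis by (simp add: k_def mult_ac)
qed

context nonprincipal_real_char
begin

definition lsum :: "real \<Rightarrow> nat \<Rightarrow> real" where
  "lsum \<delta> X = (\<Sum>n=1..X. lam n * real n powr (\<delta> - 1))"

lemma lsum_eq_sum_sum:
  "lsum \<delta> X = (\<Sum>m=1..X. \<Sum>d=1..X div m. chi d * real d powr (\<delta> - 1) * real m powr (\<delta> - 1))"
proof -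
  have "lsum \<delta> X = (\<Sum>n=1..X. \<Sum>d | d dvd n. chi d * real n powr (\<delta> - 1))"
    by (simp add: lsum_def lam_def sum_distrib_right)
  also have "\<dots> = (\<Sum>(n, d)\<in>(SIGMA n:{1..X}. {d. d dvd n}). chi d * real n powr (\<delta> - 1))"
    by (subst sum.Sigma) (auto intro: finite_divisors_nat)
  also have "\<dots> = (\<Sum>(m, d)\<in>(SIGMA m:{1..X}. {1..X div m}). chi d * real d powr (\<delta> - 1) * real m powr (\<delta> - 1))"
  proof (rule sum.reindex_bij_witness[where i = "\<lambda>(m, d). (m * d, d)" and j = "\<lambda>(n, d). (n div d, d)"])
    fix a assume "a \<in> (SIGMA n:{1..X}. {d. d dvd n})"
    then obtain m d where a: "a = (m * d, d)" "m * d \<ge> 1" "m * d \<le> X"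
      by (auto simp: dvd_def mult.commute)
    then have d: "d > 0" "m > 0" by (auto intro: Nat.gr0I)
    show "(case (case a of (n, d) \<Rightarrow> (n div d, d)) of (m, d) \<Rightarrow> (m * d, d)) = a"
      using a d by simp
    show "(case a of (n, d) \<Rightarrow> (n div d, d)) \<in> (SIGMA m:{1..X}. {1..X div m})"
      using a d by (auto simp: less_eq_div_iff_mult_less_eq mult.commute Suc_le_eq intro: le_trans[of m "m * d"])
    show "(case (case a of (n, d) \<Rightarrow> (n div d, d)) of (m, d) \<Rightarrow>
            chi d * real d powr (\<delta> - 1) * real m powr (\<delta> - 1)) =
          (case a of (n, d) \<Rightarrow> chi d * real n powr (\<delta> - 1))"
      using a d by (simp add: powr_mult mult_ac)
  next
    fix b assume "b \<in> (SIGMA m:{1..X}. {1..X div m})"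
    then obtain m d where b: "b = (m, d)" "m \<ge> 1" "d \<ge> 1" "d \<le> X div m" by auto
    show "(case (case b of (m, d) \<Rightarrow> (m * d, d)) of (n, d) \<Rightarrow> (n div d, d)) = b"
      using b by simp
    show "(case b of (m, d) \<Rightarrow> (m * d, d)) \<in> (SIGMA n:{1..X}. {d. d dvd n})"
      using b by (auto simp: less_eq_div_iff_mult_less_eq mult.commute Suc_le_eq)
  qed
  also have "\<dots> = (\<Sum>m=1..X. \<Sum>d=1..X div m. chi d * real d powr (\<delta> - 1) * real m powr (\<delta> - 1))"
    by (subst sum.Sigma) auto
  finally show ?thesis .
qed

text \<open>The pairs \<open>(m, d)\<close> with \<open>m * d \<le> X\<close> are split at
  \<open>d = D\<close>. For \<open>d > D\<close> the sum over \<open>d\<close> is taken first and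
  cancels by the oscillation of \<open>chi\<close>, uniformly in \<open>m\<close>; the remaining sum
  over \<open>m\<close> is then bounded trivially.\<close>

lemma lsum_hyperbola:
  assumes "\<delta> \<le> 1" "1 \<le> D" "D \<le> X"
  shows "\<bar>lsum \<delta> X - (\<Sum>d=1..D. chi d * real d powr (\<delta> - 1) * zsum \<delta> (X div d))\<bar>
         \<le> 2 * real q * real D powr (\<delta> - 1) * zsum \<delta> X"
proof -
  let ?g = "\<lambda>d. chi d * real d powr (\<delta> - 1)"
  let ?h = "\<lambda>m. real m powr (\<delta> - 1)"
  have split: "(\<Sum>d=1..X div m. ?g d * ?h m) =
      (\<Sum>d=1..D. if d * m \<le> X then ?g d * ?h m else 0) + (\<Sum>d\<in>{D<..X div m}. ?g d) * ?h m"
    if "m \<in> {1..X}" for m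
  proof -
    have "{1..X div m} = {d\<in>{1..D}. d * m \<le> X} \<union> {D<..X div m}"
      using that assms by (intro equalityI subsetI) (auto simp: less_eq_div_iff_mult_less_eq)
    moreover have "(\<Sum>d\<in>{d\<in>{1..D}. d * m \<le> X} \<union> {D<..X div m}. ?g d * ?h m) =
       (\<Sum>d\<in>{d\<in>{1..D}. d * m \<le> X}. ?g d * ?h m) + (\<Sum>d\<in>{D<..X div m}. ?g d * ?h m)"
      by (rule sum.union_disjoint) auto
    ultimately have "(\<Sum>d=1..X div m. ?g d * ?h m) =
       (\<Sum>d\<in>{d\<in>{1..D}. d * m \<le> X}. ?g d * ?h m) + (\<Sum>d\<in>{D<..X div m}. ?g d * ?h m)"
      by simp
    then show ?thesis by (simp only: sum.inter_filter[OF finite_atLeastAtMost] sum_distrib_right)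
  qed
  have "lsum \<delta> X = (\<Sum>m=1..X. (\<Sum>d=1..D. if d * m \<le> X then ?g d * ?h m else 0) + (\<Sum>d\<in>{D<..X div m}. ?g d) * ?h m)"
    unfolding lsum_eq_sum_sum by (intro sum.cong refl split)
  also have "\<dots> = (\<Sum>m=1..X. \<Sum>d=1..D. if d * m \<le> X then ?g d * ?h m else 0) +
                   (\<Sum>m=1..X. (\<Sum>d\<in>{D<..X div m}. ?g d) * ?h m)"
    by (rule sum.distrib)
  also have "(\<Sum>m=1..X. \<Sum>d=1..D. if d * m \<le> X then ?g d * ?h m else 0) =
             (\<Sum>d=1..D. \<Sum>m=1..X. if d * m \<le> X then ?g d * ?h m else 0)"
    by (rule sum.swap)
  also have "\<dots> = (\<Sum>d=1..D. ?g d * zsum \<delta> (X div d))"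
  proof (rule sum.cong[OF refl])
    fix d assume d: "d \<in> {1..D}"
    have "(\<Sum>m=1..X. if d * m \<le> X then ?g d * ?h m else 0) = (\<Sum>m\<in>{m\<in>{1..X}. d * m \<le> X}. ?g d * ?h m)"
      by (simp only: sum.inter_filter[OF finite_atLeastAtMost])
    also have "{m\<in>{1..X}. d * m \<le> X} = {1..X div d}"
    proof (intro equalityI subsetI)
      fix m assume "m \<in> {1..X div d}"
      then have m: "1 \<le> m" "m \<le> X div d" by auto
      moreover have "m \<le> X" using m(2) div_le_dividend le_trans by blast
      ultimately show "m \<in> {m\<in>{1..X}. d * m \<le> X}"
        using d by (simp add: less_eq_div_iff_mult_less_eq mult.commute)
    qed (use d in \<open>auto simp: less_eq_div_iff_mult_less_eq mult.commute\<close>)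
    finally show "(\<Sum>m=1..X. if d * m \<le> X then ?g d * ?h m else 0) = ?g d * zsum \<delta> (X div d)"
      by (simp add: zsum_def sum_distrib_left)
  qed
  finally have "\<bar>lsum \<delta> X - (\<Sum>d=1..D. ?g d * zsum \<delta> (X div d))\<bar> =
       \<bar>\<Sum>m=1..X. (\<Sum>d\<in>{D<..X div m}. ?g d) * ?h m\<bar>" by simp
  also have "\<dots> \<le> (\<Sum>m=1..X. (2 * real q * real D powr (\<delta> - 1)) * ?h m)"
  proof (intro order_trans[OF sum_abs] sum_mono)
    fix m
    have "{D<..X div m} = {Suc D..<Suc (X div m)}" by auto
    then have "\<bar>\<Sum>d\<in>{D<..X div m}. ?g d\<bar> \<le> 2 * real q * real (Suc D) powr (\<delta> - 1)"
      using abs_sum_chi_powr_le[of "1 - \<delta>" "Suc D" "Suc (X div m)"] assms by simp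
    also have "\<dots> \<le> 2 * real q * real D powr (\<delta> - 1)"
      using assms by (intro mult_left_mono powr_mono2') auto
    finally show "\<bar>(\<Sum>d\<in>{D<..X div m}. ?g d) * ?h m\<bar> \<le> (2 * real q * real D powr (\<delta> - 1)) * ?h m"
      by (simp add: abs_mult mult_right_mono)
  qed
  also have "\<dots> = 2 * real q * real D powr (\<delta> - 1) * zsum \<delta> X"
    by (simp add: zsum_def sum_distrib_left)
  finally show ?thesis by simp
qed

(* In the difference the summand over d loses its dependence on d up to small errors, since
   pint(X/d) = pint(X/x) + (X/x)^delta * pint(x/d); the zero of the L-function then kills the main term. *)
lemma lsum_compare:
  assumes \<delta>: "0 \<le> \<delta>" "\<delta> \<le> 1" and D: "1 \<le> D" "D \<le> x" "x \<le> X"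
    and zero: "(\<lambda>N. \<Sum>n<N. chi n * real n powr (\<delta> - 1)) \<longlonglongrightarrow> 0"
    and \<kappa>: "\<kappa> = (real X / real x) powr \<delta>"
  shows "\<bar>lsum \<delta> X - \<kappa> * lsum \<delta> x\<bar> \<le>
      (pint \<delta> (real X / real x) + 1 + \<kappa>) * (2 * real q * real D powr (\<delta> - 1)) +
      2 * real D * (real X powr (\<delta> - 1) + \<kappa> * real x powr (\<delta> - 1)) +
      2 * real q * real D powr (\<delta> - 1) * (zsum \<delta> X + \<kappa> * zsum \<delta> x)"
proof -
  let ?g = "\<lambda>d. chi d * real d powr (\<delta> - 1)"
  let ?E = "\<lambda>X. zsum \<delta> X - pint \<delta> (real X)"
  define r where "r X d = zsum \<delta> (X div d) - pint \<delta> (real X / real d) - ?E X" for X d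
  define c where "c = pint \<delta> (real X / real x) + ?E X - \<kappa> * ?E x"
  have k0: "\<kappa> \<ge> 0" using \<kappa> by simp
  have pos: "real X / real x \<ge> 1" "X \<ge> 1" "x \<ge> 1" using D by auto
  have c: "\<bar>c\<bar> \<le> pint \<delta> (real X / real x) + 1 + \<kappa>"
  proof -
    have "?E X \<le> 1" "0 \<le> ?E X" "?E x \<le> 1" "0 \<le> ?E x"
      using zsum_minus_pint_bounds[OF \<delta>(2)] pos by auto
    moreover from this have "\<kappa> * ?E x \<le> \<kappa> * 1" "0 \<le> \<kappa> * ?E x"
      by (intro mult_left_mono mult_nonneg_nonneg k0; simp)+
    moreover have "pint \<delta> (real X / real x) \<ge> 0"
    proof -
      have "(real X / real x - 1) * (real X / real x) powr (\<delta> - 1) \<ge> 0" using pos by simp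
      also have "\<dots> \<le> pint \<delta> (real X / real x)"
        using pint_diff_bounds(1)[of 1 "real X / real x" \<delta>] pos \<delta> by simp
      finally show ?thesis .
    qed
    ultimately show ?thesis unfolding c_def by linarith
  qed
  have id: "zsum \<delta> (X div d) - \<kappa> * zsum \<delta> (x div d) = c + (r X d - \<kappa> * r x d)" if "d \<in> {1..D}" for d
  proof -
    have "pint \<delta> (real X / real d) = pint \<delta> ((real X / real x) * (real x / real d))"
      using that pos by simp
    also have "\<dots> = pint \<delta> (real X / real x) + \<kappa> * pint \<delta> (real x / real d)"
      unfolding \<kappa> using that pos by (intro pint_mult) auto
    finally show ?thesis by (simp add: r_def c_def algebra_simps)
  qed
  have r: "\<bar>r X d - \<kappa> * r x d\<bar> \<le> 2 * real d powr (1 - \<delta>) * (real X powr (\<delta> - 1) + \<kappa> * real x powr (\<delta> - 1))"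
    if "d \<in> {1..D}" for d
  proof -
    have "\<bar>r X d\<bar> \<le> 2 * real d powr (1 - \<delta>) * real X powr (\<delta> - 1)"
      unfolding r_def using that D \<delta> by (intro zsum_div_approx) auto
    moreover have "\<bar>\<kappa> * r x d\<bar> \<le> \<kappa> * (2 * real d powr (1 - \<delta>) * real x powr (\<delta> - 1))"
      unfolding r_def abs_mult abs_of_nonneg[OF k0] using that D \<delta> k0
      by (intro mult_left_mono zsum_div_approx) auto
    ultimately have "\<bar>r X d - \<kappa> * r x d\<bar> \<le> 2 * real d powr (1 - \<delta>) * real X powr (\<delta> - 1) +
          \<kappa> * (2 * real d powr (1 - \<delta>) * real x powr (\<delta> - 1))" by linarith
    then show ?thesis by (simp add: algebra_simps)
  qed
  have G: "\<bar>\<Sum>d=1..D. ?g d\<bar> \<le> 2 * real q * real D powr (\<delta> - 1)"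
  proof -
    have "{..<Suc D} = insert 0 {1..D}" by auto
    then have "(\<Sum>d<Suc D. ?g d) = (\<Sum>d=1..D. ?g d)"
      by (simp del: sum.lessThan_Suc)
    moreover have "\<bar>\<Sum>d<Suc D. ?g d\<bar> \<le> 2 * real q * real (Suc D) powr (\<delta> - 1)"
      using abs_partial_sum_le[of "1 - \<delta>" "Suc D"] zero \<delta> by simp
    moreover have "\<dots> \<le> 2 * real q * real D powr (\<delta> - 1)"
      using D \<delta> by (intro mult_left_mono powr_mono2') auto
    ultimately show ?thesis by linarith
  qed
  let ?T = "\<lambda>X. \<Sum>d=1..D. ?g d * zsum \<delta> (X div d)"
  have "?T X - \<kappa> * ?T x = (\<Sum>d=1..D. ?g d * (zsum \<delta> (X div d) - \<kappa> * zsum \<delta> (x div d)))"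
    by (simp add: sum_subtractf sum_distrib_left algebra_simps)
  also have "\<dots> = (\<Sum>d=1..D. ?g d * c + ?g d * (r X d - \<kappa> * r x d))"
    by (intro sum.cong refl) (simp only: id distrib_left)
  also have "\<dots> = c * (\<Sum>d=1..D. ?g d) + (\<Sum>d=1..D. ?g d * (r X d - \<kappa> * r x d))"
    by (simp add: sum.distrib sum_distrib_left mult_ac)
  finally have eq: "?T X - \<kappa> * ?T x = c * (\<Sum>d=1..D. ?g d) + (\<Sum>d=1..D. ?g d * (r X d - \<kappa> * r x d))" .
  have A: "\<bar>c * (\<Sum>d=1..D. ?g d)\<bar> \<le> (pint \<delta> (real X / real x) + 1 + \<kappa>) * (2 * real q * real D powr (\<delta> - 1))"
    unfolding abs_mult by (intro mult_mono c G) (use c in auto)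
  have B: "\<bar>\<Sum>d=1..D. ?g d * (r X d - \<kappa> * r x d)\<bar> \<le> 2 * real D * (real X powr (\<delta> - 1) + \<kappa> * real x powr (\<delta> - 1))"
  proof -
    have "\<bar>?g d * (r X d - \<kappa> * r x d)\<bar> \<le> 2 * (real X powr (\<delta> - 1) + \<kappa> * real x powr (\<delta> - 1))"
      if d: "d \<in> {1..D}" for d
    proof -
      have "\<bar>?g d * (r X d - \<kappa> * r x d)\<bar> = \<bar>chi d\<bar> * (real d powr (\<delta> - 1) * \<bar>r X d - \<kappa> * r x d\<bar>)"
        by (simp add: abs_mult)
      also have "\<dots> \<le> 1 * (real d powr (\<delta> - 1) *
           (2 * real d powr (1 - \<delta>) * (real X powr (\<delta> - 1) + \<kappa> * real x powr (\<delta> - 1))))"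
        using r[OF d] abs_chi_le[of d] by (intro mult_mono) auto
      also have "\<dots> = (real d powr (\<delta> - 1) * real d powr (1 - \<delta>)) * (2 * (real X powr (\<delta> - 1) + \<kappa> * real x powr (\<delta> - 1)))"
        by (simp only: mult_1 mult_ac)
      also have "real d powr (\<delta> - 1) * real d powr (1 - \<delta>) = 1"
        using d by (simp flip: powr_add)
      finally show ?thesis by simp
    qed
    then have "\<bar>\<Sum>d=1..D. ?g d * (r X d - \<kappa> * r x d)\<bar> \<le> (\<Sum>d=1..D. 2 * (real X powr (\<delta> - 1) + \<kappa> * real x powr (\<delta> - 1)))"
      by (intro order_trans[OF sum_abs] sum_mono) auto
    then show ?thesis by (simp add: algebra_simps)
  qed
  have C1: "\<bar>lsum \<delta> X - ?T X\<bar> \<le> 2 * real q * real D powr (\<delta> - 1) * zsum \<delta> X"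
    using D \<delta> by (intro lsum_hyperbola) auto
  have "\<bar>\<kappa> * (lsum \<delta> x - ?T x)\<bar> \<le> \<kappa> * (2 * real q * real D powr (\<delta> - 1) * zsum \<delta> x)"
    unfolding abs_mult abs_of_nonneg[OF k0] using D \<delta> k0 by (intro mult_left_mono lsum_hyperbola) auto
  moreover have "lsum \<delta> X - \<kappa> * lsum \<delta> x = (lsum \<delta> X - ?T X) - \<kappa> * (lsum \<delta> x - ?T x) + (?T X - \<kappa> * ?T x)"
    by (simp add: algebra_simps)
  ultimately have "\<bar>lsum \<delta> X - \<kappa> * lsum \<delta> x\<bar> \<le>
      (pint \<delta> (real X / real x) + 1 + \<kappa>) * (2 * real q * real D powr (\<delta> - 1)) +
      2 * real D * (real X powr (\<delta> - 1) + \<kappa> * real x powr (\<delta> - 1)) +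
      (2 * real q * real D powr (\<delta> - 1) * zsum \<delta> X + \<kappa> * (2 * real q * real D powr (\<delta> - 1) * zsum \<delta> x))"
    using A B C1 eq by linarith
  also have "2 * real q * real D powr (\<delta> - 1) * zsum \<delta> X + \<kappa> * (2 * real q * real D powr (\<delta> - 1) * zsum \<delta> x) =
     2 * real q * real D powr (\<delta> - 1) * (zsum \<delta> X + \<kappa> * zsum \<delta> x)" by (simp add: algebra_simps)
  finally show ?thesis .
qed

lemma lsum_mult_ge:
  assumes "x \<ge> 1" "Y \<ge> 1"
  shows "lsum \<delta> x + lsum \<delta> x * (\<Sum>p | prime p \<and> x < p \<and> p \<le> Y \<and> chi p = 1. 2 * real p powr (\<delta> - 1))
         \<le> lsum \<delta> (x * Y)"
proof -
  let ?B = "{p. prime p \<and> x < p \<and> p \<le> Y \<and> chi p = 1}"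
  let ?f = "\<lambda>(m::nat, p). m * p"
  let ?F = "\<lambda>n. lam n * real n powr (\<delta> - 1)"
  have inj: "inj_on ?f ({1..x} \<times> ?B)"
  proof (rule inj_onI, clarify)
    fix m p m' p' assume *: "m \<in> {1..x}" "m' \<in> {1..x}" "m * p = m' * p'"
       "prime p" "x < p" "prime p'" "x < p'"
    have "\<not> p dvd m'" using * by (auto dest: dvd_imp_le)
    moreover have "p dvd m' * p'" using * by (metis dvd_triv_right)
    ultimately have "p dvd p'" using * by (simp add: prime_dvd_mult_iff)
    then have "p = p'" using * by (simp add: primes_dvd_imp_eq)
    then show "m = m' \<and> p = p'" using * by auto
  qed
  have "lsum \<delta> x * (\<Sum>p\<in>?B. 2 * real p powr (\<delta> - 1)) =
     (\<Sum>(m, p)\<in>{1..x} \<times> ?B. ?F m * (2 * real p powr (\<delta> - 1)))"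
    by (simp add: lsum_def sum_product sum.cartesian_product)
  also have "\<dots> = (\<Sum>(m, p)\<in>{1..x} \<times> ?B. ?F (m * p))"
  proof (intro sum.cong refl, clarify)
    fix m p assume *: "m \<in> {1..x}" "prime p" "x < p" "chi p = 1"
    then have "\<not> p dvd m" by (auto dest: dvd_imp_le)
    then show "?F m * (2 * real p powr (\<delta> - 1)) = ?F (m * p)"
      using * by (simp add: lam_mult_prime powr_mult)
  qed
  also have "\<dots> = (\<Sum>n\<in>?f ` ({1..x} \<times> ?B). ?F n)"
    by (subst sum.reindex[OF inj]) (simp add: case_prod_unfold o_def)
  also have "\<dots> \<le> (\<Sum>n\<in>{x<..x * Y}. ?F n)"
  proof (rule sum_mono2)
    show "?f ` ({1..x} \<times> ?B) \<subseteq> {x<..x * Y}"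
    proof clarify
      fix m p assume "m \<in> {1..x}" "x < p" "p \<le> Y"
      then have "1 * p \<le> m * p" "m * p \<le> x * Y" by (auto intro!: mult_le_mono simp del: mult_le_cancel2)
      with \<open>x < p\<close> have "x < m * p" by linarith
      with \<open>m * p \<le> x * Y\<close> show "m * p \<in> {x<..x * Y}" by simp
    qed
    show "0 \<le> ?F b" for b using lam_nonneg by simp
  qed simp
  also have "lsum \<delta> x + \<dots> = lsum \<delta> (x * Y)"
  proof -
    have "x \<le> x * Y" using assms by simp
    moreover have "{1..z} = {1..x} \<union> {x<..z}" if "x \<le> z" for z using that assms(1) by auto
    ultimately have "{1..x * Y} = {1..x} \<union> {x<..x * Y}" by blast
    then show ?thesis unfolding lsum_def by (simp only:) (rule sum.union_disjoint[symmetric], auto)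
  qed
  finally show ?thesis by simp
qed

lemma lsum_ge_1: "X \<ge> 1 \<Longrightarrow> lsum \<delta> X \<ge> 1"
proof -
  assume "X \<ge> 1"
  then have "(\<Sum>n\<in>{1}. lam n * real n powr (\<delta> - 1)) \<le> lsum \<delta> X"
    unfolding lsum_def by (intro sum_mono2) (auto simp: lam_nonneg)
  then show ?thesis by (simp del: One_nat_def)
qed

lemma pint_le: "\<delta> \<ge> 0 \<Longrightarrow> t \<ge> 1 \<Longrightarrow> pint \<delta> t \<le> t powr \<delta> * ln t"
proof (cases "\<delta> = 0")
  case False
  assume "\<delta> \<ge> 0" "t \<ge> 1"
  have "1 - \<delta> * ln t \<le> exp (- (\<delta> * ln t))"
    using exp_ge_add_one_self[of "- (\<delta> * ln t)"] by simp
  then have "t powr \<delta> * (1 - \<delta> * ln t) \<le> t powr \<delta> * exp (- (\<delta> * ln t))"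
    by (intro mult_left_mono) auto
  also have "\<dots> = 1" using \<open>t \<ge> 1\<close> by (simp add: powr_def flip: exp_add)
  finally show ?thesis using False \<open>\<delta> \<ge> 0\<close> by (simp add: pint_def field_simps)
qed (simp add: pint_def)

text \<open>The primes in question multiply \<open>lsum\<close> at \<open>x = q ^ 6\<close> by one
  plus twice their sum when passing to \<open>X = x * Y\<close>, whereas \<open>lsum_compare\<close>
  allows only the factor \<open>Y powr \<delta>\<close> up to small errors.\<close>

lemma sum_inverse_primes_le:
  assumes \<delta>: "0 \<le> \<delta>" "\<delta> \<le> 1 / 4" and "q \<ge> 2" "Y \<ge> 1"
    and small: "\<delta> * ln (real (q ^ 6 * Y)) \<le> ln 2"
    and zero: "(\<lambda>N. \<Sum>n<N. chi n * real n powr (\<delta> - 1)) \<longlonglongrightarrow> 0"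
  shows "(\<Sum>p | prime p \<and> q ^ 6 < p \<and> p \<le> Y \<and> chi p = 1. 1 / real p)
         \<le> (exp (\<delta> * ln (real Y)) - 1) + (16 * ln (real (q ^ 6 * Y)) + 18) / real q"
proof -
  \<comment> \<open>For \<open>\<delta> \<le> 1 / 4\<close> the exponents 6 and 3 make both error
    quantities, \<open>q * D powr (\<delta> - 1)\<close> and
    \<open>D * x powr (\<delta> - 1)\<close>, at most \<open>1 / q\<close>.\<close>
  define x where "x = q ^ 6"
  define D where "D = q ^ 3"
  define X where "X = x * Y"
  define L where "L = ln (real X)"
  define \<kappa> where "\<kappa> = (real X / real x) powr \<delta>"
  let ?R = "\<Sum>p | prime p \<and> x < p \<and> p \<le> Y \<and> chi p = 1. 2 * real p powr (\<delta> - 1)"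
  have D: "1 \<le> D" "D \<le> x" "x \<le> X" "1 \<le> x" "1 \<le> X" "Y \<le> X"
    using assms by (auto simp: D_def x_def X_def intro: power_increasing)
  have Xx: "real X / real x = real Y" using D by (simp add: X_def)
  have \<kappa>: "\<kappa> = exp (\<delta> * ln (real Y))" using assms by (simp add: \<kappa>_def Xx powr_def)
  have lnY: "0 \<le> ln (real Y)" "ln (real Y) \<le> L" "0 \<le> L" "ln (real x) \<le> L" "0 \<le> ln (real x)"
    using assms D unfolding L_def by (auto intro!: ln_mono)
  have le2: "real Z powr \<delta> \<le> 2" if "Z \<ge> 1" "ln (real Z) \<le> L" for Z
  proof -
    have "\<delta> * ln (real Z) \<le> ln 2"
      using mult_left_mono[OF that(2) \<delta>(1)] small by (simp add: L_def X_def x_def)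
    then have "exp (\<delta> * ln (real Z)) \<le> exp (ln 2)" by (simp only: exp_le_cancel_iff)
    then show ?thesis using that by (simp add: powr_def)
  qed
  have k: "1 \<le> \<kappa>" "\<kappa> \<le> 2"
    using le2[of Y] lnY assms \<delta> by (auto simp: \<kappa>_def Xx ge_one_powr_ge_zero)
  have pint2: "pint \<delta> (real Z) \<le> 2 * L" if "Z \<ge> 1" "ln (real Z) \<le> L" for Z
  proof -
    have "pint \<delta> (real Z) \<le> real Z powr \<delta> * ln (real Z)" using that \<delta> by (intro pint_le) auto
    also have "\<dots> \<le> 2 * L" using that le2[OF that] lnY by (intro mult_mono) auto
    finally show ?thesis .
  qed
  have z2: "zsum \<delta> Z \<le> 1 + 2 * L" if "Z \<ge> 1" "ln (real Z) \<le> L" for Z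
    using sum_powr_le_pint[of \<delta> Z] pint2[OF that] that \<delta> by (simp add: zsum_def)
  have q1: "real q \<ge> 1" using assms by simp
  have Dq: "real q * real D powr (\<delta> - 1) \<le> 1 / real q"
  proof -
    have "real D powr (\<delta> - 1) = real q powr (3 * (\<delta> - 1))"
    proof -
      have "real D = real q powr 3" using q1 by (simp add: D_def powr_numeral)
      then show ?thesis by (simp only: powr_powr)
    qed
    also have "\<dots> \<le> real q powr (-2)" using q1 \<delta> by (intro powr_mono) auto
    also have "\<dots> = 1 / real q ^ 2" using q1 by (simp add: powr_minus_divide powr_numeral)
    finally have "real q * real D powr (\<delta> - 1) \<le> real q * (1 / real q ^ 2)"
      by (intro mult_left_mono) auto
    then show ?thesis using q1 by (simp add: power2_eq_square)
  qed
  have xq: "real D * real x powr (\<delta> - 1) \<le> 1 / real q"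
  proof -
    have "real x powr (\<delta> - 1) = real q powr (6 * (\<delta> - 1))"
    proof -
      have "real x = real q powr 6" using q1 by (simp add: x_def powr_numeral)
      then show ?thesis by (simp only: powr_powr)
    qed
    also have "\<dots> \<le> real q powr (-4)" using q1 \<delta> by (intro powr_mono) auto
    also have "\<dots> = 1 / real q ^ 4" using q1 by (simp add: powr_minus_divide powr_numeral)
    finally have "real D * real x powr (\<delta> - 1) \<le> real q ^ 3 * (1 / real q ^ 4)"
      unfolding D_def of_nat_power by (rule mult_left_mono) simp
    then show ?thesis using q1 by (simp add: power_numeral_reduce)
  qed
  have Xx': "real X powr (\<delta> - 1) \<le> real x powr (\<delta> - 1)"
    using D \<delta> by (intro powr_mono2') auto
  have S1: "lsum \<delta> x \<ge> 1" using D by (intro lsum_ge_1)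
  have "lsum \<delta> X - \<kappa> * lsum \<delta> x \<le>
      (pint \<delta> (real X / real x) + 1 + \<kappa>) * (2 * real q * real D powr (\<delta> - 1)) +
      2 * real D * (real X powr (\<delta> - 1) + \<kappa> * real x powr (\<delta> - 1)) +
      2 * real q * real D powr (\<delta> - 1) * (zsum \<delta> X + \<kappa> * zsum \<delta> x)"
    using lsum_compare[OF \<delta>(1) _ D(1,2,3) zero \<kappa>_def] \<delta> by simp
  also have "\<dots> \<le> (2 * L + 1 + 2) * (2 * real q * real D powr (\<delta> - 1)) +
      2 * real D * (real x powr (\<delta> - 1) + 2 * real x powr (\<delta> - 1)) +
      2 * real q * real D powr (\<delta> - 1) * ((1 + 2 * L) + 2 * (1 + 2 * L))"
  proof (intro add_mono mult_left_mono mult_right_mono mult_mono Xx' z2)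
    show "pint \<delta> (real X / real x) \<le> 2 * L" unfolding Xx using lnY assms by (intro pint2) auto
    show "0 \<le> zsum \<delta> x" by (simp add: zsum_def sum_nonneg)
  qed (use k D lnY L_def in auto)
  also have "\<dots> = (16 * L + 12) * (real q * real D powr (\<delta> - 1)) + 6 * (real D * real x powr (\<delta> - 1))"
    by (simp add: algebra_simps)
  also have "\<dots> \<le> (16 * L + 12) * (1 / real q) + 6 * (1 / real q)"
    using lnY Dq xq by (intro add_mono mult_left_mono) auto
  also have "\<dots> = (16 * L + 18) / real q" by (simp add: add_divide_distrib)
  finally have e: "lsum \<delta> X - \<kappa> * lsum \<delta> x \<le> (16 * L + 18) / real q" .
  have e0: "(16 * L + 18) / real q \<ge> 0" using lnY by simp
  have "lsum \<delta> x * ?R \<le> (\<kappa> - 1) * lsum \<delta> x + (16 * L + 18) / real q"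
    using lsum_mult_ge[of x Y \<delta>] D assms e by (simp add: X_def algebra_simps)
  \<comment> \<open>As \<open>lsum \<delta> x \<ge> 1\<close>, the additive error becomes a multiple
    of \<open>lsum \<delta> x\<close>, which can then be cancelled.\<close>
  also have "\<dots> \<le> (\<kappa> - 1) * lsum \<delta> x + (16 * L + 18) / real q * lsum \<delta> x"
    using mult_left_mono[OF S1 e0] by simp
  also have "\<dots> = lsum \<delta> x * ((\<kappa> - 1) + (16 * L + 18) / real q)" by (simp add: algebra_simps)
  finally have R: "?R \<le> (\<kappa> - 1) + (16 * L + 18) / real q" using S1 by simp
  have "(\<Sum>p | prime p \<and> x < p \<and> p \<le> Y \<and> chi p = 1. 1 / real p) \<le> ?R"
  proof (rule sum_mono)
    fix p assume "p \<in> {p. prime p \<and> x < p \<and> p \<le> Y \<and> chi p = 1}"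
    then have p: "real p \<ge> 1" using prime_ge_1_nat by auto
    have "1 / real p = real p powr (-1)" using p by (simp add: powr_minus_divide)
    also have "\<dots> \<le> real p powr (\<delta> - 1)" using p \<delta> by (intro powr_mono) auto
    also have "\<dots> \<le> 2 * real p powr (\<delta> - 1)" by simp
    finally show "1 / real p \<le> 2 * real p powr (\<delta> - 1)" .
  qed
  with R show ?thesis by (simp add: \<kappa> L_def X_def x_def)
qed

end

section \<open>Dirichlet series to the left of Re s = 1\<close>

lemma norm_powr_diff_le:
  assumes "n \<ge> 1" "Re s > 0"
  shows "norm (of_nat n powr - s - of_nat (Suc n) powr - s :: complex) \<le> norm s * real n powr (- Re s - 1)"
proof -
  let ?S = "closed_segment (of_nat n) (of_nat (Suc n)) :: complex set"
  have S: "\<exists>x. z = of_real x \<and> real n \<le> x" if "z \<in> ?S" for z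
  proof -
    have "z \<in> of_real ` closed_segment (real n) (real (Suc n))"
      using that by (metis closed_segment_of_real of_real_of_nat_eq)
    then obtain x where "z = of_real x" "x \<in> closed_segment (real n) (real (Suc n))" by blast
    then show ?thesis by (auto simp: closed_segment_eq_real_ivl)
  qed
  have "norm (of_nat n powr - s - of_nat (Suc n) powr - s :: complex) \<le>
      (norm s * real n powr (- Re s - 1)) * norm (of_nat n - of_nat (Suc n) :: complex)"
  proof (rule field_differentiable_bound[of ?S "\<lambda>z. z powr - s" "\<lambda>z. - s * z powr (- s - 1)"])
    fix z assume "z \<in> ?S"
    then obtain x where x: "z = of_real x" "real n \<le> x" using S by blast
    then have "z \<notin> \<real>\<^sub>\<le>\<^sub>0" using assms by auto
    then show "((\<lambda>z. z powr - s) has_field_derivative - s * z powr (- s - 1)) (at z within ?S)"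
      by (intro DERIV_subset[OF has_field_derivative_powr]) auto
    have "norm (z powr (- s - 1)) = x powr (- Re s - 1)"
      using x assms by (simp add: norm_powr_real_powr)
    also have "\<dots> \<le> real n powr (- Re s - 1)" using x assms by (intro powr_mono2') auto
    finally show "norm (- s * z powr (- s - 1)) \<le> norm s * real n powr (- Re s - 1)"
      by (simp add: norm_mult mult_left_mono)
  qed auto
  then show ?thesis by simp
qed

(* Abel summation turns the Dirichlet series into one that converges absolutely for Re s > 0. *)
lemma dirichlet_series_holomorphic:
  fixes f :: "nat \<Rightarrow> complex"
  assumes B: "\<And>N. norm (\<Sum>n<N. f n) \<le> B"
  obtains F where "F holomorphic_on {s. Re s > 0}"
    "\<And>s. Re s > 0 \<Longrightarrow> (\<lambda>N. \<Sum>n<N. f n * of_nat n powr - s) \<longlonglongrightarrow> F s"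
proof -
  \<comment> \<open>The term \<open>n = 0\<close> of the series vanishes because
    \<open>0 powr - s = 0\<close>, so \<open>f 0\<close> has to be left out of the partial sums.
    This is why they are bounded by \<open>2 * B\<close> and not by \<open>B\<close>.\<close>
  define C where "C N = (\<Sum>n\<in>{1..<N}. f n)" for N
  define t where "t n s = (if n = 0 then 0 else C (Suc n) * (of_nat n powr - s - of_nat (Suc n) powr - s))"
    for n :: nat and s :: complex
  have B0: "B \<ge> 0" using B[of 0] by simp
  have C: "norm (C N) \<le> 2 * B" for N
  proof (cases "N = 0")
    case False
    then have "{..<N} = insert 0 {1..<N}" by auto
    then have "C N = (\<Sum>n<N. f n) - (\<Sum>n<1. f n)" by (simp add: C_def)
    then show ?thesis using B[of N] B[of 1] norm_triangle_ineq4[of "\<Sum>n<N. f n" "\<Sum>n<1. f n"] by simp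
  qed (use B0 in \<open>auto simp: C_def\<close>)
  have abel: "(\<Sum>n<N. f n * of_nat n powr - s) = C N * of_nat N powr - s + (\<Sum>n<N. t n s)" for N s
  proof (induction N)
    case (Suc N)
    show ?case
    proof (cases "N = 0")
      case False
      then have "C (Suc N) = C N + f N" by (simp add: C_def)
      then show ?thesis using Suc False by (simp add: t_def algebra_simps)
    qed (simp add: C_def t_def)
  qed simp
  have tb: "norm (t n s) \<le> 2 * B * R * real n powr (- \<sigma> - 1)"
    if "norm s \<le> R" "Re s \<ge> \<sigma>" "\<sigma> > 0" for n s R \<sigma>
  proof (cases "n = 0")
    case False
    have R: "R \<ge> 0" using that(1) norm_ge_zero[of s] by linarith
    have "norm (t n s) \<le> (2 * B) * (norm s * real n powr (- Re s - 1))"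
      unfolding t_def using False that C B0
      by (simp only: if_False norm_mult) (intro mult_mono norm_powr_diff_le, auto)
    also have "\<dots> \<le> (2 * B) * (R * real n powr (- \<sigma> - 1))"
      using that False B0 R by (intro mult_left_mono mult_mono powr_mono) auto
    finally show ?thesis by simp
  qed (use that B0 in \<open>auto simp: t_def\<close>)
  have summ: "summable (\<lambda>n. 2 * B * R * real n powr (- \<sigma> - 1))" if "\<sigma> > 0" for R \<sigma>
    using that by (intro summable_mult) (subst summable_real_powr_iff, auto)
  define F where "F s = (\<Sum>n. t n s)" for s
  show ?thesis
  proof
    show "F holomorphic_on {s. Re s > 0}"
    proof (rule holomorphic_uniform_sequence[of _ "\<lambda>N s. \<Sum>n<N. t n s"])
      show "open {s. Re s > 0}" by (rule open_halfspace_Re_gt)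
      show "(\<lambda>s. \<Sum>n<N. t n s) holomorphic_on {s. Re s > 0}" for N
      proof (intro holomorphic_on_sum)
        fix n
        show "t n holomorphic_on {s. Re s > 0}"
        proof (cases "n = 0")
          case True
          then have "t n = (\<lambda>_. 0)" by (auto simp: t_def)
          then show ?thesis by simp
        next
          case False
          then have "t n = (\<lambda>s. C (Suc n) * (of_nat n powr - s - of_nat (Suc n) powr - s))"
            by (auto simp: t_def)
          then show ?thesis using False by (auto intro!: holomorphic_intros)
        qed
      qed
      fix s :: complex assume s: "s \<in> {s. Re s > 0}"
      define d where "d = Re s / 2"
      have d: "d > 0" using s by (auto simp: d_def)
      have in_ball: "Re w \<ge> d \<and> norm w \<le> norm s + d" if "w \<in> cball s d" for w
      proof -
        have "norm (s - w) \<le> d" using that by (simp add: dist_norm)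
        moreover have "\<bar>Re (s - w)\<bar> \<le> norm (s - w)" by (rule abs_Re_le_cmod)
        moreover have "norm w \<le> norm s + norm (s - w)"
          using norm_triangle_ineq4[of s "s - w"] by simp
        ultimately show ?thesis by (auto simp: d_def)
      qed
      have "cball s d \<subseteq> {s. Re s > 0}" using in_ball d by force
      moreover have "uniform_limit (cball s d) (\<lambda>N s. \<Sum>n<N. t n s) F sequentially"
        unfolding F_def
      proof (rule Weierstrass_m_test)
        show "norm (t n w) \<le> 2 * B * (norm s + d) * real n powr (- d - 1)" if "w \<in> cball s d" for n w
          using in_ball[OF that] d by (intro tb) auto
      qed (rule summ[OF d])
      ultimately show "\<exists>d>0. cball s d \<subseteq> {s. Re s > 0} \<and>
          uniform_limit (cball s d) (\<lambda>N s. \<Sum>n<N. t n s) F sequentially"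
        using d by blast
    qed
  next
    fix s :: complex assume s: "Re s > 0"
    have "summable (\<lambda>n. t n s)"
      using tb[of s "norm s" "Re s"] s by (intro summable_comparison_test'[OF summ[OF s]]) auto
    then have "(\<lambda>N. \<Sum>n<N. t n s) \<longlonglongrightarrow> F s"
      unfolding F_def by (rule summable_LIMSEQ)
    moreover have "(\<lambda>N. C N * of_nat N powr - s) \<longlonglongrightarrow> 0"
    proof (rule Lim_null_comparison)
      show "\<forall>\<^sub>F N in sequentially. norm (C N * of_nat N powr - s) \<le> 2 * B * real N powr - Re s"
        using eventually_gt_at_top[of 0]
      proof eventually_elim
        case (elim N)
        have "norm (of_nat N powr - s :: complex) = real N powr - Re s"
          using elim norm_powr_real_powr[of "of_nat N" "- s"] by simp
        then show ?case using C[of N] by (simp add: norm_mult mult_right_mono)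
      qed
      have "(\<lambda>N. 2 * B * real N powr - Re s) \<longlonglongrightarrow> 2 * B * 0"
        using s by (intro tendsto_intros tendsto_neg_powr filterlim_real_sequentially) auto
      then show "(\<lambda>N. 2 * B * real N powr - Re s) \<longlonglongrightarrow> 0" by simp
    qed
    ultimately have "(\<lambda>N. C N * of_nat N powr - s + (\<Sum>n<N. t n s)) \<longlonglongrightarrow> 0 + F s"
      by (intro tendsto_add)
    then show "(\<lambda>N. \<Sum>n<N. f n * of_nat n powr - s) \<longlonglongrightarrow> F s" by (simp add: abel)
  qed
qed

section \<open>Non-vanishing of L-functions and convergence of the series\<close>

lemma of_nat_powr_mult: "of_nat (m * n) powr s = of_nat m powr s * (of_nat n powr s :: complex)"
proof -
  have "of_nat (m * n) powr s = (of_real (real m) * of_real (real n)) powr s" by simp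
  also have "\<dots> = of_real (real m) powr s * of_real (real n) powr s"
    by (rule powr_times_real) auto
  finally show ?thesis by simp
qed

lemma norm_of_nat_powr: "norm (of_nat n powr - s :: complex) = real n powr - Re s"
  by (cases "n = 0") (use norm_powr_real_powr[of "of_nat n" "- s"] in auto)

lemma summable_on_dirichlet:
  fixes f :: "nat \<Rightarrow> complex"
  assumes "\<And>n. norm (f n) \<le> 1" "Re s > 1"
  shows "(\<lambda>n. f n * of_nat n powr - s) summable_on A"
proof (rule abs_summable_summable)
  show "(\<lambda>n. norm (f n * of_nat n powr - s)) summable_on A"
  proof (rule summable_on_comparison_test)
    show "(\<lambda>n. real n powr - Re s) summable_on A" using assms by (intro summable_on_powr)
    show "norm (f n * of_nat n powr - s) \<le> real n powr - Re s" for n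
      using assms(1)[of n] by (simp add: norm_mult norm_of_nat_powr mult_left_le_one_le)
  qed simp
qed

lemma infsum_dirichlet_eqI:
  fixes f :: "nat \<Rightarrow> complex"
  assumes "\<And>n. norm (f n) \<le> 1" "Re s > 1"
    "(\<lambda>N. \<Sum>n<N. f n * of_nat n powr - s) \<longlonglongrightarrow> l"
  shows "infsum (\<lambda>n. f n * of_nat n powr - s) UNIV = l"
proof -
  have "((\<lambda>n. f n * of_nat n powr - s) has_sum infsum (\<lambda>n. f n * of_nat n powr - s) UNIV) UNIV"
    using summable_on_dirichlet[of f s UNIV] assms by auto
  then have "(\<lambda>n. f n * of_nat n powr - s) sums infsum (\<lambda>n. f n * of_nat n powr - s) UNIV"
    by (rule has_sum_imp_sums)
  then show ?thesis using assms(3) LIMSEQ_unique by (auto simp: sums_def)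
qed

lemma sums_Suc_dirichlet_iff:
  "(\<lambda>n. f (Suc n) / of_nat (Suc n) powr s) sums l \<longleftrightarrow>
   (\<lambda>N. \<Sum>n<N. f n * of_nat n powr - s) \<longlonglongrightarrow> (l :: complex)"
proof -
  have "(\<Sum>n<Suc N. f n * of_nat n powr - s) = (\<Sum>n<N. f (Suc n) / of_nat (Suc n) powr s)" for N
    by (subst sum.lessThan_Suc_shift) (simp add: powr_minus divide_inverse)
  then show ?thesis unfolding sums_def
    using filterlim_sequentially_Suc[of "\<lambda>N. \<Sum>n<N. f n * of_nat n powr - s" "nhds l"] by simp
qed

text \<open>If the series vanished, it would still vanish after sieving out all primes below
  \<open>u\<close>. But the sieved series is 1 plus a part of the tail from \<open>u\<close> on,
  which is smaller than 1 in norm for large \<open>u\<close>. A finite Euler product is thus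
  enough.\<close>

lemma dirichlet_L_nonzero_right:
  assumes chi: "\<And>m n. chi (m * n) = chi m * chi n" "\<And>n. norm (chi n) \<le> 1" "chi 1 = 1"
    and L: "is_dirichlet_L q chi L" and s: "Re s > 1"
  shows "L s \<noteq> 0"
proof
  assume "L s = 0"
  define h where "h n = chi n * of_nat n powr - s" for n
  define \<sigma> where "\<sigma> = Re s"
  have hm: "h (m * n) = h m * h n" for m n
    unfolding h_def chi(1) of_nat_powr_mult by (simp only: mult_ac)
  have hs: "h summable_on A" for A
    unfolding h_def[abs_def] using chi s by (intro summable_on_dirichlet)
  have "(\<lambda>n. chi (Suc n) / of_nat (Suc n) powr s) sums L s" using L s by (auto simp: is_dirichlet_L_def)
  then have h0: "infsum h UNIV = 0"
    unfolding h_def[abs_def] sums_Suc_dirichlet_iff using chi s \<open>L s = 0\<close>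
    by (intro infsum_dirichlet_eqI) auto
  let ?g = "\<lambda>n::nat. real n powr - \<sigma>"
  have gs: "?g summable_on A" for A using s by (intro summable_on_powr) (simp add: \<sigma>_def)
  have "?g sums infsum ?g UNIV" using has_sum_infsum[OF gs] by (rule has_sum_imp_sums)
  then have "(\<lambda>u. infsum ?g UNIV - (\<Sum>n<u. ?g n)) \<longlonglongrightarrow> infsum ?g UNIV - infsum ?g UNIV"
    unfolding sums_def by (intro tendsto_intros)
  then have "\<forall>\<^sub>F u in sequentially. infsum ?g UNIV - (\<Sum>n<u. ?g n) < 1"
    by (intro order_tendstoD(2)[where y = "infsum ?g UNIV - infsum ?g UNIV"]) auto
  then have "\<forall>\<^sub>F u in sequentially. infsum ?g UNIV - (\<Sum>n<u. ?g n) < 1 \<and> u \<ge> 3"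
    by (intro eventually_conj eventually_ge_at_top)
  then obtain u where u: "infsum ?g UNIV - (\<Sum>n<u. ?g n) < 1" "u \<ge> 3"
    by (auto simp: eventually_sequentially)
  let ?P = "{p. prime p \<and> p < u}"
  let ?S = "{n. \<forall>p\<in>?P. \<not> p dvd n}"
  have "infsum h ?S = (\<Prod>p\<in>?P. 1 - h p) * infsum h UNIV"
    by (rule infsum_euler_factors[OF hm hs]) auto
  then have S0: "infsum h ?S = 0" using h0 by simp
  have "1 \<in> ?S" by (auto dest: not_prime_unit)
  have "infsum h (?S - {1}) = infsum h ?S - infsum h {1}"
    using \<open>1 \<in> ?S\<close> by (intro infsum_Diff hs) auto
  then have "infsum h (?S - {1}) = -1" using S0 chi(3) by (simp add: h_def)
  then have "1 = norm (infsum h (?S - {1}))" by simp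
  also have "\<dots> \<le> infsum ?g (?S - {1})"
  proof (rule norm_infsum_le)
    show "(h has_sum infsum h (?S - {1})) (?S - {1})" by (intro has_sum_infsum hs)
    show "(?g has_sum infsum ?g (?S - {1})) (?S - {1})" by (intro has_sum_infsum gs)
    show "norm (h n) \<le> ?g n" for n
      using chi(2)[of n] by (simp add: h_def norm_mult norm_of_nat_powr \<sigma>_def mult_left_le_one_le)
  qed
  also have "\<dots> \<le> infsum ?g (UNIV - {..<u})"
  proof (rule infsum_mono_neutral[OF gs gs])
    fix n assume n: "n \<in> ?S - {1} - (UNIV - {..<u})"
    have "n = 0"
    proof (rule ccontr)
      assume "n \<noteq> 0"
      then have "n \<noteq> 1" "n > 0" using n by auto
      then obtain p where p: "prime p" "p dvd n" using prime_factor_nat by blast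
      then have "p \<le> n" using \<open>n > 0\<close> by (auto dest: dvd_imp_le)
      then show False using n p by auto
    qed
    then show "?g n \<le> 0" by simp
  qed auto
  also have "\<dots> = infsum ?g UNIV - infsum ?g {..<u}" by (intro infsum_Diff gs) auto
  also have "\<dots> < 1" using u by simp
  finally show False by simp
qed

lemma alternating_sum_bounds:
  fixes f :: "nat \<Rightarrow> real"
  assumes "\<And>n. n \<ge> 1 \<Longrightarrow> f (Suc n) \<le> f n"
  shows "f 1 - f 2 \<le> (\<Sum>n\<in>{1..<2 * k + 3}. (-1) ^ Suc n * f n)"
proof (induction k)
  case 0
  have "{1..<2 * 0 + 3} = {1::nat, 2}" by auto
  then show ?case by simp
next
  case (Suc k)
  have "{1..<2 * Suc k + 3} = {1..<2 * k + 3} \<union> {2 * k + 3, 2 * k + 4}" by auto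
  then have "(\<Sum>n\<in>{1..<2 * Suc k + 3}. (-1) ^ Suc n * f n) =
     (\<Sum>n\<in>{1..<2 * k + 3}. (-1) ^ Suc n * f n) + (f (2 * k + 3) - f (2 * k + 4))"
    by (simp add: power_add)
  moreover have "f (2 * k + 4) \<le> f (2 * k + 3)" using assms[of "2 * k + 3"] by (simp add: eval_nat_numeral)
  ultimately show ?case using Suc by linarith
qed

text \<open>Up to finitely many Euler factors this is the zeta function, and
  \<open>1 - 2 * 2 powr - z\<close> times zeta is the alternating series \<open>F\<close>, which is
  positive on \<open>(0, 1)\<close>. The identity holds for \<open>Re z > 1\<close> and is continued
  to the right half plane without the pole.\<close>

lemma principal_dirichlet_L_nonzero:
  assumes q: "q > 0" and chi: "principal_character q chi" and L: "is_dirichlet_L q chi L"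
    and s: "0 < s" "s < 1"
  shows "L (complex_of_real s) \<noteq> 0"
proof
  assume L0: "L (complex_of_real s) = 0"
  define f where "f n = (-1 :: complex) ^ Suc n" for n
  have fN: "(\<Sum>n<N. f n) = (if even N then 0 else -1)" for N
    by (induction N) (auto simp: f_def)
  obtain F where F: "F holomorphic_on {s. Re s > 0}"
    "\<And>s. Re s > 0 \<Longrightarrow> (\<lambda>N. \<Sum>n<N. f n * of_nat n powr - s) \<longlonglongrightarrow> F s"
    by (rule dirichlet_series_holomorphic[of f 1]) (auto simp: fN)
  let ?P = "prime_factors q"
  have hol: "L holomorphic_on - {1}" using L chi by (auto simp: is_dirichlet_L_def L_domain_def)
  have eq: "L z * (1 - 2 * 2 powr - z) = (\<Prod>p\<in>?P. 1 - of_nat p powr - z) * F z" if z: "Re z > 1" for z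
  proof -
    define h where "h n = (of_nat n powr - z :: complex)" for n
    have hs: "h summable_on A" for A
      using summable_on_dirichlet[of "\<lambda>_. 1" z A] z by (simp add: h_def[abs_def])
    have hm: "h (m * n) = h m * h n" for m n unfolding h_def by (rule of_nat_powr_mult)
    have fs: "(\<lambda>n. f n * h n) summable_on A" for A
      unfolding h_def using z by (intro summable_on_dirichlet) (auto simp: f_def norm_power)
    have e1: "infsum (\<lambda>n. f n * h n) UNIV = F z"
      unfolding h_def using z F by (intro infsum_dirichlet_eqI) (auto simp: f_def norm_power)
    have e2: "infsum (\<lambda>n. f n * h n) UNIV = infsum h UNIV - 2 * infsum h ((*) 2 ` UNIV)"
    proof -
      have "((\<lambda>n. h n + - (f n * h n)) has_sum infsum h UNIV + - infsum (\<lambda>n. f n * h n) UNIV) UNIV"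
        by (intro has_sum_add has_sum_uminusI has_sum_infsum hs fs)
      then have "infsum h UNIV - infsum (\<lambda>n. f n * h n) UNIV = infsum (\<lambda>n. h n - f n * h n) UNIV"
        by (simp add: infsumI)
      also have "\<dots> = infsum (\<lambda>n. 2 * h n) ((*) 2 ` UNIV)"
      proof (rule infsum_cong_neutral)
        have ev: "n \<in> range ((*) 2) \<longleftrightarrow> even n" for n :: nat by (auto elim!: evenE)
        show "h n - f n * h n = 0" if "n \<in> UNIV - range ((*) 2)" for n
          using that by (auto simp: ev f_def)
        show "h n - f n * h n = 2 * h n" if "n \<in> UNIV \<inter> range ((*) 2)" for n
          using that by (auto simp: ev f_def)
      qed auto
      also have "\<dots> = 2 * infsum h ((*) 2 ` UNIV)" by (intro infsum_cmult_right hs)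
      finally show ?thesis by (simp add: algebra_simps)
    qed
    have e3: "infsum h ((*) 2 ` UNIV) = 2 powr - z * infsum h UNIV"
    proof -
      have "infsum h ((*) 2 ` UNIV) = infsum (\<lambda>n. h (2 * n)) UNIV"
        by (subst infsum_reindex) (auto simp: inj_on_def o_def)
      also have "\<dots> = infsum (\<lambda>n. 2 powr - z * h n) UNIV" by (simp only: hm) (simp add: h_def)
      also have "\<dots> = 2 powr - z * infsum h UNIV" by (intro infsum_cmult_right hs)
      finally show ?thesis .
    qed
    have "F z = infsum h UNIV - 2 * (2 powr - z * infsum h UNIV)" using e1 e2 e3 by metis
    then have Fz: "F z = (1 - 2 * 2 powr - z) * infsum h UNIV" by (simp add: algebra_simps)
    have "L z = infsum (\<lambda>n. chi n * h n) UNIV"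
    proof -
      have "(\<lambda>n. chi (Suc n) / of_nat (Suc n) powr z) sums L z" using L z by (auto simp: is_dirichlet_L_def)
      then show ?thesis unfolding h_def sums_Suc_dirichlet_iff using z chi
        by (intro infsum_dirichlet_eqI[symmetric]) (auto simp: principal_character_def)
    qed
    also have "\<dots> = infsum h {n. \<forall>p\<in>?P. \<not> p dvd n}"
    proof (rule infsum_cong_neutral)
      have cop: "coprime n q \<longleftrightarrow> (\<forall>p\<in>?P. \<not> p dvd n)" for n
      proof
        assume "coprime n q"
        then show "\<forall>p\<in>?P. \<not> p dvd n"
          by (metis coprime_common_divisor in_prime_factors_iff not_prime_unit)
      next
        assume *: "\<forall>p\<in>?P. \<not> p dvd n"
        show "coprime n q"
        proof (rule ccontr)
          assume "\<not> coprime n q"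
          then obtain p where "prime p" "p dvd gcd n q"
            using prime_factor_nat[of "gcd n q"] by (auto simp: coprime_iff_gcd_eq_1)
          then show False using * q by (auto simp: in_prime_factors_iff)
        qed
      qed
      show "chi n * h n = 0" if "n \<in> UNIV - {n. \<forall>p\<in>?P. \<not> p dvd n}" for n
        using that chi cop[of n] by (auto simp: principal_character_def)
      show "chi n * h n = h n" if "n \<in> UNIV \<inter> {n. \<forall>p\<in>?P. \<not> p dvd n}" for n
        using that chi cop[of n] by (auto simp: principal_character_def)
    qed auto
    also have "\<dots> = (\<Prod>p\<in>?P. 1 - h p) * infsum h UNIV"
      by (rule infsum_euler_factors[OF hm hs]) auto
    finally show ?thesis using Fz by (simp add: h_def)
  qed
  let ?D = "{z. Re z > 0} - {1 :: complex}"
  have eqs: "L (of_real s) * (1 - 2 * 2 powr - of_real s) = (\<Prod>p\<in>?P. 1 - of_nat p powr - of_real s) * F (of_real s)"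
  proof (rule analytic_continuation_open[of "{z. Re z > 1}" ?D
        "\<lambda>z. L z * (1 - 2 * 2 powr - z)" "\<lambda>z. (\<Prod>p\<in>?P. 1 - of_nat p powr - z) * F z"])
    show "open {z::complex. Re z > 1}" by (rule open_halfspace_Re_gt)
    show "open ?D" by (intro open_Diff open_halfspace_Re_gt) auto
    have "(2::complex) \<in> {z. Re z > 1}" by simp
    then show "{z::complex. Re z > 1} \<noteq> {}" by blast
    show "connected ?D"
      by (intro connected_open_delete open_halfspace_Re_gt convex_connected convex_halfspace_Re_gt) auto
    show "(\<lambda>z. L z * (1 - 2 * 2 powr - z)) holomorphic_on ?D"
      by (intro holomorphic_intros holomorphic_on_subset[OF hol]) auto
    show "(\<lambda>z. (\<Prod>p\<in>?P. 1 - of_nat p powr - z) * F z) holomorphic_on ?D"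
      by (intro holomorphic_intros holomorphic_on_subset[OF F(1)]) (auto dest: in_prime_factors_imp_prime)
    show "complex_of_real s \<in> ?D" using s by (auto simp: complex_eq_iff)
  qed (use eq in auto)
  have powr_real: "of_nat n powr - complex_of_real s = of_real (real n powr - s)" for n
    using powr_of_real[of "real n" "- s"] by simp
  have "F (of_real s) = 0"
  proof -
    have "1 - of_nat p powr - complex_of_real s \<noteq> 0" if "p \<in> ?P" for p
    proof -
      have "prime p" using that by (rule in_prime_factors_imp_prime)
      then have "real p > 1" using prime_gt_1_nat[of p] by simp
      then have "real p powr - s < real p powr 0" using s by (intro powr_less_mono) auto
      then have "1 - real p powr - s \<noteq> 0" using \<open>real p > 1\<close> s by simp
      then show ?thesis unfolding powr_real by (metis of_real_1 of_real_diff of_real_eq_0_iff)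
    qed
    then show ?thesis using eqs L0 by auto
  qed
  then have "(\<lambda>N. Re (\<Sum>n<N. f n * of_nat n powr - of_real s)) \<longlonglongrightarrow> 0"
    using F(2)[of "of_real s"] s tendsto_Re by fastforce
  \<comment> \<open>Along this subsequence the sum stops after the even index
    \<open>2 * k + 2\<close>, so it consists of complete pairs and is at least its first
    pair.\<close>
  then have "((\<lambda>N. Re (\<Sum>n<N. f n * of_nat n powr - of_real s)) \<circ> (\<lambda>k. 2 * k + 3)) \<longlonglongrightarrow> 0"
    by (rule LIMSEQ_subseq_LIMSEQ) (auto simp: strict_mono_def)
  moreover have "Re (\<Sum>n<2 * k + 3. f n * of_nat n powr - of_real s) \<ge> 1 - 2 powr - s" for k
  proof -
    have "Re (f n * of_nat n powr - of_real s) = (-1) ^ Suc n * real n powr - s" for n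
    proof -
      have "f n = of_real ((-1) ^ Suc n)" by (simp add: f_def)
      then show ?thesis by (simp only: powr_real flip: of_real_mult) simp
    qed
    then have "Re (\<Sum>n<2 * k + 3. f n * of_nat n powr - of_real s) = (\<Sum>n<2 * k + 3. (-1) ^ Suc n * real n powr - s)"
      unfolding Re_sum by (intro sum.cong refl)
    also have "(\<Sum>n<2 * k + 3. (-1) ^ Suc n * real n powr - s) =
               (\<Sum>n\<in>{1..<2 * k + 3}. (-1) ^ Suc n * real n powr - s)"
      by (intro sum.mono_neutral_right) auto
    finally have eq: "Re (\<Sum>n<2 * k + 3. f n * of_nat n powr - of_real s) =
               (\<Sum>n\<in>{1..<2 * k + 3}. (-1) ^ Suc n * real n powr - s)" .
    have "real 1 powr - s - real 2 powr - s \<le> (\<Sum>n\<in>{1..<2 * k + 3}. (-1) ^ Suc n * real n powr - s)"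
      by (rule alternating_sum_bounds) (use s in \<open>auto intro!: powr_mono2'\<close>)
    then show ?thesis unfolding eq by (simp only: of_nat_1 of_nat_numeral powr_one_eq_one)
  qed
  ultimately have "1 - 2 powr - s \<le> 0"
    unfolding o_def by (intro LIMSEQ_le_const) blast+
  moreover have "2 powr - s < 2 powr (0::real)" using s by (intro powr_less_mono) auto
  ultimately show False by simp
qed

text \<open>The series already converges to a holomorphic function for \<open>Re s > 0\<close>, and
  by uniqueness of continuation this function is \<open>L\<close>. A zero of \<open>L\<close>
  thereby becomes a statement about partial sums.\<close>

lemma nonprincipal_dirichlet_L_sums:
  assumes chi: "\<not> principal_character q chi" and B: "\<And>N. norm (\<Sum>n<N. chi n) \<le> B"
    and le1: "\<And>n. norm (chi n) \<le> 1"
    and L: "is_dirichlet_L q chi L" and s: "Re s > 0"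
  shows "(\<lambda>N. \<Sum>n<N. chi n * of_nat n powr - s) \<longlonglongrightarrow> L s"
proof -
  obtain F where F: "F holomorphic_on {s. Re s > 0}"
    "\<And>s. Re s > 0 \<Longrightarrow> (\<lambda>N. \<Sum>n<N. chi n * of_nat n powr - s) \<longlonglongrightarrow> F s"
    using dirichlet_series_holomorphic[OF B] by blast
  have "L s = F s"
  proof (rule analytic_continuation_open[of "{z. Re z > 1}" "{z. Re z > 0}" L F])
    show "open {z::complex. Re z > 1}" "open {z::complex. Re z > 0}" by (rule open_halfspace_Re_gt)+
    have "(2::complex) \<in> {z. Re z > 1}" by simp
    then show "{z::complex. Re z > 1} \<noteq> {}" by blast
    show "connected {z::complex. Re z > 0}" by (intro convex_connected convex_halfspace_Re_gt)
    show "L holomorphic_on {z. Re z > 0}"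
      using L chi by (auto simp: is_dirichlet_L_def L_domain_def intro: holomorphic_on_subset)
    show "L z = F z" if "z \<in> {z. Re z > 1}" for z
    proof -
      have "(\<lambda>n. chi (Suc n) / of_nat (Suc n) powr z) sums L z" using L that by (auto simp: is_dirichlet_L_def)
      then have "(\<lambda>N. \<Sum>n<N. chi n * of_nat n powr - z) \<longlonglongrightarrow> L z" by (simp only: sums_Suc_dirichlet_iff)
      moreover have "(\<lambda>N. \<Sum>n<N. chi n * of_nat n powr - z) \<longlonglongrightarrow> F z" using that by (intro F(2)) auto
      ultimately show ?thesis by (rule LIMSEQ_unique)
    qed
  qed (use s F(1) in auto)
  then show ?thesis using F(2)[OF s] by simp
qed

section \<open>From an exceptional zero to a vanishing real series\<close>

lemma real_char_Re:
  assumes "real_dirichlet_character q \<chi>'"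
  shows "real_char q (\<lambda>n. Re (\<chi>' n))" and "\<chi>' n = of_real (Re (\<chi>' n))"
proof -
  have R: "\<chi>' n = of_real (Re (\<chi>' n))" for n
    using assms by (simp add: real_dirichlet_character_def complex_is_Real_iff complex_eq_iff)
  show "\<chi>' n = of_real (Re (\<chi>' n))" by (rule R)
  have D: "dirichlet_character q \<chi>'" using assms by (simp add: real_dirichlet_character_def)
  show "real_char q (\<lambda>n. Re (\<chi>' n))"
  proof
    show "q > 0" using D by (simp add: dirichlet_character_def)
    show "Re (\<chi>' (m * n)) = Re (\<chi>' m) * Re (\<chi>' n)" for m n
    proof -
      have "\<chi>' (m * n) = \<chi>' m * \<chi>' n" using D by (simp add: dirichlet_character_def)
      also have "\<dots> = of_real (Re (\<chi>' m) * Re (\<chi>' n))" using R[of m] R[of n] by simp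
      finally show ?thesis by simp
    qed
    show "Re (\<chi>' (n + q)) = Re (\<chi>' n)" for n using D by (simp add: dirichlet_character_def)
    have "Re (\<chi>' n) \<noteq> 0 \<longleftrightarrow> \<chi>' n \<noteq> 0" for n using R[of n] by (metis of_real_0 zero_complex.sel(1))
    then show "Re (\<chi>' n) \<noteq> 0 \<longleftrightarrow> coprime n q" for n using D by (simp add: dirichlet_character_def)
  qed
qed

text \<open>Smallness of \<open>\<bar>\<delta>\<bar>\<close> alone allows a zero to the right of 1
  or a principal character; both are ruled out here. A zero at 1 itself,
  \<open>\<delta> = 0\<close>, is kept, and the estimates for \<open>pint\<close> and
  \<open>lsum\<close> cover it.\<close>

lemma real_zero_imp_series_zero:
  assumes chi: "real_dirichlet_character q \<chi>'" and zero: "dirichlet_L_zero q \<chi>' (complex_of_real (1 - \<delta>))"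
    and \<delta>: "\<bar>\<delta>\<bar> \<le> 1 / 4"
  obtains chi where "nonprincipal_real_char q chi" "\<delta> \<ge> 0"
    "(\<lambda>N. \<Sum>n<N. chi n * real n powr (\<delta> - 1)) \<longlonglongrightarrow> 0"
proof -
  define chi where "chi n = Re (\<chi>' n)" for n
  interpret real_char q chi unfolding chi_def using real_char_Re[OF assms(1)] by simp
  have R: "\<chi>' n = of_real (chi n)" for n unfolding chi_def by (rule real_char_Re[OF assms(1)])
  obtain L where L: "is_dirichlet_L q \<chi>' L" "L (complex_of_real (1 - \<delta>)) = 0"
    and dom: "complex_of_real (1 - \<delta>) \<in> L_domain q \<chi>'"
    using zero by (auto simp: dirichlet_L_zero_def)
  have le1: "norm (\<chi>' n) \<le> 1" for n using abs_chi_le[of n] by (simp add: R)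
  have mult': "\<chi>' (m * n) = \<chi>' m * \<chi>' n" for m n by (simp add: R mult)
  have \<delta>0: "\<delta> \<ge> 0"
  proof (rule ccontr)
    assume "\<not> \<delta> \<ge> 0"
    then have "L (complex_of_real (1 - \<delta>)) \<noteq> 0"
      by (intro dirichlet_L_nonzero_right[OF mult' le1 _ L(1)]) (auto simp: R)
    then show False using L by simp
  qed
  have np: "\<not> principal_character q \<chi>'"
  proof
    assume p: "principal_character q \<chi>'"
    then have "\<delta> \<noteq> 0" using dom by (auto simp: L_domain_def)
    then have "L (complex_of_real (1 - \<delta>)) \<noteq> 0"
      using \<delta> \<delta>0 q_pos by (intro principal_dirichlet_L_nonzero[OF _ p L(1)]) auto
    then show False using L by simp
  qed
  have "nonprincipal_real_char q chi"
  proof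
    obtain n where "\<chi>' n \<noteq> (if coprime n q then 1 else 0)"
      using np by (auto simp: principal_character_def)
    then have "coprime n q \<and> chi n \<noteq> 1" using nonzero[of n] by (auto simp: R split: if_splits)
    then show "\<exists>n. coprime n q \<and> chi n \<noteq> 1" by blast
  qed
  then interpret nonprincipal_real_char q chi .
  have "norm (\<Sum>n<N. \<chi>' n) \<le> real q" for N
    using abs_sum_chi_le[of N] unfolding R of_real_sum[symmetric] norm_of_real .
  from nonprincipal_dirichlet_L_sums[OF np this le1 L(1), of "complex_of_real (1 - \<delta>)"] \<delta> L(2)
  have "(\<lambda>N. \<Sum>n<N. \<chi>' n * of_nat n powr - complex_of_real (1 - \<delta>)) \<longlonglongrightarrow> 0" by simp
  moreover have "\<chi>' n * of_nat n powr - complex_of_real (1 - \<delta>) = of_real (chi n * real n powr (\<delta> - 1))" for n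
    using powr_of_real[of "real n" "\<delta> - 1"] by (simp add: R)
  ultimately have "(\<lambda>N. complex_of_real (\<Sum>n<N. chi n * real n powr (\<delta> - 1))) \<longlonglongrightarrow> complex_of_real 0"
    by simp
  then have "(\<lambda>N. \<Sum>n<N. chi n * real n powr (\<delta> - 1)) \<longlonglongrightarrow> 0"
    by (simp only: tendsto_of_real_iff)
  with that \<delta>0 \<open>nonprincipal_real_char q chi\<close> show ?thesis by blast
qed

section \<open>Sieving an arithmetic progression\<close>

lemma W_le: "W y \<le> card ({n. 0 \<le> n \<and> real_of_int n \<le> y} \<inter> sifted_set a (sqrt (y / ln y)))"
  unfolding W_def by (rule cINF_lower) auto

lemma W_attained:
  obtains a where "W y = card ({n. 0 \<le> n \<and> real_of_int n \<le> y} \<inter> sifted_set a (sqrt (y / ln y)))"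
proof -
  let ?f = "\<lambda>a. card ({n. 0 \<le> n \<and> real_of_int n \<le> y} \<inter> sifted_set a (sqrt (y / ln y)))"
  have "Inf (range ?f) \<in> range ?f" by (rule Inf_nat_def1) auto
  then show ?thesis using that by (auto simp: W_def)
qed

lemma exists_large_residue_class:
  fixes F :: "int set"
  assumes "finite F" "m > 0"
  obtains c where "card F \<le> m * card {n \<in> F. [n = c] (mod int m)}"
proof -
  have "\<exists>c. card F \<le> m * card {n \<in> F. [n = c] (mod int m)}"
  proof (rule ccontr)
    assume "\<not> ?thesis"
    then have *: "m * card {n \<in> F. [n = c] (mod int m)} < card F" for c by (simp add: not_le)
    have "F = (\<Union>c\<in>{0..<int m}. {n \<in> F. [n = c] (mod int m)})"
    proof (intro equalityI subsetI)
      fix n assume "n \<in> F"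
      then show "n \<in> (\<Union>c\<in>{0..<int m}. {n \<in> F. [n = c] (mod int m)})"
        using assms by (intro UN_I[of "n mod int m"]) (auto simp: cong_def)
    qed auto
    then have "card F \<le> (\<Sum>c\<in>{0..<int m}. card {n \<in> F. [n = c] (mod int m)})"
      by (metis card_UN_le finite_atLeastLessThan_int)
    then have "m * card F \<le> (\<Sum>c\<in>{0..<int m}. m * card {n \<in> F. [n = c] (mod int m)})"
      by (simp add: sum_distrib_left[symmetric])
    also have "\<dots> < (\<Sum>c\<in>{0..<int m}. card F)"
      using assms * by (intro sum_strict_mono) auto
    finally show False by simp
  qed
  with that show ?thesis by blast
qed

lemma greedy_sieve:
  fixes F :: "int set"
  assumes "finite F" "finite P" "\<And>p. p \<in> P \<Longrightarrow> p > 0"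
  obtains a where "real (card {n \<in> F. \<forall>p\<in>P. \<not> [n = a p] (mod int p)}) \<le> real (card F) * (\<Prod>p\<in>P. 1 - 1 / real p)"
proof -
  have "\<exists>a. real (card {n \<in> F. \<forall>p\<in>P. \<not> [n = a p] (mod int p)}) \<le> real (card F) * (\<Prod>p\<in>P. 1 - 1 / real p)"
    using assms(2,3)
  proof (induction P rule: finite_induct)
    case (insert p P)
    then obtain a where a: "real (card {n \<in> F. \<forall>p\<in>P. \<not> [n = a p] (mod int p)}) \<le> real (card F) * (\<Prod>p\<in>P. 1 - 1 / real p)"
      by auto
    let ?G = "{n \<in> F. \<forall>p\<in>P. \<not> [n = a p] (mod int p)}"
    have fin: "finite ?G" using assms by simp
    have p: "p > 0" using insert by auto
    obtain c where c: "card ?G \<le> p * card {n \<in> ?G. [n = c] (mod int p)}"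
      using exists_large_residue_class[OF fin p] by blast
    let ?C = "{n \<in> ?G. [n = c] (mod int p)}"
    have "real (card ?G) \<le> real p * real (card ?C)" using c by (simp only: flip: of_nat_mult)
    then have cc: "real (card ?G) / real p \<le> real (card ?C)" using p by (simp add: field_simps)
    have eq: "{n \<in> F. \<forall>r\<in>insert p P. \<not> [n = (a(p := c)) r] (mod int r)} = ?G - ?C"
      using insert by auto
    have subC: "?C \<subseteq> ?G" by auto
    have "real (card {n \<in> F. \<forall>r\<in>insert p P. \<not> [n = (a(p := c)) r] (mod int r)}) = real (card ?G) - real (card ?C)"
      unfolding eq card_Diff_subset[OF finite_subset[OF subC fin] subC]
      by (rule of_nat_diff[OF card_mono[OF fin subC]])
    also have "\<dots> \<le> real (card ?G) * (1 - 1 / real p)" using cc by (simp add: algebra_simps)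
    also have "\<dots> \<le> (real (card F) * (\<Prod>p\<in>P. 1 - 1 / real p)) * (1 - 1 / real p)"
      using a p by (intro mult_right_mono) auto
    finally show ?case using insert by (intro exI[of _ "a(p := c)"]) (simp add: mult_ac)
  qed simp
  with that show ?thesis by blast
qed

lemma finite_int_interval: "finite {n::int. 0 \<le> n \<and> real_of_int n \<le> y}"
  by (rule finite_subset[of _ "{0..\<lfloor>y\<rfloor>}"]) (auto simp: le_floor_iff)

lemma finite_nat_le_real: "finite {n::nat. real n \<le> y}"
  using finite_primes_le_real[of "\<lambda>_. True" y] by simp

text \<open>A prime not dividing \<open>q\<close> removes the \<open>n\<close> for which it divides
  \<open>q * n + b\<close>. A prime dividing \<open>q\<close> never divides
  \<open>q * n + b\<close>, so its class is still free and can be chosen greedily, which gains the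
  factor \<open>totient q / q\<close>. The bound on \<open>q\<close> puts all these primes below the
  sifting level.\<close>

lemma W_le_progression:
  assumes q: "q > 0" "real q \<le> sqrt (y / ln y)" and b: "coprime b q"
  shows "real (W y) \<le> real (card {n::nat. real n \<le> y \<and> (\<forall>p. prime p \<longrightarrow> real p \<le> sqrt (y / ln y) \<longrightarrow> \<not> p dvd q * n + b)}) *
      (real (totient q) / real q)"
proof -
  define z where "z = sqrt (y / ln y)"
  define N where "N = {n::nat. real n \<le> y \<and> (\<forall>p. prime p \<longrightarrow> real p \<le> z \<longrightarrow> \<not> p dvd q * n + b)}"
  have finN: "finite N" unfolding N_def by (rule finite_subset[OF _ finite_nat_le_real[of y]]) auto
  obtain a where a: "real (card {n \<in> int ` N. \<forall>p\<in>prime_factors q. \<not> [n = a p] (mod int p)})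
      \<le> real (card (int ` N)) * (\<Prod>p\<in>prime_factors q. 1 - 1 / real p)"
    by (rule greedy_sieve[of "int ` N" "prime_factors q"])
       (use finN in \<open>auto dest: in_prime_factors_imp_prime prime_gt_0_nat\<close>)
  have "\<exists>c. [int q * c = - int b] (mod int p)" if "prime p" "\<not> p dvd q" for p
  proof -
    have "coprime (int q) (int p)" using that by (simp add: prime_imp_coprime coprime_commute)
    then obtain x where "[int q * x = 1] (mod int p)" using cong_solve_coprime_int by blast
    then have "[int q * x * (- int b) = 1 * (- int b)] (mod int p)" by (rule cong_scalar_right)
    then show ?thesis by (metis mult.assoc mult_1)
  qed
  then obtain e where e: "\<And>p. prime p \<Longrightarrow> \<not> p dvd q \<Longrightarrow> [int q * e p = - int b] (mod int p)" by metis
  define a' where "a' p = (if p dvd q then a p else e p)" for p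
  have sub: "{n. 0 \<le> n \<and> real_of_int n \<le> y} \<inter> sifted_set a' z \<subseteq> {n \<in> int ` N. \<forall>p\<in>prime_factors q. \<not> [n = a p] (mod int p)}"
  proof
    fix n assume n: "n \<in> {n. 0 \<le> n \<and> real_of_int n \<le> y} \<inter> sifted_set a' z"
    then have ns: "\<not> [n = a' p] (mod int p)" if "prime p" "real p \<le> z" for p
      using that by (auto simp: sifted_set_def)
    obtain k where k: "n = int k" using n nonneg_int_cases[of n] by auto
    have "\<not> p dvd q * k + b" if p: "prime p" "real p \<le> z" for p
    proof (cases "p dvd q")
      case True
      show ?thesis
      proof
        assume "p dvd q * k + b"
        then have "p dvd b" using True by (simp add: dvd_add_right_iff)
        then show False using True b p by (meson coprime_common_divisor not_prime_unit)
      qed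
    next
      case False
      show ?thesis
      proof
        assume "p dvd q * k + b"
        then have "int p dvd int q * n + int b" unfolding k by (metis int_dvd_int_iff of_nat_add of_nat_mult)
        then have "[int q * n = - int b] (mod int p)" by (simp add: cong_iff_dvd_diff)
        then have "[int q * n = int q * e p] (mod int p)" using e[OF p(1) False] cong_trans cong_sym by blast
        moreover have "coprime (int q) (int p)" using p False by (simp add: prime_imp_coprime coprime_commute)
        ultimately have "[n = e p] (mod int p)" by (simp add: cong_mult_lcancel)
        then show False using ns[OF p] False by (simp add: a'_def)
      qed
    qed
    then have "k \<in> N" using n k by (auto simp: N_def)
    moreover have "\<not> [n = a p] (mod int p)" if "p \<in> prime_factors q" for p
    proof -
      have p: "prime p" "p dvd q" using that by auto
      then have "real p \<le> real q" using q by (auto dest: dvd_imp_le)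
      then have "real p \<le> z" using q(2) by (simp add: z_def)
      then show ?thesis using ns[of p] p by (simp add: a'_def)
    qed
    ultimately show "n \<in> {n \<in> int ` N. \<forall>p\<in>prime_factors q. \<not> [n = a p] (mod int p)}" using k by auto
  qed
  have "W y \<le> card ({n. 0 \<le> n \<and> real_of_int n \<le> y} \<inter> sifted_set a' z)"
    unfolding z_def by (rule W_le)
  also have "\<dots> \<le> card {n \<in> int ` N. \<forall>p\<in>prime_factors q. \<not> [n = a p] (mod int p)}"
    using sub finN by (intro card_mono) auto
  finally have "real (W y) \<le> real (card {n \<in> int ` N. \<forall>p\<in>prime_factors q. \<not> [n = a p] (mod int p)})"
    by simp
  also note a
  also have "card (int ` N) = card N" by (intro card_image) auto
  also have "(\<Prod>p\<in>prime_factors q. 1 - 1 / real p) = real (totient q) / real q"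
    using totient_formula2[of q] q by simp
  finally show ?thesis by (simp add: N_def z_def)
qed

section \<open>Rough numbers with \<open>chi m = 1\<close>\<close>

context nonprincipal_real_char
begin

lemma card_chi_eq_1:
  assumes "q \<ge> 2"
  shows "2 * card {b. b < q \<and> chi b = 1} = totient q"
proof -
  have count: "real (card {b. b < q \<and> P b}) = (\<Sum>b<q. if P b then 1 else 0)" for P
    by (simp add: sum.If_cases) (rule arg_cong[of _ _ card], auto)
  have "2 * real (card {b. b < q \<and> chi b = 1}) = (\<Sum>b<q. if chi b = 1 then 2 else 0)"
    unfolding count sum_distrib_left by (intro sum.cong) auto
  also have "\<dots> = (\<Sum>b<q. (if chi b \<noteq> 0 then 1 else 0) + chi b)"
  proof (intro sum.cong refl)
    show "(if chi b = 1 then 2 else 0) = (if chi b \<noteq> 0 then 1 else 0) + chi b" for b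
      using chi_cases[of b] by auto
  qed
  also have "\<dots> = (\<Sum>b<q. if chi b \<noteq> 0 then 1 else 0)"
    by (simp add: sum.distrib sum_chi_period)
  also have "\<dots> = real (card {b. b < q \<and> coprime b q})"
    unfolding nonzero count ..
  also have "{b. b < q \<and> coprime b q} = totatives q"
    using assms by (auto simp: totatives_def intro: Nat.gr0I order.not_eq_order_implies_strict)
  finally show ?thesis unfolding totient_def by linarith
qed

text \<open>The classes \<open>b\<close> with \<open>chi b = 1\<close> number
  \<open>totient q / 2\<close>, and the best of them has at most the average number of survivors.
  This average cancels the greedy gain \<open>totient q / q\<close> exactly, so that the result
  depends on \<open>q\<close> but not on \<open>totient q\<close>.\<close>

lemma W_le_char:
  assumes q2: "q \<ge> 2" and qz: "real q \<le> sqrt (y / ln y)" and "y \<ge> 0"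
  shows "real (W y) \<le> 2 / real q *
     real (card {m::nat. real m \<le> real q * (y + 1) \<and> chi m = 1 \<and> (\<forall>p. prime p \<longrightarrow> real p \<le> sqrt (y / ln y) \<longrightarrow> \<not> p dvd m)})"
proof -
  define z where "z = sqrt (y / ln y)"
  define M where "M = {m::nat. real m \<le> real q * (y + 1) \<and> chi m = 1 \<and> (\<forall>p. prime p \<longrightarrow> real p \<le> z \<longrightarrow> \<not> p dvd m)}"
  define B where "B = {b. b < q \<and> chi b = 1}"
  define N where "N b = {n::nat. real n \<le> y \<and> (\<forall>p. prime p \<longrightarrow> real p \<le> z \<longrightarrow> \<not> p dvd q * n + b)}" for b
  have finN: "finite (N b)" for b unfolding N_def by (rule finite_subset[OF _ finite_nat_le_real[of y]]) auto
  have finM: "finite M" unfolding M_def by (rule finite_subset[OF _ finite_nat_le_real[of "real q * (y + 1)"]]) auto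
  have finB: "finite B" by (auto simp: B_def)
  let ?f = "\<lambda>(b, n). q * n + b"
  have "(\<Sum>b\<in>B. card (N b)) = card (SIGMA b:B. N b)" using finB finN by simp
  also have "\<dots> \<le> card M"
  proof (rule card_inj_on_le)
    show "inj_on ?f (SIGMA b:B. N b)"
    proof (rule inj_onI, clarify)
      fix b n b' n' assume "b \<in> B" "b' \<in> B" and eq: "q * n + b = q * n' + b'"
      then have "b < q" "b' < q" by (auto simp: B_def)
      then have "b = b'" using arg_cong[OF eq, of "\<lambda>x. x mod q"] by simp
      then show "b = b' \<and> n = n'" using eq q_pos by simp
    qed
    show "?f ` (SIGMA b:B. N b) \<subseteq> M"
    proof clarify
      fix b n assume *: "b \<in> B" "n \<in> N b"
      have "real q * real n + real b \<le> real q * y + real q"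
        using * by (intro add_mono mult_left_mono) (auto simp: N_def B_def)
      then have "real (q * n + b) \<le> real q * (y + 1)" by (simp add: algebra_simps)
      moreover have "chi (q * n + b) = 1"
        using chi_add_mult[of b n] * by (simp add: B_def add.commute mult.commute)
      ultimately show "q * n + b \<in> M" using * by (auto simp: M_def N_def)
    qed
  qed (rule finM)
  finally have le: "(\<Sum>b\<in>B. card (N b)) \<le> card M" .
  have "totient q > 0" using q_pos by simp
  then have Bpos: "card B > 0" using card_chi_eq_1[OF q2] unfolding B_def by linarith
  have "\<exists>b\<in>B. card B * card (N b) \<le> card M"
  proof (rule ccontr)
    assume "\<not> ?thesis"
    then have *: "card M < card B * card (N b)" if "b \<in> B" for b using that by (simp add: not_le)
    have "card B * card M = (\<Sum>b\<in>B. card M)" by simp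
    also have "\<dots> < (\<Sum>b\<in>B. card B * card (N b))"
      using * Bpos finB by (intro sum_strict_mono) (auto simp: card_gt_0_iff)
    also have "\<dots> \<le> card B * card M" using le by (simp add: sum_distrib_left[symmetric])
    finally show False by simp
  qed
  then obtain b where b: "b \<in> B" "card B * card (N b) \<le> card M" by blast
  have cop: "coprime b q" using b(1) nonzero[of b] by (simp add: B_def)
  have "real (W y) \<le> real (card (N b)) * (real (totient q) / real q)"
    using W_le_progression[OF q_pos qz cop] by (simp add: N_def z_def)
  also have "real (totient q) = 2 * real (card B)"
    using card_chi_eq_1[OF q2] by (simp add: B_def flip: of_nat_mult)
  also have "real (card (N b)) * (2 * real (card B) / real q) = 2 / real q * real (card B * card (N b))"
    by simp
  also have "\<dots> \<le> 2 / real q * real (card M)"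
    using b(2) by (intro mult_left_mono) (auto simp del: of_nat_mult)
  finally show ?thesis by (simp add: M_def z_def)
qed

text \<open>Below \<open>z ^ 3\<close> a number without prime factors up to \<open>z\<close> is 1, a
  prime, or a product of two primes. In the last case the condition on \<open>chi\<close> is
  dropped: the smaller prime lies between \<open>z\<close> and \<open>sqrt X\<close>, the larger one
  is counted by Chebyshev's bound, and the sum over the smaller one is a Mertens sum over a short
  range.\<close>

lemma card_rough_chi_le:
  fixes X z :: real
  assumes z: "z > 1" and X: "z ^ 2 \<le> X" "X < z ^ 3" "X \<ge> 4"
  shows "real (card {m::nat. real m \<le> X \<and> chi m = 1 \<and> (\<forall>p. prime p \<longrightarrow> real p \<le> z \<longrightarrow> \<not> p dvd m)})
      \<le> 1 + real (card {p::nat. prime p \<and> chi p = 1 \<and> real p \<le> X})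
        + 16 * X / ln X * ((2 * ln (sqrt X / z) + 4 * ln 2) / ln z)"
proof -
  let ?A = "{p::nat. prime p \<and> chi p = 1 \<and> real p \<le> X}"
  let ?R = "{p::nat. prime p \<and> z < real p \<and> real p \<le> sqrt X}"
  let ?Q = "\<lambda>p. {p'::nat. prime p' \<and> real p' \<le> X / real p}"
  let ?M = "{m::nat. real m \<le> X \<and> chi m = 1 \<and> (\<forall>p. prime p \<longrightarrow> real p \<le> z \<longrightarrow> \<not> p dvd m)}"
  have zX: "z \<le> sqrt X" using X z by (intro real_le_rsqrt) auto
  have sX: "sqrt X \<ge> 2" "X > 0" using X(3) by (auto intro!: real_le_rsqrt)
  have finA: "finite ?A" by (rule finite_subset[OF _ finite_nat_le_real[of X]]) auto
  have finR: "finite ?R" by (rule finite_subset[OF _ finite_nat_le_real[of "sqrt X"]]) auto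
  have finQ: "finite (?Q p)" for p by (rule finite_subset[OF _ finite_nat_le_real[of "X / real p"]]) auto
  have sub: "?M \<subseteq> {1} \<union> ?A \<union> (\<Union>p\<in>?R. (*) p ` ?Q p)"
  proof
    fix m assume m: "m \<in> ?M"
    then have big: "real p > z" if "prime p" "p dvd m" for p
      using that by (cases "real p \<le> z") auto
    \<comment> \<open>For \<open>z < 2\<close> no prime excludes \<open>m = 0\<close>; instead
      \<open>chi 0 = chi 0 * chi b = - chi 0\<close> does.\<close>
    have m0: "m > 0"
    proof (rule Nat.gr0I)
      assume "m = 0"
      then have "chi 0 = 1" using m by auto
      obtain b where b: "coprime b q" "chi b = -1" by (rule ex_minus_1)
      have "chi 0 = chi 0 * chi b" using mult[of 0 b] by simp
      then show False using \<open>chi 0 = 1\<close> b by simp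
    qed
    show "m \<in> {1} \<union> ?A \<union> (\<Union>p\<in>?R. (*) p ` ?Q p)"
    proof (cases "m = 1 \<or> prime m")
      case True
      then show ?thesis using m by auto
    next
      case False
      then obtain p where p: "prime p" "p dvd m" using prime_factor_nat[of m] by auto
      then obtain k where k: "m = p * k" by blast
      have "k \<noteq> 1" using False k p by auto
      then obtain r where r: "prime r" "r dvd k" using prime_factor_nat[of k] by auto
      then obtain l where l: "k = r * l" by blast
      have bigpr: "real p > z" "real r > z" using big[of p] big[of r] p r k by auto
      have "l = 1"
      proof (rule ccontr)
        assume "l \<noteq> 1"
        then obtain s where s: "prime s" "s dvd l" using prime_factor_nat[of l] by auto
        then obtain t where t: "l = s * t" by blast
        have "real s > z" using big[of s] s k l by auto
        have "t \<ge> 1" using m0 k l t by (auto simp: Suc_le_eq)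
        have "z ^ 3 = z * z * z" by (simp add: power3_eq_cube)
        also have "\<dots> < real p * real r * real s"
          using bigpr \<open>real s > z\<close> z by (intro mult_strict_mono) auto
        also have "\<dots> \<le> real p * real r * real s * real t"
          using mult_left_mono[of 1 "real t" "real p * real r * real s"] \<open>t \<ge> 1\<close> by simp
        also have "\<dots> = real m" using k l t by simp
        finally show False using m X by simp
      qed
      then have mpr: "m = p * r" using k l by simp
      have fin: "m \<in> (\<Union>p\<in>?R. (*) p ` ?Q p)"
        if "m = u * v" "prime u" "prime v" "real u > z" "u \<le> v" for u v
      proof -
        have "real u * real u \<le> real u * real v" using that by (intro mult_left_mono) auto
        also have "\<dots> \<le> X" using m that(1) by simp
        finally have "real u \<le> sqrt X" by (intro real_le_rsqrt) (simp add: power2_eq_square)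
        moreover have "real v \<le> X / real u"
          using m that by (auto simp: field_simps dest: prime_gt_0_nat)
        ultimately show ?thesis using that by blast
      qed
      show ?thesis
      proof (cases "p \<le> r")
        case True
        then show ?thesis using fin[of p r] mpr p r bigpr by blast
      next
        case False
        then show ?thesis using fin[of r p] mpr p r bigpr by (auto simp: mult.commute)
      qed
    qed
  qed
  have "card ?M \<le> card ({1} \<union> ?A \<union> (\<Union>p\<in>?R. (*) p ` ?Q p))"
    using sub finA finR finQ by (intro card_mono) auto
  also have "\<dots> \<le> card ({1} \<union> ?A) + card (\<Union>p\<in>?R. (*) p ` ?Q p)" by (rule card_Un_le)
  also have "card ({1} \<union> ?A) \<le> 1 + card ?A" using card_Un_le[of "{1}" ?A] by simp
  also have "card (\<Union>p\<in>?R. (*) p ` ?Q p) \<le> (\<Sum>p\<in>?R. card ((*) p ` ?Q p))" by (rule card_UN_le[OF finR])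
  also have "\<dots> \<le> (\<Sum>p\<in>?R. card (?Q p))" by (intro sum_mono card_image_le finQ)
  finally have "real (card ?M) \<le> real (1 + card ?A + (\<Sum>p\<in>?R. card (?Q p)))"
    by (simp only: of_nat_le_iff)
  then have "real (card ?M) \<le> 1 + real (card ?A) + (\<Sum>p\<in>?R. real (card (?Q p)))" by simp
  also have "(\<Sum>p\<in>?R. real (card (?Q p))) \<le> (\<Sum>p\<in>?R. 16 * X / ln X * ((ln (real p) / real p) / ln z))"
  proof (rule sum_mono)
    fix p assume p: "p \<in> ?R"
    then have p0: "real p > 0" using z by auto
    have "sqrt X * real p \<le> sqrt X * sqrt X" using p X(3) by (intro mult_left_mono) auto
    also have "\<dots> = X" using X(3) by simp
    finally have Xp: "sqrt X \<le> X / real p" using p0 by (simp add: field_simps)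
    have "real (card (?Q p)) \<le> 8 * (X / real p) / ln (X / real p)"
      using Xp sX by (intro card_primes_le) auto
    also have "\<dots> \<le> 8 * (X / real p) / (ln X / 2)"
    proof (rule divide_left_mono)
      have "ln (sqrt X) \<le> ln (X / real p)" using Xp sX by (intro ln_mono) auto
      then show "ln X / 2 \<le> ln (X / real p)" using X by (simp add: ln_sqrt)
      have "ln (X / real p) > 0" using Xp sX by (intro ln_gt_zero) auto
      then show "0 < ln (X / real p) * (ln X / 2)" using X by (intro mult_pos_pos) auto
      have "0 \<le> X" using X(3) by linarith
      then show "0 \<le> 8 * (X / real p)" using p0 by simp
    qed
    also have "\<dots> = 16 * X / ln X * (1 / real p)" by simp
    also have "\<dots> \<le> 16 * X / ln X * ((ln (real p) / real p) / ln z)"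
    proof (rule mult_left_mono)
      have "ln z \<le> ln (real p)" "ln z > 0" using p z by (auto intro!: ln_mono)
      then show "1 / real p \<le> (ln (real p) / real p) / ln z" using p0 by (simp add: field_simps)
      show "0 \<le> 16 * X / ln X" using X by simp
    qed
    finally show "real (card (?Q p)) \<le> 16 * X / ln X * ((ln (real p) / real p) / ln z)" .
  qed
  also have "\<dots> = 16 * X / ln X * ((\<Sum>p\<in>?R. ln (real p) / real p) / ln z)"
    by (simp add: sum_distrib_left sum_divide_distrib)
  also have "\<dots> \<le> 16 * X / ln X * ((2 * ln (sqrt X / z) + 4 * ln 2) / ln z)"
    using sum_ln_over_primes_le[of z "sqrt X"] z zX X
    by (intro mult_left_mono divide_right_mono) auto
  finally show ?thesis by simp
qed

end

text \<open>A pigeonhole over scales. If every \<open>i\<close> failed, summing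
  \<open>\<eta> / i\<close> over the range would give at least \<open>3 / 4 * \<eta>\<close>, since
  there are \<open>3 * I\<close> terms and each \<open>i\<close> is below \<open>4 * I\<close>. On
  the other side each \<open>p\<close> is counted with total weight at most \<open>2 / p\<close>, a
  geometric series starting at the first power of 2 above it. Hence the constant
  \<open>3 / 8\<close>.\<close>

lemma exists_sparse_power:
  fixes S :: "nat set"
  assumes I: "1 \<le> I" and S: "finite S" "\<And>p. p \<in> S \<Longrightarrow> p > 0"
    and le: "(\<Sum>p\<in>S. 1 / real p) < 3 / 8 * \<eta>"
  obtains i where "I \<le> i" "i < 4 * I" "real (card {p\<in>S. p \<le> 2 ^ i}) * real i / 2 ^ i \<le> \<eta>"
proof -
  have "\<exists>i\<in>{I..<4 * I}. real (card {p\<in>S. p \<le> 2 ^ i}) * real i / 2 ^ i \<le> \<eta>"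
  proof (rule ccontr)
    assume "\<not> ?thesis"
    then have *: "\<eta> < real (card {p\<in>S. p \<le> 2 ^ i}) * real i / 2 ^ i" if "i \<in> {I..<4 * I}" for i
      using that by (simp add: not_le)
    have \<eta>: "\<eta> > 0" using le sum_nonneg[of S "\<lambda>p. 1 / real p"] by simp
    have "3 / 4 * \<eta> = (\<Sum>i\<in>{I..<4 * I}. \<eta> / (4 * real I))" using I by (simp add: field_simps)
    also have "\<dots> \<le> (\<Sum>i\<in>{I..<4 * I}. \<eta> / real i)"
    proof (rule sum_mono)
      fix i assume "i \<in> {I..<4 * I}"
      then have "0 < real i" "real i \<le> 4 * real I" using I by auto
      then show "\<eta> / (4 * real I) \<le> \<eta> / real i" using \<eta> by (intro divide_left_mono) auto
    qed
    also have "\<dots> \<le> (\<Sum>i\<in>{I..<4 * I}. real (card {p\<in>S. p \<le> 2 ^ i}) / 2 ^ i)"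
    proof (rule sum_mono)
      fix i assume i: "i \<in> {I..<4 * I}"
      then have "real i > 0" using I by auto
      then show "\<eta> / real i \<le> real (card {p\<in>S. p \<le> 2 ^ i}) / 2 ^ i" using *[OF i] by (simp add: field_simps)
    qed
    also have "\<dots> = (\<Sum>i\<in>{I..<4 * I}. \<Sum>p\<in>S. if p \<le> 2 ^ i then (1 / 2) ^ i else 0)"
      using S by (simp add: sum.inter_filter[symmetric] power_divide)
    also have "\<dots> = (\<Sum>p\<in>S. \<Sum>i\<in>{I..<4 * I}. if p \<le> 2 ^ i then (1 / 2) ^ i else 0)"
      by (rule sum.swap)
    also have "\<dots> \<le> (\<Sum>p\<in>S. 2 * (1 / real p))"
    proof (rule sum_mono)
      fix p assume p: "p \<in> S"
      obtain k where k: "p \<le> 2 ^ k" "\<And>i. p \<le> 2 ^ i \<Longrightarrow> k \<le> i"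
        using LeastI_ex[of "\<lambda>i. p \<le> 2 ^ i"] Least_le[of "\<lambda>i. p \<le> 2 ^ i"] less_exp[of p]
        by (metis less_imp_le)
      have "(\<Sum>i\<in>{I..<4 * I}. if p \<le> 2 ^ i then (1 / 2) ^ i else 0) = (\<Sum>i\<in>{i\<in>{I..<4 * I}. p \<le> 2 ^ i}. (1 / 2 :: real) ^ i)"
        by (simp only: sum.inter_filter[OF finite_atLeastLessThan])
      also have "\<dots> \<le> (\<Sum>i\<in>{k..<k + 4 * I}. (1 / 2) ^ i)"
        using k by (intro sum_mono2) auto
      also have "\<dots> = (1 / 2) ^ k * (\<Sum>i<4 * I. (1 / 2) ^ i)"
        using sum.shift_bounds_nat_ivl[of "\<lambda>i. (1 / 2 :: real) ^ i" 0 k "4 * I"]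
        by (simp add: power_add sum_distrib_left atLeast0LessThan add.commute mult.commute)
      also have "(\<Sum>i<n. (1 / 2 :: real) ^ i) = 2 - 2 * (1 / 2) ^ n" for n by (induction n) auto
      also have "(1 / 2) ^ k * (2 - 2 * (1 / 2) ^ (4 * I)) \<le> (1 / 2 :: real) ^ k * 2"
        by (intro mult_left_mono) auto
      also have "\<dots> \<le> 2 * (1 / real p)"
      proof -
        have "real p \<le> 2 ^ k" using k(1) by (metis of_nat_le_iff of_nat_numeral of_nat_power)
        then have "(1 / 2) ^ k \<le> 1 / real p" using S(2)[OF p] by (simp add: power_divide field_simps)
        then show ?thesis by simp
      qed
      finally show "(\<Sum>i\<in>{I..<4 * I}. if p \<le> 2 ^ i then (1 / 2) ^ i else 0) \<le> 2 * (1 / real p)" .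
    qed
    also have "\<dots> = 2 * (\<Sum>p\<in>S. 1 / real p)" by (simp only: sum_distrib_left)
    also have "\<dots> < 3 / 4 * \<eta>" using le by simp
    finally show False by simp
  qed
  with that show ?thesis by auto
qed

context nonprincipal_real_char
begin

text \<open>The choice of \<open>y\<close> makes \<open>q * (y + 1) = X\<close>. Primes with
  \<open>chi p = 1\<close> contribute through their density at \<open>X\<close>, products of two
  primes through \<open>1 / A\<close>; the 256 is the 16 of \<open>card_rough_chi_le\<close> times
  the 16 of \<open>frac\<close>. The second claim lets \<open>y\<close> grow with
  \<open>X\<close>.\<close>

lemma W_le_of_sparse:
  fixes A X :: real
  defines "\<Lambda> \<equiv> ln X" and "y \<equiv> X / real q - 1"
  assumes q: "q \<ge> 2" and A: "A \<ge> 100" and qA: "A * ln (real q) \<le> \<Lambda>" and \<Lambda>: "\<Lambda> \<ge> 1" "ln \<Lambda> + 5 \<le> \<Lambda> / A"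
    and X: "X > 0"
  shows "real (W y) \<le> 4 * ((1 + real (card {p::nat. prime p \<and> chi p = 1 \<and> real p \<le> X})) * \<Lambda> / X + 256 / A) * (y / ln y)"
    and "exp (\<Lambda> / 2) - 1 \<le> y"
proof -
  define l where "l = ln (real q)"
  have l: "0 < l" "l \<le> \<Lambda> / A" using q A qA by (auto simp: l_def field_simps)
  have l\<Lambda>: "ln \<Lambda> \<ge> 0" using \<Lambda> by simp
  then have "5 \<le> \<Lambda> / A" using \<Lambda> by linarith
  then have "5 * A \<le> \<Lambda>" using A by (simp add: field_simps)
  then have \<Lambda>500: "\<Lambda> \<ge> 500" using A by linarith
  have "\<Lambda> / A \<le> \<Lambda> / 100" using A \<Lambda> by (intro divide_left_mono) auto
  then have small: "l \<le> \<Lambda> / 100" "ln \<Lambda> + 5 \<le> \<Lambda> / 100" using l \<Lambda> by linarith+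
  have Xexp: "X = exp \<Lambda>" using X by (simp add: \<Lambda>_def)
  have qexp: "real q = exp l" using q by (simp add: l_def)
  have Xq: "X / real q = exp (\<Lambda> - l)" by (simp add: Xexp qexp exp_diff)
  have "\<Lambda> - l \<ge> 1" using small \<Lambda>500 by linarith
  then have Xq2: "X / real q \<ge> 2" unfolding Xq using exp_ge_add_one_self[of "\<Lambda> - l"] by linarith
  have y1: "X / (2 * real q) \<le> y" using Xq2 by (simp add: y_def)
  have ln2: "ln (2::real) \<le> 1" using ln2_le_25_over_36 by linarith
  have e2: "X / (2 * real q) = exp (\<Lambda> - l - ln 2)"
    by (simp add: Xexp qexp exp_diff)
  have ypos: "y > 0" using y1 e2 exp_gt_zero by (metis less_le_trans)
  have lny1: "\<Lambda> - l - ln 2 \<le> ln y"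
    using y1 ypos unfolding e2 by (simp add: ln_ge_iff)
  have "y \<le> X / real q" by (simp add: y_def)
  also have "\<dots> \<le> X" using q X by (simp add: field_simps)
  finally have yX: "y \<le> X" .
  have lny2: "ln y \<le> \<Lambda>" unfolding \<Lambda>_def using yX ypos by (intro ln_mono) auto
  have lnyhalf: "\<Lambda> / 2 \<le> ln y" using lny1 small ln2 \<Lambda>500 by linarith
  then have lny0: "ln y > 1" using \<Lambda>500 by linarith
  define z where "z = sqrt (y / ln y)"
  have ygt1: "y > 1" using lny0 by (subst ln_gt_zero_iff[OF ypos, symmetric]) linarith
  have ylny: "y / ln y > 0" using ypos lny0 ygt1 by (intro divide_pos_pos) auto
  then have z0: "z > 0" by (simp add: z_def)
  have lnz: "ln z = (ln y - ln (ln y)) / 2"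
    using ypos lny0 ygt1 by (simp add: z_def ln_sqrt ln_div)
  have lnlny: "ln (ln y) \<le> ln \<Lambda>" using lny2 lny0 by (intro ln_mono) auto
  have lnly: "ln (ln y) \<le> \<Lambda> / 100" by (rule order_trans[OF lnlny]) (use small in linarith)
  have lnz8: "\<Lambda> / 8 \<le> ln z"
  proof -
    have "2 * ln z = ln y - ln (ln y)" using lnz by simp
    moreover have "\<Lambda> / 100 + \<Lambda> / 4 \<le> \<Lambda> / 2" using \<Lambda>500 by simp
    ultimately show ?thesis using lnly lnyhalf by argo
  qed
  have lnz3: "\<Lambda> < 3 * ln z"
  proof -
    have "2 * ln z = ln y - ln (ln y)" using lnz by simp
    then have "\<Lambda> - l - ln 2 - \<Lambda> / 100 \<le> 2 * ln z" using lnly lny1 by argo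
    then show ?thesis using small(1) ln2 \<Lambda>500 by argo
  qed
  have z1: "z > 1" using lnz8 \<Lambda>500 by (subst ln_gt_zero_iff[OF z0, symmetric]) linarith
  have qz: "real q \<le> z"
  proof -
    have "l \<le> ln z" using lnz8 small \<Lambda>500 by linarith
    then have "exp l \<le> exp (ln z)" by (simp only: exp_le_cancel_iff)
    then show ?thesis using z0 qexp by simp
  qed
  have zX: "z ^ 2 \<le> X"
  proof -
    have "z ^ 2 = y / ln y" using ylny by (simp add: z_def)
    also have "\<dots> \<le> y / 1" using ypos lny0 ygt1 by (intro divide_left_mono) auto
    finally show ?thesis using yX by simp
  qed
  have Xz: "X < z ^ 3"
  proof -
    have "exp \<Lambda> < exp (3 * ln z)" using lnz3 by (simp only: exp_less_cancel_iff)
    also have "\<dots> = z ^ 3" using z0 exp_of_nat_mult[of 3 "ln z"] by simp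
    finally show ?thesis using Xexp by simp
  qed
  have X4: "X \<ge> 4" unfolding Xexp using exp_ge_add_one_self[of \<Lambda>] \<Lambda>500 by linarith
  let ?\<pi> = "real (card {p::nat. prime p \<and> chi p = 1 \<and> real p \<le> X})"
  have qy: "real q * (y + 1) = X" using q by (simp add: y_def)
  \<comment> \<open>On a logarithmic scale \<open>y\<close> falls short of \<open>X\<close>
    essentially by \<open>l = ln q\<close>, and \<open>z ^ 2\<close> falls short of \<open>y\<close>
    by \<open>ln (ln y)\<close>. Both losses, constants included, are at most
    \<open>\<Lambda> / A\<close>.\<close>
  have frac: "(2 * ln (sqrt X / z) + 4 * ln 2) / ln z \<le> 16 / A"
  proof -
    have "ln (sqrt X / z) = (\<Lambda> - ln y + ln (ln y)) / 2"
      using X z0 lnz by (simp add: ln_div ln_sqrt \<Lambda>_def field_simps)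
    then have "2 * ln (sqrt X / z) + 4 * ln 2 \<le> l + (ln \<Lambda> + 5)"
      using lnlny lny1 ln2 by argo
    also have "\<dots> \<le> 2 * \<Lambda> / A" using l \<Lambda> by simp
    finally have "(2 * ln (sqrt X / z) + 4 * ln 2) / ln z \<le> (2 * \<Lambda> / A) / ln z"
      using lnz8 \<Lambda>500 by (intro divide_right_mono) auto
    also have "\<dots> \<le> (2 * \<Lambda> / A) / (\<Lambda> / 8)"
      using lnz8 \<Lambda>500 A by (intro divide_left_mono mult_pos_pos) auto
    also have "\<dots> = 16 / A" using \<Lambda>500 by simp
    finally show ?thesis .
  qed
  have "real (W y) \<le> 2 / real q *
     real (card {m::nat. real m \<le> real q * (y + 1) \<and> chi m = 1 \<and> (\<forall>p. prime p \<longrightarrow> real p \<le> z \<longrightarrow> \<not> p dvd m)})"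
    unfolding z_def using q qz ypos by (intro W_le_char) (auto simp: z_def)
  also have "\<dots> \<le> 2 / real q * (1 + ?\<pi> + 16 * X / ln X * ((2 * ln (sqrt X / z) + 4 * ln 2) / ln z))"
    unfolding qy using card_rough_chi_le[OF z1 zX Xz X4] by (intro mult_left_mono) auto
  also have "\<dots> \<le> 2 / real q * (1 + ?\<pi> + 16 * X / ln X * (16 / A))"
    using frac X4 by (intro mult_left_mono add_left_mono) auto
  also have "\<dots> = 4 * ((1 + ?\<pi>) * \<Lambda> / X + 256 / A) * (X / (2 * real q) / \<Lambda>)"
    using X \<Lambda>500 q A by (simp add: \<Lambda>_def[symmetric] field_simps)
  also have "\<dots> \<le> 4 * ((1 + ?\<pi>) * \<Lambda> / X + 256 / A) * (y / ln y)"
  proof (rule mult_left_mono)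
    show "X / (2 * real q) / \<Lambda> \<le> y / ln y"
      using y1 lny2 lny0 X ypos ygt1 by (intro frac_le) auto
  qed (use X \<Lambda>500 A in auto)
  finally show "real (W y) \<le> 4 * ((1 + ?\<pi>) * \<Lambda> / X + 256 / A) * (y / ln y)" .
  have "\<Lambda> / 2 \<le> \<Lambda> - l" using small \<Lambda>500 by linarith
  then show "exp (\<Lambda> / 2) - 1 \<le> y" unfolding y_def Xq by simp
qed

end

section \<open>Choice of the modulus and of the scale\<close>

lemma exists_sparse_modulus:
  assumes "exceptional_zeros_exist" "C > 0" "\<theta> > 0"
  obtains q chi \<delta> where "q \<ge> N" "nonprincipal_real_char q chi" "0 \<le> \<delta>" "\<delta> \<le> 1 / 4"
    "(\<lambda>N. \<Sum>n<N. chi n * real n powr (\<delta> - 1)) \<longlonglongrightarrow> 0" "\<delta> * (C * ln (real q)) \<le> \<theta>"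
proof -
  obtain E \<chi>' \<delta> where E: "infinite E"
    "\<And>q. q \<in> E \<Longrightarrow> real_dirichlet_character q (\<chi>' q) \<and> dirichlet_L_zero q (\<chi>' q) (complex_of_real (1 - \<delta> q))"
    "\<delta> \<in> o[inf at_top (principal E)](\<lambda>q. 1 / ln (real q))"
    using assms(1) unfolding exceptional_zeros_exist_def by blast
  \<comment> \<open>The bound \<open>\<theta> / C\<close> is the one wanted for
    \<open>\<delta> * ln q\<close>; the bound \<open>1 / 4\<close> passes to \<open>\<delta>\<close>
    itself because \<open>ln q \<ge> 1\<close>.\<close>
  define c where "c = min (1 / 4) (\<theta> / C)"
  have c: "c > 0" using assms by (simp add: c_def)
  have "eventually (\<lambda>q. norm (\<delta> q) \<le> c * norm (1 / ln (real q))) (inf at_top (principal E))"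
    using landau_o.smallD[OF E(3) c] .
  then have "eventually (\<lambda>q. q \<in> E \<longrightarrow> norm (\<delta> q) \<le> c * norm (1 / ln (real q))) at_top"
    by (simp add: eventually_inf_principal)
  then obtain N' where N': "\<And>q. q \<ge> N' \<Longrightarrow> q \<in> E \<Longrightarrow> norm (\<delta> q) \<le> c * norm (1 / ln (real q))"
    by (auto simp: eventually_at_top_linorder)
  obtain q where q: "q \<in> E" "q \<ge> max N (max N' 3)"
    using E(1) by (meson finite_nat_set_iff_bounded_le linear)
  have "exp 1 \<le> (3::real)" by (rule exp_le)
  then have lnq: "ln (real q) \<ge> 1" using q by (subst ln_ge_iff) auto
  have d: "\<bar>\<delta> q\<bar> * ln (real q) \<le> c" using N'[of q] q lnq by (auto simp: field_simps)
  have "\<bar>\<delta> q\<bar> * 1 \<le> \<bar>\<delta> q\<bar> * ln (real q)" using lnq by (intro mult_left_mono) auto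
  then have d4: "\<bar>\<delta> q\<bar> \<le> 1 / 4" using d by (simp add: c_def)
  obtain chi where chi: "nonprincipal_real_char q chi" "\<delta> q \<ge> 0"
    "(\<lambda>N. \<Sum>n<N. chi n * real n powr (\<delta> q - 1)) \<longlonglongrightarrow> 0"
    using real_zero_imp_series_zero[of q "\<chi>' q" "\<delta> q"] E(2)[OF q(1)] d4 by blast
  have "\<delta> q * ln (real q) \<le> \<theta> / C" using d chi(2) by (simp add: c_def)
  then have "\<delta> q * (C * ln (real q)) \<le> \<theta>" using assms(2) by (simp add: field_simps)
  then show ?thesis using that[of q chi "\<delta> q"] chi d4 q by auto
qed

lemma W_small:
  assumes exc: "exceptional_zeros_exist" and \<epsilon>: "\<epsilon> > 0"
  obtains y where "y \<ge> Y0" "y \<ge> 2" "real (W y) \<le> \<epsilon> * (y / ln y)"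
proof -
  \<comment> \<open>In the end three contributions of at most \<open>\<epsilon> / 16\<close> occur,
    with a factor 4 in front: products of two primes via \<open>A\<close>, primes above
    \<open>q ^ 6\<close> via \<open>\<eta>\<close>, and the numbers up to
    \<open>q ^ 6\<close>.\<close>
  define A where "A = max 100 (4096 / \<epsilon>)"
  define \<eta> where "\<eta> = \<epsilon> / 16"
  \<comment> \<open>Chosen so that \<open>C * ln q\<close> bounds \<open>ln (q ^ 6 * Y)\<close>,
    which is at most \<open>6 * l + 4 * (A * l + 1)\<close> with
    \<open>l = ln q \<ge> 1\<close>.\<close>
  define C where "C = 4 * A + 10"
  \<comment> \<open>\<open>ln 2\<close> is what \<open>sum_inverse_primes_le\<close> asks for, and
    \<open>ln (1 + \<eta> / 8)\<close> bounds the growth term there by \<open>\<eta> / 8\<close>.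
    With another \<open>\<eta> / 8\<close> for the error, the sum stays below the
    \<open>3 / 8 * \<eta>\<close> of \<open>exists_sparse_power\<close>.\<close>
  define \<theta> where "\<theta> = min (ln 2) (ln (1 + \<eta> / 8))"
  have A: "A \<ge> 100" "256 / A \<le> \<epsilon> / 16" using \<epsilon> by (auto simp: A_def field_simps max_def)
  have pos: "\<eta> > 0" "C > 0" "\<theta> > 0" using \<epsilon> A by (auto simp: \<eta>_def C_def \<theta>_def)
  have "\<forall>\<^sub>F \<Lambda> in at_top. ln \<Lambda> + 5 \<le> \<Lambda> / A" using A(1) by real_asymp
  moreover have "\<forall>\<^sub>F \<Lambda> in at_top. 2 * \<Lambda> * exp (- \<Lambda> / 2) \<le> \<epsilon> / 16" using \<epsilon> by real_asymp
  moreover have "\<forall>\<^sub>F \<Lambda> in at_top. max Y0 2 \<le> exp (\<Lambda> / 2) - 1" by real_asymp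
  moreover have "\<forall>\<^sub>F \<Lambda>::real in at_top. 1 \<le> \<Lambda>" by (rule eventually_ge_at_top)
  ultimately have "\<forall>\<^sub>F \<Lambda> in at_top. ln \<Lambda> + 5 \<le> \<Lambda> / A \<and> 2 * \<Lambda> * exp (- \<Lambda> / 2) \<le> \<epsilon> / 16 \<and>
      max Y0 2 \<le> exp (\<Lambda> / 2) - 1 \<and> 1 \<le> \<Lambda>" by eventually_elim auto
  then obtain \<Lambda>1 where \<Lambda>1: "\<And>\<Lambda>. \<Lambda> \<ge> \<Lambda>1 \<Longrightarrow> ln \<Lambda> + 5 \<le> \<Lambda> / A \<and> 2 * \<Lambda> * exp (- \<Lambda> / 2) \<le> \<epsilon> / 16 \<and>
      max Y0 2 \<le> exp (\<Lambda> / 2) - 1 \<and> 1 \<le> \<Lambda>" by (auto simp: eventually_at_top_linorder)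
  have "\<forall>\<^sub>F q in at_top. \<Lambda>1 \<le> A * ln (real q)" using A by real_asymp
  moreover have "\<forall>\<^sub>F q in at_top. (16 * (C * ln (real q)) + 18) / real q \<le> \<eta> / 8" using pos by real_asymp
  ultimately have "\<forall>\<^sub>F q in at_top. \<Lambda>1 \<le> A * ln (real q) \<and> (16 * (C * ln (real q)) + 18) / real q \<le> \<eta> / 8"
    by eventually_elim auto
  then obtain N where N: "\<And>q. q \<ge> N \<Longrightarrow> \<Lambda>1 \<le> A * ln (real q) \<and> (16 * (C * ln (real q)) + 18) / real q \<le> \<eta> / 8"
    by (auto simp: eventually_at_top_linorder)
  obtain q chi \<delta> where q: "q \<ge> max N 3" and chi: "nonprincipal_real_char q chi" and \<delta>: "0 \<le> \<delta>" "\<delta> \<le> 1 / 4"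
    and zero: "(\<lambda>N. \<Sum>n<N. chi n * real n powr (\<delta> - 1)) \<longlonglongrightarrow> 0" and \<delta>\<theta>: "\<delta> * (C * ln (real q)) \<le> \<theta>"
    by (rule exists_sparse_modulus[OF exc pos(2,3), where N = "max N 3"])
  interpret nonprincipal_real_char q chi by (rule chi)
  define l where "l = ln (real q)"
  have "exp 1 \<le> (3::real)" by (rule exp_le)
  then have l1: "l \<ge> 1" using q unfolding l_def by (subst ln_ge_iff) auto
  have q3: "q \<ge> 3" "q \<ge> N" using q by auto
  \<comment> \<open>So that \<open>X = 2 ^ i\<close> with \<open>i \<ge> I\<close> satisfies
    \<open>A * ln q \<le> ln X\<close>, while \<open>i < 4 * I\<close> keeps \<open>X\<close> below
    \<open>Y\<close>.\<close>
  define I where "I = nat \<lceil>A * l / ln 2\<rceil>"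
  have l2: "0 < ln (2::real)" "ln (2::real) \<le> 1" using ln2_le_25_over_36 by auto
  have "A * l / ln 2 > 0" using A l1 by simp
  then have I: "A * l / ln 2 \<le> real I" "real I \<le> A * l / ln 2 + 1" "I \<ge> 1" unfolding I_def by linarith+
  define Y where "Y = (2::nat) ^ (4 * I)"
  have lnY: "ln (real Y) = 4 * (real I * ln 2)" by (simp add: Y_def ln_realpow)
  have I2: "real I * ln 2 \<le> A * l + 1" using mult_right_mono[OF I(2), of "ln 2"] l2 by (simp add: algebra_simps)
  have I2': "A * l \<le> real I * ln 2" using mult_right_mono[OF I(1), of "ln 2"] l2 by simp
  have lnq6: "ln (real (q ^ 6 * Y)) = 6 * l + ln (real Y)"
    using q3 by (simp add: ln_mult ln_realpow l_def Y_def)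
  have Cl: "ln (real (q ^ 6 * Y)) \<le> C * l"
    unfolding lnq6 lnY C_def using I2 l1 by (simp add: algebra_simps)
  have lnYC: "ln (real Y) \<le> C * l" using Cl lnq6 l1 by linarith
  have \<delta>l: "\<delta> * ln (real (q ^ 6 * Y)) \<le> \<theta>" "\<delta> * ln (real Y) \<le> \<theta>"
    using mult_left_mono[OF Cl \<delta>(1)] mult_left_mono[OF lnYC \<delta>(1)] \<delta>\<theta> by (auto simp: l_def)
  define S where "S = {p. prime p \<and> q ^ 6 < p \<and> p \<le> Y \<and> chi p = 1}"
  have finS: "finite S" by (rule finite_subset[of _ "{..Y}"]) (auto simp: S_def)
  have "(\<Sum>p\<in>S. 1 / real p) \<le> (exp (\<delta> * ln (real Y)) - 1) + (16 * ln (real (q ^ 6 * Y)) + 18) / real q"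
    unfolding S_def using q3 \<delta> zero \<delta>l by (intro sum_inverse_primes_le) (auto simp: Y_def \<theta>_def)
  also have "exp (\<delta> * ln (real Y)) \<le> exp (ln (1 + \<eta> / 8))" using \<delta>l(2) by (simp add: \<theta>_def)
  also have "\<dots> = 1 + \<eta> / 8" using pos by simp
  also have "(16 * ln (real (q ^ 6 * Y)) + 18) / real q \<le> (16 * (C * l) + 18) / real q"
    using Cl by (intro divide_right_mono) auto
  also have "\<dots> \<le> \<eta> / 8" using N[OF q3(2)] by (simp add: l_def)
  finally have "(\<Sum>p\<in>S. 1 / real p) < 3 / 8 * \<eta>" using pos by simp
  then obtain i where i: "I \<le> i" "i < 4 * I" "real (card {p\<in>S. p \<le> 2 ^ i}) * real i / 2 ^ i \<le> \<eta>"
    using exists_sparse_power[OF I(3) finS] by (auto simp: S_def dest: prime_gt_0_nat)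
  define X where "X = (2::real) ^ i"
  define \<Lambda> where "\<Lambda> = ln X"
  have X: "X > 0" by (simp add: X_def)
  have \<Lambda>i: "\<Lambda> = real i * ln 2" by (simp add: \<Lambda>_def X_def ln_realpow)
  have "A * l \<le> real i * ln 2" by (rule order_trans[OF I2']) (use i(1) l2 in \<open>auto intro!: mult_right_mono\<close>)
  then have A\<Lambda>: "A * l \<le> \<Lambda>" by (simp add: \<Lambda>i)
  then have "\<Lambda> \<ge> \<Lambda>1" using N[OF q3(2)] by (simp add: l_def)
  note \<Lambda>1 = \<Lambda>1[OF this]
  let ?\<pi> = "real (card {p::nat. prime p \<and> chi p = 1 \<and> real p \<le> X})"
  have Xexp: "X = exp \<Lambda>" using X by (simp add: \<Lambda>_def)
  have "real (q ^ 6) = exp (6 * l)"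
    using q3 exp_of_nat_mult[of 6 l] by (simp add: l_def)
  also have "\<dots> \<le> exp (\<Lambda> / 2)"
  proof -
    have "100 * l \<le> A * l" using A l1 by (intro mult_right_mono) auto
    then have "6 * l \<le> \<Lambda> / 2" using A\<Lambda> l1 by linarith
    then show ?thesis by simp
  qed
  finally have q6: "real (q ^ 6) \<le> exp (\<Lambda> / 2)" .
  \<comment> \<open>The reciprocal sum says nothing about primes up to \<open>q ^ 6\<close>. They
    are counted trivially, which is affordable as \<open>q ^ 6 \<le> sqrt X\<close>.\<close>
  have "{p::nat. prime p \<and> chi p = 1 \<and> real p \<le> X} \<subseteq> {1..q ^ 6} \<union> {p\<in>S. p \<le> 2 ^ i}"
  proof
    fix p assume p: "p \<in> {p::nat. prime p \<and> chi p = 1 \<and> real p \<le> X}"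
    then have "real p \<le> real (2 ^ i)" by (simp add: X_def)
    then have pi: "p \<le> 2 ^ i" by (simp only: of_nat_le_iff)
    also have "\<dots> \<le> Y" unfolding Y_def using i by (intro power_increasing) auto
    finally show "p \<in> {1..q ^ 6} \<union> {p\<in>S. p \<le> 2 ^ i}"
      using p pi by (cases "p \<le> q ^ 6") (auto simp: S_def Suc_le_eq dest: prime_gt_0_nat)
  qed
  then have "card {p::nat. prime p \<and> chi p = 1 \<and> real p \<le> X} \<le> card ({1..q ^ 6} \<union> {p\<in>S. p \<le> 2 ^ i})"
    using finS by (intro card_mono) auto
  also have "\<dots> \<le> q ^ 6 + card {p\<in>S. p \<le> 2 ^ i}" using card_Un_le[of "{1..q ^ 6}" "{p\<in>S. p \<le> 2 ^ i}"] by simp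
  finally have "?\<pi> \<le> real (q ^ 6) + real (card {p\<in>S. p \<le> 2 ^ i})" by linarith
  then have \<pi>: "1 + ?\<pi> \<le> 2 * exp (\<Lambda> / 2) + real (card {p\<in>S. p \<le> 2 ^ i})"
    using q6 \<Lambda>1 one_le_exp_iff[of "\<Lambda> / 2"] by linarith
  have "(1 + ?\<pi>) * \<Lambda> / X \<le> (2 * exp (\<Lambda> / 2) + real (card {p\<in>S. p \<le> 2 ^ i})) * \<Lambda> / X"
    using \<pi> X \<Lambda>1 by (intro divide_right_mono mult_right_mono) auto
  also have "\<dots> = 2 * \<Lambda> * (exp (\<Lambda> / 2) / X) + real (card {p\<in>S. p \<le> 2 ^ i}) * \<Lambda> / X"
    by (simp add: algebra_simps add_divide_distrib)
  also have "exp (\<Lambda> / 2) / X = exp (- \<Lambda> / 2)" by (simp add: Xexp flip: exp_diff)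
  also have "real (card {p\<in>S. p \<le> 2 ^ i}) * \<Lambda> / X \<le> real (card {p\<in>S. p \<le> 2 ^ i}) * real i / X"
    using X l2 by (intro divide_right_mono mult_left_mono) (auto simp: \<Lambda>i mult_left_le)
  also have "\<dots> \<le> \<eta>" using i(3) by (simp add: X_def)
  finally have "(1 + ?\<pi>) * \<Lambda> / X \<le> \<epsilon> / 16 + \<epsilon> / 16" using \<Lambda>1 by (simp add: \<eta>_def)
  then have le: "4 * ((1 + ?\<pi>) * \<Lambda> / X + 256 / A) \<le> \<epsilon>" using A(2) \<epsilon> by argo
  define y where "y = X / real q - 1"
  have y: "exp (\<Lambda> / 2) - 1 \<le> y"
    "real (W y) \<le> 4 * ((1 + ?\<pi>) * \<Lambda> / X + 256 / A) * (y / ln y)"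
    unfolding y_def \<Lambda>_def using q3 A A\<Lambda> \<Lambda>1 X
    by (intro W_le_of_sparse[of A X]; simp add: \<Lambda>_def l_def)+
  have y2: "y \<ge> Y0" "y \<ge> 2" using y(1) \<Lambda>1 by auto
  have "4 * ((1 + ?\<pi>) * \<Lambda> / X + 256 / A) * (y / ln y) \<le> \<epsilon> * (y / ln y)"
    using le y2 by (intro mult_right_mono) auto
  with y(2) y2 that show ?thesis by fastforce
qed

section \<open>Consequences for g and for prime gaps\<close>

lemma Liminf_W:
  assumes "exceptional_zeros_exist"
  shows "Liminf at_top (\<lambda>y::real. ereal (real (W y) / (y / ln y))) = 0"
proof (rule antisym)
  show "0 \<le> Liminf at_top (\<lambda>y::real. ereal (real (W y) / (y / ln y)))"
  proof (rule Liminf_bounded)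
    show "\<forall>\<^sub>F y::real in at_top. 0 \<le> ereal (real (W y) / (y / ln y))"
      using eventually_ge_at_top[of 2] by eventually_elim auto
  qed
  show "Liminf at_top (\<lambda>y::real. ereal (real (W y) / (y / ln y))) \<le> 0"
  proof (rule ccontr)
    assume "\<not> Liminf at_top (\<lambda>y::real. ereal (real (W y) / (y / ln y))) \<le> 0"
    then obtain \<epsilon> where \<epsilon>: "0 < ereal \<epsilon>" "ereal \<epsilon> < Liminf at_top (\<lambda>y::real. ereal (real (W y) / (y / ln y)))"
      using ereal_dense2[of 0] by (auto simp: not_le)
    from less_LiminfD[OF \<epsilon>(2)] obtain Y where Y: "\<And>y. y \<ge> Y \<Longrightarrow> \<epsilon> < real (W y) / (y / ln y)"
      by (auto simp: eventually_at_top_linorder)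
    have "\<epsilon> > 0" using \<epsilon>(1) by simp
    then obtain y where y: "y \<ge> Y" "y \<ge> 2" "real (W y) \<le> \<epsilon> * (y / ln y)"
      using W_small[OF assms] by metis
    have "y / ln y > 0" using y(2) by simp
    then have "real (W y) / (y / ln y) \<le> \<epsilon>" using y(3) by (subst pos_divide_le_eq)
    then show False using Y[OF y(1)] by simp
  qed
qed

text \<open>If \<open>W y * ln y \<le> y / K\<close>, then \<open>y\<close> is admissible in the
  supremum that defines \<open>g\<close> at \<open>u = y / K\<close>.\<close>

lemma g_large:
  assumes "exceptional_zeros_exist" "K > 0"
  obtains u where "u \<ge> U" "u > 0" "ereal (K * u) \<le> g u"
proof -
  obtain y where y: "y \<ge> K * max U 1" "y \<ge> 2" "real (W y) \<le> (1 / K) * (y / ln y)"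
    using W_small[OF assms(1), of "1 / K"] assms(2) by (metis zero_less_divide_1_iff)
  define u where "u = y / K"
  have "ln y > 0" using y by simp
  then have "real (W y) * ln y \<le> (1 / K) * (y / ln y) * ln y" using y(3) by (intro mult_right_mono) auto
  then have "real (W y) * ln y \<le> u" using \<open>ln y > 0\<close> by (simp add: u_def)
  then have "ereal y \<le> g u" unfolding g_def using y by (intro SUP_upper) auto
  moreover have "K * u = y" using assms by (simp add: u_def)
  moreover have "max U 1 \<le> u" using y(1) assms unfolding u_def
    by (subst pos_le_divide_eq) (simp_all only: mult.commute)
  ultimately show ?thesis using that[of u] by simp
qed

lemma Limsup_g:
  assumes "exceptional_zeros_exist"
  shows "Limsup at_top (\<lambda>u::real. g u / ereal u) = \<infinity>"
proof (rule ccontr)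
  assume "Limsup at_top (\<lambda>u::real. g u / ereal u) \<noteq> \<infinity>"
  then obtain K where K: "Limsup at_top (\<lambda>u::real. g u / ereal u) < ereal K"
    using less_PInf_Ex_of_nat by auto
  from Limsup_lessD[OF this] obtain U where U: "\<And>u. u \<ge> U \<Longrightarrow> g u / ereal u < ereal K"
    by (auto simp: eventually_at_top_linorder)
  have K1: "max K 1 > 0" by simp
  obtain u where u: "u \<ge> U" "u > 0" "ereal (max K 1 * u) \<le> g u"
    by (rule g_large[OF assms K1, where U = U])
  have "ereal (max K 1 * u) / ereal u \<le> g u / ereal u" using u by (intro ereal_divide_right_mono) auto
  also have "\<dots> < ereal K" using U u by auto
  finally show False using u by simp
qed

lemma g_mono: "u \<le> v \<Longrightarrow> g u \<le> g v"
  unfolding g_def by (intro SUP_subset_mono) auto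

lemma largest_gap_ge:
  assumes "a \<le> b" "{a..b} \<subseteq> {1..x}" "{a..b} \<inter> real ` A = {}"
  shows "b - a \<le> largest_gap A x"
  unfolding largest_gap_def
proof (rule cSup_upper)
  show "bdd_above {b - a |a b. a \<le> b \<and> {a..b} \<subseteq> {1..x} \<and> {a..b} \<inter> real ` A = {}}"
    by (rule bdd_aboveI[of _ "x - 1"]) auto
qed (use assms in blast)

lemma Limsup_largest_gap_eqI:
  assumes "\<And>K X. K > 0 \<Longrightarrow> \<exists>x\<ge>X. K * (ln x)\<^sup>2 \<le> largest_gap A x"
  shows "Limsup at_top (\<lambda>x::real. ereal (largest_gap A x / (ln x)\<^sup>2)) = \<infinity>"
proof (rule ccontr)
  assume "Limsup at_top (\<lambda>x::real. ereal (largest_gap A x / (ln x)\<^sup>2)) \<noteq> \<infinity>"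
  then obtain K where K: "Limsup at_top (\<lambda>x::real. ereal (largest_gap A x / (ln x)\<^sup>2)) < ereal K"
    using less_PInf_Ex_of_nat by auto
  from Limsup_lessD[OF this] obtain X where X: "\<And>x. x \<ge> X \<Longrightarrow> largest_gap A x / (ln x)\<^sup>2 < K"
    by (auto simp: eventually_at_top_linorder)
  obtain x where x: "x \<ge> max X 2" "max K 1 * (ln x)\<^sup>2 \<le> largest_gap A x"
  proof -
    have "max K 1 > 0" by simp
    then show ?thesis using assms[of "max K 1" "max X 2"] that by blast
  qed
  have "ln x > 0" using x by simp
  then have "max K 1 \<le> largest_gap A x / (ln x)\<^sup>2" using x(2) by (subst pos_le_divide_eq) auto
  then show False using X[of x] x by simp
qed

lemma \<xi>_pos: "\<xi> > 0"
  by (simp add: \<xi>_def)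

lemma Limsup_prime_gap:
  assumes "exceptional_zeros_exist" "prime_gap_conjecture"
  shows "Limsup at_top (\<lambda>x::real. ereal (largest_gap {p. prime p} x / (ln x)\<^sup>2)) = \<infinity>"
proof (rule Limsup_largest_gap_eqI)
  fix K X :: real assume K: "K > 0"
  obtain \<epsilon> :: "real \<Rightarrow> real" where \<epsilon>: "\<epsilon> \<in> o(\<lambda>_. 1)"
    "(\<lambda>x. g ((\<xi> - \<epsilon> x) * (ln x)\<^sup>2)) \<lesssim> (\<lambda>x. ereal (largest_gap {p. prime p} x))"
    using assms(2) unfolding prime_gap_conjecture_def by blast
  have "\<forall>\<^sub>F x in at_top. norm (\<epsilon> x) \<le> \<xi> / 2 * norm (1::real)"
    using \<xi>_pos by (intro landau_o.smallD[OF \<epsilon>(1)]) simp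
  moreover have "\<forall>\<^sub>F x in at_top. g ((\<xi> - \<epsilon> x) * (ln x)\<^sup>2) / ereal (largest_gap {p. prime p} x) < ereal 2"
    using \<epsilon>(2) unfolding asymp_le_def
    by (intro Limsup_lessD) (erule le_less_trans, simp)
  ultimately have "\<forall>\<^sub>F x in at_top. \<bar>\<epsilon> x\<bar> \<le> \<xi> / 2 \<and>
      g ((\<xi> - \<epsilon> x) * (ln x)\<^sup>2) / ereal (largest_gap {p. prime p} x) < ereal 2" by eventually_elim auto
  then obtain X1 where X1: "\<And>x. x \<ge> X1 \<Longrightarrow> \<bar>\<epsilon> x\<bar> \<le> \<xi> / 2 \<and>
      g ((\<xi> - \<epsilon> x) * (ln x)\<^sup>2) / ereal (largest_gap {p. prime p} x) < ereal 2"
    by (auto simp: eventually_at_top_linorder)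
  define M where "M = max (max X X1) 5"
  \<comment> \<open>Of the factor 4, one 2 pays for the ratio bound \<open>ereal 2\<close> and the
    other for replacing \<open>\<xi> - \<epsilon> x\<close> by \<open>\<xi> / 2\<close>.\<close>
  have "4 * K / \<xi> > 0" using K \<xi>_pos by simp
  then obtain u where u: "u \<ge> \<xi> / 2 * (ln M)\<^sup>2" "u > 0" "ereal ((4 * K / \<xi>) * u) \<le> g u"
    by (rule g_large[OF assms(1)])
  \<comment> \<open>The solution of \<open>\<xi> / 2 * (ln x)\<^sup>2 = u\<close>.\<close>
  define x where "x = exp (sqrt (2 * u / \<xi>))"
  have "(ln M)\<^sup>2 \<le> 2 * u / \<xi>" using u(1) \<xi>_pos by (simp add: field_simps)
  then have "ln M \<le> sqrt (2 * u / \<xi>)" by (rule real_le_rsqrt)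
  then have "exp (ln M) \<le> x" unfolding x_def by (simp only: exp_le_cancel_iff)
  moreover have "M > 0" by (simp add: M_def)
  ultimately have x: "x \<ge> X" "x \<ge> X1" "x \<ge> 5" by (auto simp: M_def)
  have lnx: "(ln x)\<^sup>2 = 2 * u / \<xi>" using u(2) \<xi>_pos by (simp add: x_def)
  \<comment> \<open>The ratio bound can be multiplied out only if the gap is positive; the
    prime-free interval from \<open>7 / 2\<close> to 4 witnesses this.\<close>
  have gap: "0 < largest_gap {p. prime p} x"
  proof -
    have "{7 / 2..4} \<inter> real ` {p. prime p} = {}"
    proof -
      have False if "prime p" "7 / 2 \<le> real p" "real p \<le> 4" for p
      proof -
        have "p = 4" using that by linarith
        then show False using that(1) primes_dvd_imp_eq[of 2 p] by simp
      qed
      then show ?thesis by auto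
    qed
    then have "4 - 7 / 2 \<le> largest_gap {p. prime p} x" using x by (intro largest_gap_ge) auto
    then show ?thesis by simp
  qed
  have "u = \<xi> / 2 * (ln x)\<^sup>2" using lnx \<xi>_pos by simp
  also have "\<dots> \<le> (\<xi> - \<epsilon> x) * (ln x)\<^sup>2" using X1[OF x(2)] by (intro mult_right_mono) auto
  finally have "g u \<le> g ((\<xi> - \<epsilon> x) * (ln x)\<^sup>2)" by (rule g_mono)
  also have "\<dots> < ereal (largest_gap {p. prime p} x) * ereal 2"
    using X1[OF x(2)] gap by (subst (asm) ereal_divide_less_iff) (auto simp: mult.commute)
  finally have "ereal ((4 * K / \<xi>) * u) < ereal (largest_gap {p. prime p} x) * ereal 2"
    using u(3) by (rule le_less_trans[rotated])
  then have "(4 * K / \<xi>) * u < largest_gap {p. prime p} x * 2" by simp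
  moreover have "(4 * K / \<xi>) * u = 2 * (K * (ln x)\<^sup>2)" unfolding lnx by simp
  ultimately have "K * (ln x)\<^sup>2 \<le> largest_gap {p. prime p} x" by linarith
  then show "\<exists>x\<ge>X. K * (ln x)\<^sup>2 \<le> largest_gap {p. prime p} x" using x(1) by blast
qed

section \<open>Random residue classes\<close>

definition hits :: "nat set \<Rightarrow> (nat \<Rightarrow> int) \<Rightarrow> int \<Rightarrow> bool" where
  "hits A a t \<longleftrightarrow> (\<exists>p\<in>A. [t = a p] (mod int p))"

text \<open>Every estimate involves finitely many primes only, so probabilities are computed in a
  discrete product, with default 0 outside \<open>A\<close>. The transfer to
  \<open>random_residues\<close> is \<open>random_residues_event\<close>.\<close>

definition residue_pmf :: "nat set \<Rightarrow> (nat \<Rightarrow> int) pmf" where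
  "residue_pmf A = Pi_pmf A 0 (\<lambda>p. pmf_of_set {0..<int p})"

abbreviation residue_prob :: "nat set \<Rightarrow> ((nat \<Rightarrow> int) \<Rightarrow> bool) \<Rightarrow> real" where
  "residue_prob A P \<equiv> measure_pmf.prob (residue_pmf A) {a. P a}"

lemma prime_residues: "prime (p::nat) \<Longrightarrow> finite {0..<int p} \<and> {0..<int p} \<noteq> {}"
  by (auto dest: prime_gt_0_nat)

lemma finite_set_residue_pmf:
  assumes "finite A" "\<And>p. p \<in> A \<Longrightarrow> prime p"
  shows "finite (set_pmf (residue_pmf A))"
proof -
  have s: "set_pmf (pmf_of_set {0..<int p}) = {0..<int p}" if "p \<in> A" for p
    using prime_residues[OF assms(2)[OF that]] by (auto intro!: set_pmf_of_set)
  have "set_pmf (residue_pmf A) \<subseteq> PiE_dflt A 0 (\<lambda>p. {0..<int p})"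
    unfolding residue_pmf_def set_Pi_pmf[OF assms(1)] using s by (auto simp: PiE_dflt_def)
  moreover have "finite (PiE_dflt A 0 (\<lambda>p. {0..<int p}))"
    using assms by (intro finite_PiE_dflt) auto
  ultimately show ?thesis by (rule finite_subset)
qed

text \<open>Avoiding \<open>D\<close> is a condition on each prime separately, so independence gives
  an exact product. Hitting all of \<open>D\<close> has no such form and is reduced to avoidance in
  \<open>residue_prob_hit_avoid\<close>.\<close>

lemma residue_prob_avoid:
  assumes A: "finite A" "\<And>p. p \<in> A \<Longrightarrow> prime p" and D: "finite D"
    "\<And>p. p \<in> A \<Longrightarrow> inj_on (\<lambda>t. t mod int p) D"
  shows "residue_prob A (\<lambda>a. \<forall>t\<in>D. \<not> hits A a t) = (\<Prod>p\<in>A. 1 - real (card D) / real p)"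
proof -
  have "{a. \<forall>t\<in>D. \<not> hits A a t} = Pi A (\<lambda>p. {c. \<forall>t\<in>D. \<not> [t = c] (mod int p)})"
    by (auto simp: hits_def Pi_def)
  then have "residue_prob A (\<lambda>a. \<forall>t\<in>D. \<not> hits A a t) =
     (\<Prod>p\<in>A. measure_pmf.prob (pmf_of_set {0..<int p}) {c. \<forall>t\<in>D. \<not> [t = c] (mod int p)})"
    unfolding residue_pmf_def using A by (simp add: measure_Pi_pmf_Pi)
  also have "\<dots> = (\<Prod>p\<in>A. 1 - real (card D) / real p)"
  proof (rule prod.cong[OF refl])
    fix p assume p: "p \<in> A"
    then have p0: "p > 0" using A by (auto dest: prime_gt_0_nat)
    have eq: "{0..<int p} \<inter> {c. \<forall>t\<in>D. \<not> [t = c] (mod int p)} = {0..<int p} - (\<lambda>t. t mod int p) ` D"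
      by (auto simp: cong_def)
    have sub: "(\<lambda>t. t mod int p) ` D \<subseteq> {0..<int p}" using p0 by auto
    have "card ((\<lambda>t. t mod int p) ` D) = card D" using D(2)[OF p] by (rule card_image)
    moreover have "card ((\<lambda>t. t mod int p) ` D) \<le> card {0..<int p}" using sub by (intro card_mono) auto
    ultimately have "real (card ({0..<int p} - (\<lambda>t. t mod int p) ` D)) = real p - real (card D)"
      using sub D(1) by (subst card_Diff_subset) (auto simp: of_nat_diff)
    then show "measure_pmf.prob (pmf_of_set {0..<int p}) {c. \<forall>t\<in>D. \<not> [t = c] (mod int p)} = 1 - real (card D) / real p"
      using p0 by (subst measure_pmf_of_set) (auto simp: eq field_simps)
  qed
  finally show ?thesis .
qed

lemma residue_prob_not_hits:
  assumes A: "finite A" "\<And>p. p \<in> A \<Longrightarrow> prime p"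
  shows "residue_prob A (\<lambda>a. \<not> hits A a t) = (\<Prod>p\<in>A. 1 - 1 / real p)"
  using residue_prob_avoid[OF A, of "{t}"] by simp

(* Inclusion-exclusion, one element of D at a time: hitting is the complement of avoiding. *)
lemma residue_prob_hit_avoid:
  assumes A: "finite A" "\<And>p. p \<in> A \<Longrightarrow> prime p" and T: "finite T"
    "\<And>p. p \<in> A \<Longrightarrow> inj_on (\<lambda>t. t mod int p) T"
    and err: "\<And>k. k \<le> card T \<Longrightarrow> \<bar>(\<Prod>p\<in>A. 1 - real k / real p) - \<rho> ^ k\<bar> \<le> \<epsilon>"
    and D: "finite D" "D \<subseteq> T" "E \<subseteq> T" "D \<inter> E = {}"
  shows "\<bar>residue_prob A (\<lambda>a. (\<forall>t\<in>D. hits A a t) \<and> (\<forall>t\<in>E. \<not> hits A a t)) - (1 - \<rho>) ^ card D * \<rho> ^ card E\<bar>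
         \<le> 2 ^ card D * \<epsilon>"
  using D
proof (induction D arbitrary: E rule: finite_induct)
  case empty
  have "finite E" using T empty finite_subset by blast
  moreover have "inj_on (\<lambda>t. t mod int p) E" if "p \<in> A" for p
    using T(2)[OF that] empty inj_on_subset by blast
  ultimately show ?case using residue_prob_avoid[OF A, of E] err[of "card E"] T(1) empty
    by (simp add: card_mono)
next
  case (insert t D)
  let ?P = "\<lambda>D E. residue_prob A (\<lambda>a. (\<forall>t\<in>D. hits A a t) \<and> (\<forall>t\<in>E. \<not> hits A a t))"
  have finE: "finite E" by (rule finite_subset[OF _ T(1)]) (use insert in auto)
  have "?P D E = ?P (insert t D) E + ?P D (insert t E)"
  proof -
    let ?S = "\<lambda>D E. {a. (\<forall>t\<in>D. hits A a t) \<and> (\<forall>t\<in>E. \<not> hits A a t)}"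
    have "?S D E = ?S (insert t D) E \<union> ?S D (insert t E)" "?S (insert t D) E \<inter> ?S D (insert t E) = {}"
      by auto
    then show ?thesis by (simp only:) (rule measure_pmf.finite_measure_Union, simp_all only: sets_measure_pmf UNIV_I)
  qed
  moreover have "\<bar>?P D E - (1 - \<rho>) ^ card D * \<rho> ^ card E\<bar> \<le> 2 ^ card D * \<epsilon>"
    using insert by auto
  moreover have "\<bar>?P D (insert t E) - (1 - \<rho>) ^ card D * \<rho> ^ card (insert t E)\<bar> \<le> 2 ^ card D * \<epsilon>"
    using insert by (intro insert.IH) auto
  moreover have "card (insert t E) = Suc (card E)" "card (insert t D) = Suc (card D)"
    using finE insert by auto
  moreover have "(1 - \<rho>) ^ Suc (card D) * \<rho> ^ card E =
     (1 - \<rho>) ^ card D * \<rho> ^ card E - (1 - \<rho>) ^ card D * \<rho> ^ Suc (card E)"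
    by (simp add: algebra_simps)
  moreover have "(2::real) ^ Suc (card D) * \<epsilon> = 2 ^ card D * \<epsilon> + 2 ^ card D * \<epsilon>" by simp
  ultimately show ?case by simp
qed

section \<open>Near-independence for large primes and the second moment\<close>

lemma power_bound_second_order:
  fixes x :: real
  assumes "0 \<le> x" "x \<le> 1"
  shows "\<bar>(1 - real k * x) - (1 - x) ^ k\<bar> \<le> (real k)\<^sup>2 * x\<^sup>2"
proof -
  have "1 - real k * x \<le> (1 - x) ^ k"
    using Bernoulli_inequality[of "- x" k] assms by simp
  moreover have "(1 - x) ^ k \<le> 1 - real k * x + (real k)\<^sup>2 * x\<^sup>2"
  proof (induction k)
    case (Suc k)
    have "(1 - x) ^ Suc k \<le> (1 - real k * x + (real k)\<^sup>2 * x\<^sup>2) * (1 - x)"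
      using mult_right_mono[OF Suc, of "1 - x"] assms by (simp add: mult.commute)
    also have "\<dots> = 1 - real (Suc k) * x + (real k + (real k)\<^sup>2) * x\<^sup>2 - (real k)\<^sup>2 * x ^ 3"
      by (simp add: algebra_simps power2_eq_square power3_eq_cube)
    also have "\<dots> \<le> 1 - real (Suc k) * x + (real k + (real k)\<^sup>2) * x\<^sup>2"
      using assms by simp
    also have "(real k + (real k)\<^sup>2) * x\<^sup>2 \<le> (real (Suc k))\<^sup>2 * x\<^sup>2"
      by (intro mult_right_mono) (auto simp: power2_eq_square algebra_simps)
    finally show ?case by simp
  qed simp
  ultimately show ?thesis by linarith
qed

lemma sum_inverse_squares_le:
  assumes "U \<ge> 1" "U \<le> N"
  shows "(\<Sum>n\<in>{U<..N}. 1 / (real n)\<^sup>2) \<le> 1 / real U - 1 / real N"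
  using assms(2)
proof (induction N rule: dec_induct)
  case (step N)
  have "{U<..Suc N} = insert (Suc N) {U<..N}" using step by auto
  then have "(\<Sum>n\<in>{U<..Suc N}. 1 / (real n)\<^sup>2) = 1 / (real (Suc N))\<^sup>2 + (\<Sum>n\<in>{U<..N}. 1 / (real n)\<^sup>2)"
    by simp
  moreover have "1 / (real (Suc N))\<^sup>2 \<le> 1 / real N - 1 / real (Suc N)"
  proof -
    have "real N \<ge> 1" using step assms by simp
    then have "1 / real N - 1 / real (Suc N) = 1 / (real N * real (Suc N))" by (simp add: field_simps)
    moreover have "real N * real (Suc N) \<le> (real (Suc N))\<^sup>2" by (simp add: power2_eq_square)
    ultimately show ?thesis using \<open>real N \<ge> 1\<close> by (simp only:) (intro divide_left_mono, auto)
  qed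
  ultimately show ?case using step by linarith
qed simp

text \<open>The factors \<open>1 - k / p\<close> and \<open>(1 - 1 / p) ^ k\<close> differ by at
  most \<open>(k / p)\<^sup>2\<close>, and the sum of \<open>1 / p\<^sup>2\<close> over
  \<open>p > U\<close> is at most \<open>1 / U\<close>. Thus primes above \<open>U\<close> miss
  \<open>k\<close> given integers almost independently.\<close>

lemma prod_approx:
  fixes U :: nat
  assumes A: "finite A" "\<And>p. p \<in> A \<Longrightarrow> p > U" and U: "U \<ge> 1" "k \<le> U"
  shows "\<bar>(\<Prod>p\<in>A. 1 - real k / real p) - (\<Prod>p\<in>A. 1 - 1 / real p) ^ k\<bar> \<le> (real k)\<^sup>2 / real U"
proof -
  have bounds: "0 \<le> 1 / real p" "1 / real p \<le> 1" "0 \<le> real k / real p" "real k / real p \<le> 1" if "p \<in> A" for p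
    using A(2)[OF that] U by auto
  have "\<bar>(\<Prod>p\<in>A. 1 - real k / real p) - (\<Prod>p\<in>A. 1 - 1 / real p) ^ k\<bar> =
        norm ((\<Prod>p\<in>A. 1 - real k / real p) - (\<Prod>p\<in>A. (1 - 1 / real p) ^ k))"
    by (simp add: prod_power_distrib)
  also have "\<dots> \<le> (\<Sum>p\<in>A. norm ((1 - real k / real p) - (1 - 1 / real p) ^ k))"
    using bounds by (intro norm_prod_diff) (auto simp: abs_le_iff power_le_one intro: order_trans[of _ 0])
  also have "\<dots> \<le> (\<Sum>p\<in>A. (real k)\<^sup>2 * (1 / (real p)\<^sup>2))"
    using power_bound_second_order[of "1 / real _" k] bounds
    by (intro sum_mono) (auto simp: power_divide)
  also have "\<dots> = (real k)\<^sup>2 * (\<Sum>p\<in>A. 1 / (real p)\<^sup>2)" by (simp only: sum_distrib_left)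
  also have "\<dots> \<le> (real k)\<^sup>2 * (1 / real U)"
  proof (rule mult_left_mono)
    obtain N where N: "A \<subseteq> {..N}" using A(1) by (meson finite_nat_iff_bounded_le)
    have "(\<Sum>p\<in>A. 1 / (real p)\<^sup>2) \<le> (\<Sum>n\<in>{U<..max U N}. 1 / (real n)\<^sup>2)"
      using N A(2) by (intro sum_mono2) auto
    also have "\<dots> \<le> 1 / real U - 1 / real (max U N)" using U by (intro sum_inverse_squares_le) auto
    also have "\<dots> \<le> 1 / real U" by simp
    finally show "(\<Sum>p\<in>A. 1 / (real p)\<^sup>2) \<le> 1 / real U" .
  qed simp
  finally show ?thesis by simp
qed

lemma residue_prob_hit_bound:
  fixes U :: nat
  assumes A: "finite A" "\<And>p. p \<in> A \<Longrightarrow> prime p" "\<And>p. p \<in> A \<Longrightarrow> p > U"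
    and D: "finite D" "\<And>p. p \<in> A \<Longrightarrow> inj_on (\<lambda>t. t mod int p) D" "card D \<le> m" "m \<le> U" "1 \<le> U"
  shows "\<bar>residue_prob A (\<lambda>a. \<forall>t\<in>D. hits A a t) - (1 - (\<Prod>p\<in>A. 1 - 1 / real p)) ^ card D\<bar>
    \<le> 2 ^ m * ((real m)\<^sup>2 / real U)"
proof -
  have "\<bar>residue_prob A (\<lambda>a. (\<forall>t\<in>D. hits A a t) \<and> (\<forall>t\<in>{}. \<not> hits A a t)) -
      (1 - (\<Prod>p\<in>A. 1 - 1 / real p)) ^ card D * (\<Prod>p\<in>A. 1 - 1 / real p) ^ card ({} :: int set)\<bar>
     \<le> 2 ^ card D * ((real m)\<^sup>2 / real U)"
  proof (rule residue_prob_hit_avoid[OF A(1,2) D(1,2)])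
    fix k assume "k \<le> card D"
    then have "k \<le> m" using D by simp
    then have "\<bar>(\<Prod>p\<in>A. 1 - real k / real p) - (\<Prod>p\<in>A. 1 - 1 / real p) ^ k\<bar> \<le> (real k)\<^sup>2 / real U"
      using A D by (intro prod_approx) auto
    also have "\<dots> \<le> (real m)\<^sup>2 / real U" using \<open>k \<le> m\<close> by (intro divide_right_mono power_mono) auto
    finally show "\<bar>(\<Prod>p\<in>A. 1 - real k / real p) - (\<Prod>p\<in>A. 1 - 1 / real p) ^ k\<bar> \<le> (real m)\<^sup>2 / real U" .
  qed (use D in auto)
  also have "\<dots> \<le> 2 ^ m * ((real m)\<^sup>2 / real U)" using D by (intro mult_right_mono power_increasing) auto
  finally show ?thesis by simp
qed

text \<open>Chebyshev's inequality for the number \<open>X\<close> of sets that are hit in full.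
  Disjoint sets are nearly uncorrelated, because \<open>residue_prob_hit_bound\<close> applies also
  to their union of at most \<open>2 * n\<close> elements. As an integer is hit with probability at
  least 1/2, a set is hit in full with probability about \<open>2 ^ - n\<close> or more, so the mean
  is at least the number of sets divided by \<open>2 ^ n\<close>.\<close>

lemma residue_prob_no_full_hit:
  fixes U n :: nat and D :: "'i \<Rightarrow> int set"
  defines "e \<equiv> 2 ^ (2 * n) * ((real (2 * n))\<^sup>2 / real U)"
  assumes A: "finite A" "\<And>p. p \<in> A \<Longrightarrow> prime p" "\<And>p. p \<in> A \<Longrightarrow> p > U"
    and half: "(\<Prod>p\<in>A. 1 - 1 / real p) \<le> 1 / 2"
    and J: "finite J" "J \<noteq> {}" "\<And>j. j \<in> J \<Longrightarrow> finite (D j)" "\<And>j. j \<in> J \<Longrightarrow> card (D j) \<le> n"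
    and disj: "disjoint_family_on D J"
    and inj: "\<And>p. p \<in> A \<Longrightarrow> inj_on (\<lambda>t. t mod int p) (\<Union>j\<in>J. D j)"
    and n: "2 * n \<le> U" "1 \<le> U"
  shows "residue_prob A (\<lambda>a. \<forall>j\<in>J. \<exists>t\<in>D j. \<not> hits A a t) \<le> 2 ^ n / real (card J) + 3 * 2 ^ (2 * n) * e"
proof -
  define \<rho> where "\<rho> = (\<Prod>p\<in>A. 1 - 1 / real p)"
  define c where "c j = (1 - \<rho>) ^ card (D j)" for j
  \<comment> \<open>This is the mean that exact independence would give, not the expectation of
    \<open>X\<close>; the second moment is taken about it.\<close>
  define \<mu> where "\<mu> = (\<Sum>j\<in>J. c j)"
  define N where "N = real (card J)"
  define H where "H j = {a. \<forall>t\<in>D j. hits A a t}" for j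
  let ?M = "measure_pmf (residue_pmf A)"
  let ?pr = "measure_pmf.prob (residue_pmf A)"
  have N1: "N \<ge> 1" using J by (simp add: N_def Suc_le_eq card_gt_0_iff)
  have e0: "e \<ge> 0" by (simp add: e_def)
  have \<rho>: "0 \<le> \<rho>" "\<rho> \<le> 1 / 2"
  proof -
    show "0 \<le> \<rho>" unfolding \<rho>_def
    proof (rule prod_nonneg)
      show "0 \<le> 1 - 1 / real p" if "p \<in> A" for p
        using prime_factor_bounds(1)[OF A(2)[OF that]] by linarith
    qed
  qed (use half in \<open>simp add: \<rho>_def\<close>)
  have c: "(1 / 2) ^ n \<le> c j" "c j \<le> 1" "0 \<le> c j" if "j \<in> J" for j
  proof -
    have "(1 / 2 :: real) ^ n \<le> (1 / 2) ^ card (D j)" using J(4)[OF that] by (intro power_decreasing) auto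
    also have "\<dots> \<le> c j" unfolding c_def using \<rho> by (intro power_mono) auto
    finally show "(1 / 2) ^ n \<le> c j" .
  qed (use \<rho> in \<open>auto simp: c_def power_le_one\<close>)
  have \<mu>N: "\<mu> \<le> N" using sum_mono[of J c "\<lambda>_. 1"] c by (simp add: \<mu>_def N_def)
  have \<mu>ge: "N * (1 / 2) ^ n \<le> \<mu>" using sum_mono[of J "\<lambda>_. (1 / 2) ^ n" c] c by (simp add: \<mu>_def N_def)
  have \<mu>0: "\<mu> > 0" using \<mu>ge N1 by (intro less_le_trans[OF _ \<mu>ge] mult_pos_pos) auto
  have single: "\<bar>?pr (H j) - c j\<bar> \<le> e" if j: "j \<in> J" for j
    unfolding H_def c_def \<rho>_def e_def
  proof (rule residue_prob_hit_bound[OF A])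
    show "inj_on (\<lambda>t. t mod int p) (D j)" if "p \<in> A" for p
      by (rule inj_on_subset[OF inj[OF that]]) (use j in auto)
  qed (use J n j order_trans[OF J(4)[OF j]] in auto)
  have pair: "?pr (H i \<inter> H j) \<le> c i * c j + e" if ij: "i \<in> J" "j \<in> J" "i \<noteq> j" for i j
  proof -
    have eq: "H i \<inter> H j = {a. \<forall>t\<in>D i \<union> D j. hits A a t}" by (auto simp: H_def)
    have "D i \<inter> D j = {}" using disj ij by (auto simp: disjoint_family_on_def)
    then have cu: "card (D i \<union> D j) = card (D i) + card (D j)" using J ij by (intro card_Un_disjoint) auto
    have "\<bar>?pr (H i \<inter> H j) - (1 - \<rho>) ^ card (D i \<union> D j)\<bar> \<le> e"
      unfolding eq \<rho>_def e_def
    proof (rule residue_prob_hit_bound[OF A])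
      show "inj_on (\<lambda>t. t mod int p) (D i \<union> D j)" if "p \<in> A" for p
        by (rule inj_on_subset[OF inj[OF that]]) (use ij in auto)
      show "card (D i \<union> D j) \<le> 2 * n" unfolding cu using J(4)[OF ij(1)] J(4)[OF ij(2)] by simp
    qed (use J n ij in auto)
    then show ?thesis by (simp add: cu power_add c_def abs_le_iff)
  qed
  define X where "X a = (\<Sum>j\<in>J. indicator (H j) a :: real)" for a
  have fin: "finite (set_pmf (residue_pmf A))" using A by (intro finite_set_residue_pmf)
  have int: "integrable ?M f" for f :: "_ \<Rightarrow> real" by (rule integrable_measure_pmf_finite[OF fin])
  have sq: "(X a)\<^sup>2 = (\<Sum>i\<in>J. \<Sum>j\<in>J. indicator (H i \<inter> H j) a)" for a
    by (simp add: X_def power2_eq_square sum_product indicator_inter_arith)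
  have "(X a - \<mu>)\<^sup>2 = (\<Sum>i\<in>J. \<Sum>j\<in>J. indicator (H i \<inter> H j) a) - 2 * \<mu> * (\<Sum>j\<in>J. indicator (H j) a) + \<mu>\<^sup>2" for a
    unfolding power2_diff sq by (simp add: X_def)
  then have E: "measure_pmf.expectation (residue_pmf A) (\<lambda>a. (X a - \<mu>)\<^sup>2) =
     (\<Sum>i\<in>J. \<Sum>j\<in>J. ?pr (H i \<inter> H j)) - 2 * \<mu> * (\<Sum>j\<in>J. ?pr (H j)) + \<mu>\<^sup>2"
    by (simp add: int Bochner_Integration.integral_sum)
  \<comment> \<open>The diagonal pairs are not covered by \<open>pair\<close>; they add
    \<open>c i\<close> each, hence \<open>\<mu>\<close> in total.\<close>
  have "(\<Sum>i\<in>J. \<Sum>j\<in>J. ?pr (H i \<inter> H j)) \<le> (\<Sum>i\<in>J. \<Sum>j\<in>J. (c i * c j + e) + (if i = j then c i else 0))"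
  proof (intro sum_mono)
    fix i j assume ij: "i \<in> J" "j \<in> J"
    show "?pr (H i \<inter> H j) \<le> (c i * c j + e) + (if i = j then c i else 0)"
    proof (cases "i = j")
      case True
      have "c i * c j \<ge> 0" using c ij by simp
      then have "?pr (H i) \<le> (c i * c j + e) + c i" using single[OF ij(1)] by linarith
      then show ?thesis using True by simp
    qed (use pair ij in auto)
  qed
  also have "\<dots> = \<mu>\<^sup>2 + N\<^sup>2 * e + \<mu>"
    using J(1) by (simp add: sum.distrib \<mu>_def N_def power2_eq_square sum_product)
  finally have E1: "(\<Sum>i\<in>J. \<Sum>j\<in>J. ?pr (H i \<inter> H j)) \<le> \<mu>\<^sup>2 + N\<^sup>2 * e + \<mu>" .
  have E2: "2 * \<mu> * (\<mu> - N * e) \<le> 2 * \<mu> * (\<Sum>j\<in>J. ?pr (H j))"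
  proof (rule mult_left_mono)
    have "(\<Sum>j\<in>J. c j - e) \<le> (\<Sum>j\<in>J. ?pr (H j))"
    proof (rule sum_mono)
      show "c j - e \<le> ?pr (H j)" if "j \<in> J" for j using single[OF that] by linarith
    qed
    then show "\<mu> - N * e \<le> (\<Sum>j\<in>J. ?pr (H j))" by (simp add: sum_subtractf \<mu>_def N_def)
  qed (use \<mu>0 in simp)
  have "2 * \<mu> * (\<mu> - N * e) = 2 * \<mu>\<^sup>2 - 2 * \<mu> * N * e" by (simp add: algebra_simps power2_eq_square)
  then have "measure_pmf.expectation (residue_pmf A) (\<lambda>a. (X a - \<mu>)\<^sup>2) \<le> \<mu> + N\<^sup>2 * e + 2 * \<mu> * N * e"
    using E E1 E2 by linarith
  also have "\<dots> \<le> \<mu> + N\<^sup>2 * e + 2 * N * N * e"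
    using \<mu>N N1 e0 by (intro add_mono mult_right_mono mult_left_mono) auto
  finally have var: "measure_pmf.expectation (residue_pmf A) (\<lambda>a. (X a - \<mu>)\<^sup>2) \<le> \<mu> + 3 * N\<^sup>2 * e"
    by (simp add: power2_eq_square)
  let ?S = "{a. \<forall>j\<in>J. \<exists>t\<in>D j. \<not> hits A a t}"
  have "\<mu>\<^sup>2 * ?pr ?S = measure_pmf.expectation (residue_pmf A) (\<lambda>a. \<mu>\<^sup>2 * indicator ?S a)" by simp
  also have "\<dots> \<le> measure_pmf.expectation (residue_pmf A) (\<lambda>a. (X a - \<mu>)\<^sup>2)"
  proof (rule integral_mono[OF int int])
    fix a
    have "X a = 0" if "a \<in> ?S" using that by (auto simp: X_def H_def intro!: sum.neutral)
    then show "\<mu>\<^sup>2 * indicator ?S a \<le> (X a - \<mu>)\<^sup>2" by (auto simp: indicator_def)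
  qed
  finally have "\<mu>\<^sup>2 * ?pr ?S \<le> \<mu> + 3 * N\<^sup>2 * e" using var by linarith
  then have "?pr ?S \<le> (\<mu> + 3 * N\<^sup>2 * e) / \<mu>\<^sup>2" using \<mu>0 by (simp add: field_simps)
  also have "\<dots> = 1 / \<mu> + 3 * (N / \<mu>)\<^sup>2 * e" using \<mu>0 by (simp add: field_simps power2_eq_square)
  also have "\<dots> \<le> 2 ^ n / N + 3 * (2 ^ n)\<^sup>2 * e"
  proof (intro add_mono mult_right_mono mult_left_mono power_mono)
    have "N \<le> \<mu> * 2 ^ n" using \<mu>ge by (simp add: power_divide field_simps)
    then show "1 / \<mu> \<le> 2 ^ n / N" "N / \<mu> \<le> 2 ^ n" using \<mu>0 N1 by (auto simp: field_simps)
  qed (use e0 \<mu>0 N1 in auto)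
  finally show ?thesis by (simp add: N_def power_mult[symmetric] mult.commute)
qed

lemma prob_pair_pmf_le:
  assumes "\<And>x. x \<in> set_pmf M \<Longrightarrow> x \<notin> Bad \<Longrightarrow> measure_pmf.prob N {y. P x y} \<le> \<beta>"
    and "measure_pmf.prob M Bad \<le> \<alpha>" "0 \<le> \<beta>"
  shows "measure_pmf.prob (pair_pmf M N) {(x, y). P x y} \<le> \<alpha> + \<beta>"
proof -
  have "emeasure (measure_pmf (pair_pmf M N)) {(x, y). P x y} = (\<integral>\<^sup>+z. indicator {(x, y). P x y} z \<partial>pair_pmf M N)"
    by (simp add: nn_integral_indicator)
  also have "\<dots> = (\<integral>\<^sup>+x. \<integral>\<^sup>+y. indicator {y. P x y} y \<partial>N \<partial>M)"
    unfolding nn_integral_pair_pmf' by (intro nn_integral_cong) (simp add: indicator_def)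
  also have "\<dots> = (\<integral>\<^sup>+x. emeasure (measure_pmf N) {y. P x y} \<partial>M)" by (simp add: nn_integral_indicator)
  also have "\<dots> \<le> (\<integral>\<^sup>+x. indicator Bad x + ennreal \<beta> \<partial>M)"
  proof (rule nn_integral_mono_AE, rule AE_pmfI)
    fix x assume x: "x \<in> set_pmf M"
    show "emeasure (measure_pmf N) {y. P x y} \<le> indicator Bad x + ennreal \<beta>"
    proof (cases "x \<in> Bad")
      case True
      have "emeasure (measure_pmf N) {y. P x y} \<le> 1" by (rule measure_pmf.emeasure_le_1)
      also have "1 \<le> indicator Bad x + ennreal \<beta>" using True by simp
      finally show ?thesis .
    next
      case False
      then show ?thesis using assms(1)[OF x False] by (simp add: measure_pmf.emeasure_eq_measure ennreal_leI)
    qed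
  qed
  also have "\<dots> = emeasure (measure_pmf M) Bad + ennreal \<beta>"
    by (subst nn_integral_add) (auto simp: nn_integral_indicator)
  also have "\<dots> = ennreal (measure_pmf.prob M Bad + \<beta>)"
    using assms(3) by (simp add: measure_pmf.emeasure_eq_measure ennreal_plus)
  also have "\<dots> \<le> ennreal (\<alpha> + \<beta>)" using assms by (intro ennreal_leI) simp
  finally have "ennreal (measure_pmf.prob (pair_pmf M N) {(x, y). P x y}) \<le> ennreal (\<alpha> + \<beta>)"
    by (simp only: measure_pmf.emeasure_eq_measure)
  moreover have "0 \<le> \<alpha> + \<beta>" using assms(2,3) measure_nonneg[of M Bad] by linarith
  ultimately show ?thesis by (simp only: ennreal_le_iff)
qed

text \<open>Conditioning on the residues for \<open>A\<close>: they are fixed to \<open>f\<close>,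
  and only those for \<open>B\<close> remain random.\<close>

lemma residue_prob_union_le:
  assumes "finite A" "finite B" "A \<inter> B = {}"
    and "\<And>f. f \<in> set_pmf (residue_pmf A) \<Longrightarrow> \<not> Bad f \<Longrightarrow> residue_prob B (\<lambda>g. P (\<lambda>x. if x \<in> A then f x else g x)) \<le> \<beta>"
    and "residue_prob A Bad \<le> \<alpha>" "0 \<le> \<beta>"
  shows "residue_prob (A \<union> B) P \<le> \<alpha> + \<beta>"
proof -
  have "residue_prob (A \<union> B) P = measure_pmf.prob (pair_pmf (residue_pmf A) (residue_pmf B))
      {(f, g). P (\<lambda>x. if x \<in> A then f x else g x)}"
    unfolding residue_pmf_def Pi_pmf_union[OF assms(1-3)] measure_map_pmf
    by (rule arg_cong[of _ _ "measure _"]) auto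
  also have "\<dots> \<le> \<alpha> + \<beta>"
    by (rule prob_pair_pmf_le[where Bad = "{f. Bad f}"]) (use assms in auto)
  finally show ?thesis .
qed

lemma hits_union:
  assumes "A \<inter> B = {}"
  shows "hits (A \<union> B) (\<lambda>x. if x \<in> A then f x else f' x) t \<longleftrightarrow> hits A f t \<or> hits B f' t"
  using assms by (auto simp: hits_def)

(* Markov's inequality leaves, with high probability, at least half of the sets with at most n
   elements missed by A; for those the primes in B hit a full set by the second moment bound. *)
lemma residue_prob_two_stage:
  fixes U n w :: nat and T :: "'i \<Rightarrow> int set"
  assumes A: "finite A" "\<And>p. p \<in> A \<Longrightarrow> prime p"
    and B: "finite B" "\<And>p. p \<in> B \<Longrightarrow> prime p" "\<And>p. p \<in> B \<Longrightarrow> p > U" and AB: "A \<inter> B = {}"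
    and half: "(\<Prod>p\<in>B. 1 - 1 / real p) \<le> 1 / 2"
    and J: "finite J" "J \<noteq> {}" "\<And>j. j \<in> J \<Longrightarrow> finite (T j)" "\<And>j. j \<in> J \<Longrightarrow> card (T j) \<le> w"
    and disj: "disjoint_family_on T J"
    and inj: "\<And>p. p \<in> B \<Longrightarrow> inj_on (\<lambda>t. t mod int p) (\<Union>j\<in>J. T j)"
    and n: "2 * n \<le> U" "1 \<le> n"
  shows "residue_prob (A \<union> B) (\<lambda>a. \<forall>j\<in>J. \<exists>t\<in>T j. \<not> hits (A \<union> B) a t) \<le>
      2 * real w * (\<Prod>p\<in>A. 1 - 1 / real p) / real n +
      (2 * 2 ^ n / real (card J) + 3 * 2 ^ (2 * n) * (2 ^ (2 * n) * ((real (2 * n))\<^sup>2 / real U)))"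
proof -
  define N where "N = real (card J)"
  define \<rho> where "\<rho> = (\<Prod>p\<in>A. 1 - 1 / real p)"
  define D where "D f j = {t \<in> T j. \<not> hits A f t}" for f j
  define Y where "Y f = (\<Sum>j\<in>J. real (card (D f j)))" for f
  define Bad where "Bad f \<longleftrightarrow> N * real n / 2 < Y f" for f
  have N1: "N \<ge> 1" using J by (simp add: N_def Suc_le_eq card_gt_0_iff)
  have U: "1 \<le> U" using n by linarith
  have finD: "finite (D f j)" if "j \<in> J" for f j using J(3)[OF that] by (simp add: D_def)
  let ?\<beta> = "2 * 2 ^ n / real (card J) + 3 * 2 ^ (2 * n) * (2 ^ (2 * n) * ((real (2 * n))\<^sup>2 / real U))"
  have "residue_prob A Bad \<le> 2 * real w * \<rho> / real n"
  proof -
    have int: "integrable (measure_pmf (residue_pmf A)) f" for f :: "_ \<Rightarrow> real"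
      by (rule integrable_measure_pmf_finite[OF finite_set_residue_pmf[OF A]])
    have Y: "Y f = (\<Sum>j\<in>J. \<Sum>t\<in>T j. indicator {a. \<not> hits A a t} f)" for f
      unfolding Y_def
    proof (intro sum.cong refl)
      fix j assume "j \<in> J"
      then have "finite (T j)" by (rule J(3))
      then show "real (card (D f j)) = (\<Sum>t\<in>T j. indicator {a. \<not> hits A a t} f)"
        by (simp add: D_def indicator_def sum.If_cases Int_def conj_commute)
    qed
    have "N * real n / 2 * residue_prob A Bad = measure_pmf.expectation (residue_pmf A) (\<lambda>f. N * real n / 2 * indicator {f. Bad f} f)"
      by simp
    also have "\<dots> \<le> measure_pmf.expectation (residue_pmf A) Y"
    proof (rule integral_mono[OF int int])
      show "N * real n / 2 * indicator {f. Bad f} f \<le> Y f" for f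
        by (auto simp: indicator_def Bad_def Y_def intro: sum_nonneg)
    qed
    also have "\<dots> = (\<Sum>j\<in>J. \<Sum>t\<in>T j. residue_prob A (\<lambda>a. \<not> hits A a t))"
      unfolding Y by (simp add: int Bochner_Integration.integral_sum)
    also have "\<dots> = (\<Sum>j\<in>J. real (card (T j)) * \<rho>)"
    proof -
      have "residue_prob A (\<lambda>a. \<not> hits A a t) = \<rho>" for t
        unfolding \<rho>_def by (rule residue_prob_not_hits[OF A])
      then show ?thesis by simp
    qed
    also have "\<dots> \<le> (\<Sum>j\<in>J. real w * \<rho>)"
    proof (intro sum_mono mult_right_mono)
      show "0 \<le> \<rho>" unfolding \<rho>_def
      proof (rule prod_nonneg)
        show "0 \<le> 1 - 1 / real p" if "p \<in> A" for p
          using prime_factor_bounds(1)[OF A(2)[OF that]] by linarith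
      qed
    qed (use J in auto)
    also have "\<dots> = N * (real w * \<rho>)" by (simp add: N_def)
    finally have "N * (real n / 2 * residue_prob A Bad) \<le> N * (real w * \<rho>)" by simp
    then have "real n / 2 * residue_prob A Bad \<le> real w * \<rho>" using N1 by simp
    then show ?thesis using n by (simp add: field_simps)
  qed
  moreover have "residue_prob B (\<lambda>g. \<forall>j\<in>J. \<exists>t\<in>T j. \<not> hits (A \<union> B) (\<lambda>x. if x \<in> A then f x else g x) t) \<le> ?\<beta>"
    if "\<not> Bad f" for f
  proof -
    define G where "G = {j \<in> J. card (D f j) \<le> n}"
    have finG: "finite G" using J by (simp add: G_def)
    have "real (card (J - G)) * real n = (\<Sum>j\<in>J - G. real n)" by simp
    also have "\<dots> \<le> (\<Sum>j\<in>J - G. real (card (D f j)))"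
      by (intro sum_mono) (auto simp: G_def not_le)
    also have "\<dots> \<le> Y f" unfolding Y_def using J by (intro sum_mono2) auto
    also have "\<dots> \<le> N * real n / 2" using that by (simp add: Bad_def)
    finally have "real (card (J - G)) * real n \<le> N / 2 * real n" by simp
    then have "real (card (J - G)) \<le> N / 2" using n by simp
    moreover have "card (J - G) = card J - card G" "card G \<le> card J"
      using finG J by (auto simp: G_def card_Diff_subset card_mono)
    ultimately have G: "N / 2 \<le> real (card G)" by (simp add: N_def of_nat_diff)
    then have "G \<noteq> {}" using N1 by auto
    have "residue_prob B (\<lambda>g. \<forall>j\<in>J. \<exists>t\<in>T j. \<not> hits (A \<union> B) (\<lambda>x. if x \<in> A then f x else g x) t) \<le>
        residue_prob B (\<lambda>g. \<forall>j\<in>G. \<exists>t\<in>D f j. \<not> hits B g t)"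
      unfolding hits_union[OF AB]
      by (intro measure_pmf.finite_measure_mono) (auto simp: G_def D_def)
    also have "\<dots> \<le> 2 ^ n / real (card G) + 3 * 2 ^ (2 * n) * (2 ^ (2 * n) * ((real (2 * n))\<^sup>2 / real U))"
    proof (rule residue_prob_no_full_hit[OF B half finG \<open>G \<noteq> {}\<close>])
      show "disjoint_family_on (D f) G"
        using disj by (auto simp: disjoint_family_on_def D_def G_def)
      show "inj_on (\<lambda>t. t mod int p) (\<Union>j\<in>G. D f j)" if "p \<in> B" for p
        by (rule inj_on_subset[OF inj[OF that]]) (auto simp: D_def G_def)
    qed (use finD n U in \<open>auto simp: G_def\<close>)
    also have "2 ^ n / real (card G) \<le> 2 ^ n / (N / 2)"
      using G N1 by (intro divide_left_mono) auto
    finally show ?thesis by (simp add: N_def mult.commute)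
  qed
  ultimately show ?thesis unfolding \<rho>_def
    by (intro residue_prob_union_le[where Bad = Bad, OF A(1) B(1) AB]) auto
qed

section \<open>Transfer to the infinite product measure\<close>

lemma prob_space_random_residues: "prob_space random_residues"
  unfolding random_residues_def by (intro prob_space_PiM measure_pmf.prob_space_axioms)

text \<open>A finite union of cylinders, one for each point of the discrete support that satisfies
  \<open>P\<close>, is measurable, lies inside \<open>P\<close> and has the right probability. This
  replaces a measurability proof for \<open>P\<close> itself and suffices for lower bounds.\<close>

lemma random_residues_event:
  assumes A: "finite A" "\<And>p. p \<in> A \<Longrightarrow> prime p"
    and dep: "\<And>a b. (\<And>p. p \<in> A \<Longrightarrow> a p = b p) \<Longrightarrow> P a \<Longrightarrow> P b"
  obtains E where "E \<in> sets random_residues" "\<And>a. a \<in> E \<Longrightarrow> P a"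
    "measure random_residues E = residue_prob A P"
proof -
  interpret prod: product_prob_space "\<lambda>p. measure_pmf (pmf_of_set {0..<int p})" "{p. prime p}" ..
  interpret rr: prob_space random_residues by (rule prob_space_random_residues)
  define cyl where "cyl c = prod_emb {p. prime p} (\<lambda>p. measure_pmf (pmf_of_set {0..<int p})) A (Pi\<^sub>E A (\<lambda>p. {c p}))"
    for c :: "nat \<Rightarrow> int"
  define G where "G = {c \<in> set_pmf (residue_pmf A). P c}"
  have sub: "A \<subseteq> {p. prime p}" using A by auto
  have fin: "finite G" using finite_set_residue_pmf[OF A] by (simp add: G_def)
  have cylD: "a p = c p" if "a \<in> cyl c" "p \<in> A" for a c p
    using that by (auto simp: cyl_def prod_emb_def PiE_iff restrict_def split: if_splits)
  \<comment> \<open>Points of the support agree outside \<open>A\<close>, so two different ones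
    differ at a prime in \<open>A\<close> and their cylinders are disjoint.\<close>
  have Gout: "c p = 0" if "c \<in> G" "p \<notin> A" for c p
    using that set_Pi_pmf_subset[OF A(1), of 0 "\<lambda>p. pmf_of_set {0..<int p}"]
    by (auto simp: G_def residue_pmf_def)
  have sets: "cyl c \<in> sets random_residues" for c
    unfolding cyl_def random_residues_def using sub A by (intro sets_PiM_I) auto
  have "measure random_residues (cyl c) = pmf (residue_pmf A) c" if "c \<in> G" for c
  proof -
    have "measure random_residues (cyl c) = (\<Prod>p\<in>A. measure_pmf.prob (pmf_of_set {0..<int p}) {c p})"
      unfolding cyl_def random_residues_def using sub A by (intro prod.measure_PiM_emb) auto
    also have "\<dots> = pmf (residue_pmf A) c"
      unfolding residue_pmf_def using Gout[OF that] A by (subst pmf_Pi') (auto simp: pmf.rep_eq)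
    finally show ?thesis .
  qed
  then have "(\<Sum>c\<in>G. measure random_residues (cyl c)) = (\<Sum>c\<in>G. pmf (residue_pmf A) c)" by simp
  also have "\<dots> = measure_pmf.prob (residue_pmf A) G"
    using fin by (simp add: measure_measure_pmf_finite)
  also have "\<dots> = residue_prob A P"
    unfolding G_def using measure_Int_set_pmf[of "residue_pmf A" "{a. P a}"] by (simp add: Int_def conj_commute)
  also have "(\<Sum>c\<in>G. measure random_residues (cyl c)) = measure random_residues (\<Union>c\<in>G. cyl c)"
  proof (rule rr.finite_measure_finite_Union[symmetric])
    show "disjoint_family_on cyl G"
      unfolding disjoint_family_on_def
    proof (intro ballI impI)
      fix c d assume cd: "c \<in> G" "d \<in> G" "c \<noteq> d"
      then obtain p where "c p \<noteq> d p" by blast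
      then have "p \<in> A" using Gout cd by metis
      then show "cyl c \<inter> cyl d = {}" using cylD[of _ c p] cylD[of _ d p] \<open>c p \<noteq> d p\<close> by auto
    qed
  qed (use fin sets in auto)
  finally have "measure random_residues (\<Union>c\<in>G. cyl c) = residue_prob A P" .
  moreover have "P a" if "a \<in> (\<Union>c\<in>G. cyl c)" for a
    using that dep cylD by (metis (mono_tags, lifting) G_def UN_E mem_Collect_eq)
  moreover have "(\<Union>c\<in>G. cyl c) \<in> sets random_residues" using fin sets by auto
  ultimately show ?thesis using that by blast
qed

section \<open>Gaps in the random set\<close>

lemma prime_factor_pos: "prime (p::nat) \<Longrightarrow> 0 < 1 - 1 / real p"
  using prime_factor_bounds(1)[of p] by linarith

lemma euler_prod_pos: "0 < euler_prod u"
  unfolding euler_prod_def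
proof (rule prod_pos)
  fix p assume "p \<in> {p. prime p \<and> p \<le> u}"
  then have "0 < 1 - 1 / real p" by (intro prime_factor_pos) auto
  then show "0 < inverse (1 - 1 / real p)" by (rule positive_imp_inverse_positive)
qed

lemma euler_prod_split:
  assumes "u \<le> v"
  shows "(\<Prod>p | prime p \<and> u < p \<and> p \<le> v. 1 - 1 / real p) = euler_prod u / euler_prod v"
proof -
  let ?A = "{p. prime p \<and> p \<le> u}" and ?B = "{p. prime p \<and> u < p \<and> p \<le> v}"
  have "{p. prime p \<and> p \<le> v} = ?A \<union> ?B" using assms by auto
  then have "euler_prod v = euler_prod u * (\<Prod>p\<in>?B. inverse (1 - 1 / real p))"
    unfolding euler_prod_def by (simp only:) (rule prod.union_disjoint, auto)
  moreover have "(\<Prod>p\<in>?B. inverse (1 - 1 / real p)) = inverse (\<Prod>p\<in>?B. 1 - 1 / real p)"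
  proof -
    have "(\<Prod>p\<in>S. inverse (h p)) = inverse (\<Prod>p\<in>S. h p)" for S :: "nat set" and h :: "nat \<Rightarrow> real"
      by (induction S rule: infinite_finite_induct) auto
    then show ?thesis .
  qed
  moreover have "0 < (\<Prod>p\<in>?B. 1 - 1 / real p)"
    by (intro prod_pos prime_factor_pos) auto
  moreover note euler_prod_pos[of u]
  ultimately show ?thesis by (simp add: field_simps)
qed

lemma euler_prod_mono: "u \<le> v \<Longrightarrow> euler_prod u \<le> euler_prod v"
proof -
  assume uv: "u \<le> v"
  have "(\<Prod>p | prime p \<and> u < p \<and> p \<le> v. 1 - 1 / real p) \<le> 1"
  proof (rule prod_le_1)
    fix p assume "p \<in> {p. prime p \<and> u < p \<and> p \<le> v}"
    then show "0 \<le> 1 - 1 / real p \<and> 1 - 1 / real p \<le> 1" using prime_factor_bounds[of p] by auto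
  qed
  then show ?thesis using euler_prod_split[OF uv] euler_prod_pos[of v] by simp
qed

lemma euler_prod_Suc_le: "euler_prod (Suc u) \<le> 2 * euler_prod u"
proof -
  have "1 / 2 \<le> (\<Prod>p | prime p \<and> u < p \<and> p \<le> Suc u. 1 - 1 / real p)"
  proof (cases "prime (Suc u)")
    case True
    then have "{p. prime p \<and> u < p \<and> p \<le> Suc u} = {Suc u}" by auto
    then show ?thesis using prime_factor_bounds(1)[OF True] by simp
  next
    case False
    then have "{p. prime p \<and> u < p \<and> p \<le> Suc u} = {}" using le_antisym Suc_leI by blast
    then show ?thesis by (simp only: prod.empty)
  qed
  then have "1 / 2 \<le> euler_prod u / euler_prod (Suc u)" using euler_prod_split[of u "Suc u"] by simp
  then show ?thesis using euler_prod_pos[of "Suc u"] by (simp add: field_simps)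
qed

text \<open>Maximality of \<open>GREATEST\<close> requires the candidates to be bounded;
  \<open>euler_prod_ge\<close> turns the condition on \<open>q\<close> into
  \<open>q + 1 \<le> t\<close>.\<close>

lemma le_sieve_limit:
  assumes "prime p" "euler_prod p \<le> ln t" "t > 0"
  shows "p \<le> sieve_limit t"
  unfolding sieve_limit_def
proof (rule Greatest_le_nat)
  show "prime p \<and> (\<Prod>r | prime r \<and> r \<le> p. inverse (1 - 1 / real r)) \<le> ln t"
    using assms by (simp add: euler_prod_def)
  fix q assume "prime q \<and> (\<Prod>r | prime r \<and> r \<le> q. inverse (1 - 1 / real r)) \<le> ln t"
  then have "euler_prod q \<le> ln t" by (simp add: euler_prod_def)
  then have "ln (real q + 1) \<le> ln t" using euler_prod_ge[of q] by linarith
  then have "real q + 1 \<le> t" using assms(3) by (subst (asm) ln_le_cancel_iff) auto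
  then show "q \<le> nat \<lceil>t\<rceil>" by linarith
qed

lemma crt_shift:
  fixes u :: "nat \<Rightarrow> int"
  assumes "finite A" "\<And>p. p \<in> A \<Longrightarrow> prime p"
  obtains r :: nat where "r < \<Prod>A" "\<And>p. p \<in> A \<Longrightarrow> [int r = u p] (mod int p)"
proof -
  have "\<exists>x. \<forall>p\<in>A. [x = nat (u p mod int p)] (mod p)"
    using assms by (intro chinese_remainder_nat) (auto intro: primes_coprime)
  then obtain x where x: "\<And>p. p \<in> A \<Longrightarrow> [x = nat (u p mod int p)] (mod p)" by blast
  have "\<Prod>A > 0" using assms by (intro prod_pos) (auto dest: prime_gt_0_nat)
  then have "x mod \<Prod>A < \<Prod>A" by simp
  moreover have "[int (x mod \<Prod>A) = u p] (mod int p)" if p: "p \<in> A" for p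
  proof -
    have "p dvd \<Prod>A" using p assms(1) by (intro dvd_prodI) auto
    then have "[x mod \<Prod>A = x] (mod p)" by (simp add: cong_def mod_mod_cancel)
    then have "[x mod \<Prod>A = nat (u p mod int p)] (mod p)" using x[OF p] by (rule cong_trans)
    then have "[int (x mod \<Prod>A) = int (nat (u p mod int p))] (mod int p)" by (simp only: cong_int_iff)
    also have "int (nat (u p mod int p)) = u p mod int p"
      using assms(2)[OF p] by (simp add: prime_gt_0_nat)
    also have "[u p mod int p = u p] (mod int p)" by (simp add: cong_def)
    finally show ?thesis .
  qed
  ultimately show ?thesis using that by blast
qed

definition covered_interval :: "nat set \<Rightarrow> (nat \<Rightarrow> int) \<Rightarrow> int \<Rightarrow> real \<Rightarrow> bool" where
  "covered_interval A a s y \<longleftrightarrow> (\<forall>t. s \<le> t \<longrightarrow> real_of_int t \<le> real_of_int s + y \<longrightarrow> hits A a t)"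

text \<open>The primes up to \<open>w\<close> are conditioned on, and the two-stage bound holds for
  every choice \<open>f\<close> of their residues, so no bad event arises at this step. The
  assumption \<open>window\<close> keeps all intervals within a stretch of length \<open>U\<close>,
  on which reduction modulo a prime above \<open>U\<close> is injective; \<open>half\<close> makes
  these primes hit an integer with probability at least 1/2.\<close>

lemma residue_prob_no_covered_interval:
  fixes y :: real and U Z n N P Q :: nat and b :: int
  defines "w \<equiv> nat \<lfloor>sqrt (y / ln y)\<rfloor>"
  defines "P \<equiv> \<Prod>{p. prime p \<and> p \<le> w}" and "Q \<equiv> nat \<lceil>y\<rceil> + 1"
  assumes y: "y \<ge> 2" and wU: "w \<le> U" "U \<le> Z" and N: "N \<ge> 1" and n: "2 * n \<le> U" "1 \<le> n"
    and window: "real (N * P * Q) + real P + y < real U"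
    and half: "2 * euler_prod U \<le> euler_prod Z"
  shows "residue_prob {p. prime p \<and> p \<le> Z} (\<lambda>a. \<not> (\<exists>s. b \<le> s \<and> s \<le> b + int U \<and> covered_interval {p. prime p \<and> p \<le> Z} a s y))
     \<le> 2 * real (W y) * (euler_prod w / euler_prod U) / real n +
      (2 * 2 ^ n / real N + 3 * 2 ^ (2 * n) * (2 ^ (2 * n) * ((real (2 * n))\<^sup>2 / real U)))"
    (is "_ \<le> ?\<alpha>\<beta>")
proof -
  define A0 where "A0 = {p. prime p \<and> p \<le> w}"
  define A where "A = {p. prime p \<and> w < p \<and> p \<le> U}"
  define B where "B = {p. prime p \<and> U < p \<and> p \<le> Z}"
  have fin: "finite A0" "finite A" "finite B" by (auto simp: A0_def A_def B_def)
  have pr: "\<And>p. p \<in> A0 \<Longrightarrow> prime p" "\<And>p. p \<in> A \<Longrightarrow> prime p" "\<And>p. p \<in> B \<Longrightarrow> prime p"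
    by (auto simp: A0_def A_def B_def)
  have all: "{p. prime p \<and> p \<le> Z} = A0 \<union> (A \<union> B)" using wU by (auto simp: A0_def A_def B_def)
  have disj: "A \<inter> B = {}" "A0 \<inter> (A \<union> B) = {}" using wU by (auto simp: A0_def A_def B_def)
  have \<rho>A: "(\<Prod>p\<in>A. 1 - 1 / real p) = euler_prod w / euler_prod U"
    unfolding A_def by (rule euler_prod_split[OF wU(1)])
  have \<rho>B: "(\<Prod>p\<in>B. 1 - 1 / real p) \<le> 1 / 2"
    unfolding B_def euler_prod_split[OF wU(2)] using half euler_prod_pos[of Z] by (simp add: field_simps)
  obtain c where c: "W y = card ({t. 0 \<le> t \<and> real_of_int t \<le> y} \<inter> sifted_set c (sqrt (y / ln y)))"
    by (rule W_attained)
  have A0': "prime p \<and> real p \<le> sqrt (y / ln y) \<longleftrightarrow> p \<in> A0" for p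
  proof -
    have "real p \<le> sqrt (y / ln y) \<longleftrightarrow> p \<le> w"
    proof
      assume "p \<le> w"
      then have "real p \<le> real w" by simp
      also have "\<dots> \<le> sqrt (y / ln y)" unfolding w_def using y by (intro of_nat_floor) auto
      finally show "real p \<le> sqrt (y / ln y)" .
    qed (simp add: w_def le_nat_floor)
    then show ?thesis by (auto simp: A0_def)
  qed
  have sift: "t \<in> sifted_set c (sqrt (y / ln y)) \<longleftrightarrow> \<not> hits A0 c t" for t
    unfolding sifted_set_def hits_def A0' by auto
  have Qy: "real Q > y" using y by (simp add: Q_def) linarith
  have P0: "P \<ge> 1" unfolding P_def by (simp add: Suc_le_eq prod_pos prime_gt_0_nat)
  let ?G = "\<lambda>a. \<exists>s. b \<le> s \<and> s \<le> b + int U \<and> covered_interval (A0 \<union> (A \<union> B)) a s y"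
  have "residue_prob (A \<union> B) (\<lambda>f'. \<not> ?G (\<lambda>x. if x \<in> A0 then f x else f' x)) \<le> ?\<alpha>\<beta>" for f
  proof -
    obtain r where r: "r < P" "\<And>p. p \<in> A0 \<Longrightarrow> [int r = f p - c p - b] (mod int p)"
      using crt_shift[OF fin(1) pr(1), of "\<lambda>p. f p - c p - b"] by (auto simp: P_def A0_def)
    \<comment> \<open>The shift \<open>r\<close> aligns the given residues with an extremal choice
      \<open>c\<close> for \<open>W y\<close>, multiples of \<open>P\<close> preserve the alignment,
      and \<open>Q > y\<close> keeps intervals of length \<open>y\<close> apart.\<close>
    define m where "m j = b + int r + int (j * P * Q)" for j :: nat
    have mreal: "real_of_int (m j) = real_of_int b + real r + real (j * P * Q)" for j
      by (simp add: m_def)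
    have rP: "real r < real P" using r(1) by simp
    define T where "T j = {t. m j \<le> t \<and> real_of_int t \<le> real_of_int (m j) + y \<and> \<not> hits A0 f t}" for j
    have mc: "[f p - m j = c p] (mod int p)" if p: "p \<in> A0" for p j
    proof -
      have "p dvd P" unfolding P_def using p fin(1) by (intro dvd_prodI) (auto simp: A0_def)
      then have "int p dvd int (j * P * Q)" by simp
      moreover have "int p dvd f p - c p - b - int r" using r(2)[OF p] by (simp add: cong_iff_dvd_diff dvd_diff_commute)
      ultimately have "int p dvd (f p - c p - b - int r) - int (j * P * Q)" by (rule dvd_diff[rotated])
      moreover have "(f p - c p - b - int r) - int (j * P * Q) = (f p - m j) - c p" by (simp add: m_def)
      ultimately show ?thesis by (simp only: cong_iff_dvd_diff)
    qed
    have hshift: "hits A0 f (m j + i) \<longleftrightarrow> hits A0 c i" for i j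
    proof -
      have "[m j + i = f p] (mod int p) \<longleftrightarrow> [i = c p] (mod int p)" if "p \<in> A0" for p
      proof -
        have "[m j + i = f p] (mod int p) \<longleftrightarrow> [i = f p - m j] (mod int p)"
          by (simp add: cong_iff_dvd_diff algebra_simps)
        also have "\<dots> \<longleftrightarrow> [i = c p] (mod int p)" using mc[OF that, of j] cong_trans cong_sym by blast
        finally show ?thesis .
      qed
      then show ?thesis by (auto simp: hits_def)
    qed
    have Tim: "T j = (\<lambda>i. m j + i) ` ({t. 0 \<le> t \<and> real_of_int t \<le> y} \<inter> sifted_set c (sqrt (y / ln y)))" for j
    proof (intro equalityI subsetI)
      fix t assume "t \<in> T j"
      then show "t \<in> (\<lambda>i. m j + i) ` ({t. 0 \<le> t \<and> real_of_int t \<le> y} \<inter> sifted_set c (sqrt (y / ln y)))"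
        using hshift[of j "t - m j"] by (intro image_eqI[of _ _ "t - m j"]) (auto simp: T_def sift)
    qed (auto simp: T_def sift hshift)
    have finT: "finite (T j)" for j unfolding Tim using finite_int_interval by auto
    have cardT: "card (T j) = W y" for j unfolding Tim c by (intro card_image) auto
    have range: "b \<le> t \<and> t < b + int U" if "t \<in> T j" "j < N" for t j
    proof -
      have "real (j * P * Q) \<le> real (N * P * Q)"
        using that by (intro of_nat_mono mult_le_mono) auto
      moreover have "real_of_int t \<le> real_of_int (m j) + y" using that(1) by (simp add: T_def)
      ultimately have "real_of_int t < real_of_int (b + int U)"
        using rP window mreal[of j] unfolding of_int_add of_int_of_nat_eq by linarith
      then have "t < b + int U" by (simp only: of_int_less_iff)
      moreover have "b \<le> m j" by (simp add: m_def)
      ultimately show ?thesis using that(1) by (auto simp: T_def)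
    qed
    have "residue_prob (A \<union> B) (\<lambda>f'. \<not> ?G (\<lambda>x. if x \<in> A0 then f x else f' x)) \<le>
        residue_prob (A \<union> B) (\<lambda>a. \<forall>j\<in>{..<N}. \<exists>t\<in>T j. \<not> hits (A \<union> B) a t)"
    proof (rule measure_pmf.finite_measure_mono, intro subsetI CollectI ballI)
      fix f' j assume j: "j \<in> {..<N}" and "f' \<in> {f'. \<not> ?G (\<lambda>x. if x \<in> A0 then f x else f' x)}"
      then have notG: "\<not> ?G (\<lambda>x. if x \<in> A0 then f x else f' x)" by blast
      have "real (j * P * Q) \<le> real (N * P * Q)"
        using j by (intro of_nat_mono mult_le_mono) auto
      then have "real_of_int (m j) \<le> real_of_int (b + int U)"
        using rP window y mreal[of j] unfolding of_int_add of_int_of_nat_eq by linarith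
      then have "m j \<le> b + int U" by (simp only: of_int_le_iff)
      moreover have "b \<le> m j" by (simp add: m_def)
      ultimately have "\<not> covered_interval (A0 \<union> (A \<union> B)) (\<lambda>x. if x \<in> A0 then f x else f' x) (m j) y"
        using notG by blast
      then obtain t where "m j \<le> t" "real_of_int t \<le> real_of_int (m j) + y" "\<not> hits A0 f t" "\<not> hits (A \<union> B) f' t"
        unfolding covered_interval_def hits_union[OF disj(2)] by blast
      then show "\<exists>t\<in>T j. \<not> hits (A \<union> B) f' t" by (auto simp: T_def)
    qed simp
    also have "\<dots> \<le> 2 * real (W y) * (\<Prod>p\<in>A. 1 - 1 / real p) / real n +
      (2 * 2 ^ n / real (card {..<N}) + 3 * 2 ^ (2 * n) * (2 ^ (2 * n) * ((real (2 * n))\<^sup>2 / real U)))"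
    proof (rule residue_prob_two_stage[OF fin(2) pr(2) fin(3) pr(3) _ disj(1) \<rho>B])
      show "disjoint_family_on T {..<N}"
        unfolding disjoint_family_on_def
      proof (intro ballI impI)
        have *: "T i \<inter> T j = {}" if "i < j" for i j
        proof -
          have "(i + 1) * (P * Q) \<le> j * (P * Q)" using that by (intro mult_le_mono) auto
          moreover have "1 * Q \<le> P * Q" using P0 by (intro mult_le_mono) auto
          moreover have "(i + 1) * (P * Q) = i * P * Q + P * Q" "j * (P * Q) = j * P * Q" by (simp_all add: algebra_simps)
          ultimately have "i * P * Q + Q \<le> j * P * Q" by linarith
          then have "real (i * P * Q + Q) \<le> real (j * P * Q)" by (simp only: of_nat_le_iff)
          then have "real (i * P * Q) + real Q \<le> real (j * P * Q)" by (simp only: of_nat_add)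
          then have "real_of_int (m i) + y < real_of_int (m j)"
            using Qy mreal[of i] mreal[of j] by linarith
          then show ?thesis by (auto simp: T_def)
        qed
        fix i j :: nat assume "i \<noteq> j"
        then show "T i \<inter> T j = {}" using *[of i j] *[of j i] by (cases "i < j") auto
      qed
      show "inj_on (\<lambda>t. t mod int p) (\<Union>j\<in>{..<N}. T j)" if p: "p \<in> B" for p
      proof (rule inj_onI)
        fix t t' assume tt: "t \<in> (\<Union>j\<in>{..<N}. T j)" "t' \<in> (\<Union>j\<in>{..<N}. T j)" "t mod int p = t' mod int p"
        then have "int p dvd t - t'" by (simp add: mod_eq_dvd_iff)
        moreover have "\<bar>t - t'\<bar> < int p"
        proof -
          have "b \<le> t \<and> t < b + int U" "b \<le> t' \<and> t' < b + int U" using tt(1,2) range by blast+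
          moreover have "int U < int p" using p by (simp add: B_def)
          ultimately show ?thesis by linarith
        qed
        ultimately show "t = t'" using dvd_imp_le_int[of "t - t'" "int p"] by force
      qed
    qed (use N n finT cardT in \<open>auto simp: B_def lessThan_empty_iff\<close>)
    finally show ?thesis unfolding \<rho>A by simp
  qed
  note stage = this
  have "residue_prob (A0 \<union> (A \<union> B)) (\<lambda>a. \<not> ?G a) \<le> 0 + ?\<alpha>\<beta>"
  proof (rule residue_prob_union_le[where Bad = "\<lambda>_. False"])
    show "finite A0" "finite (A \<union> B)" "A0 \<inter> (A \<union> B) = {}" using fin disj by auto
    show "residue_prob A0 (\<lambda>_. False) \<le> 0" by simp
    show "0 \<le> ?\<alpha>\<beta>"
      using euler_prod_pos[of w] euler_prod_pos[of U] by (intro add_nonneg_nonneg) auto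
  qed (rule stage)
  then show ?thesis unfolding all by simp
qed

text \<open>\<open>W_small\<close> provides \<open>y\<close> only at special places, so
  \<open>y\<close> comes first and \<open>x\<close> is defined by
  \<open>K * (ln x)\<^sup>2 = y\<close>. The event concerns finitely many primes and one
  \<open>x\<close>.\<close>

lemma random_gap_event:
  assumes exc: "exceptional_zeros_exist" and K: "K > 0" and \<eta>: "\<eta> > 0"
  obtains E where "E \<in> sets random_residues" "measure random_residues E \<ge> 1 - \<eta>"
    "\<And>a. a \<in> E \<Longrightarrow> \<exists>x\<ge>X0. K * (ln x)\<^sup>2 \<le> largest_gap (random_set a) x"
proof -
  define CM :: real where "CM = 3 * exp 24"
  \<comment> \<open>The window length is about \<open>x powr h\<close>. This \<open>h\<close> gives
    \<open>euler_prod U \<le> ln x / 8\<close>, which is half of the lower bound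
    \<open>ln x / 4\<close> for \<open>euler_prod Z\<close>.\<close>
  define h where "h = 1 / (8 * CM)"
  \<comment> \<open>With \<open>\<tau> = h * ln x\<close>, the length
    \<open>K * (ln x)\<^sup>2\<close> becomes \<open>c * \<tau>\<^sup>2\<close>.\<close>
  define c where "c = K / h\<^sup>2"
  \<comment> \<open>Makes the Markov term in \<open>\<alpha>\<close>, which comes out as
    \<open>80 * \<epsilon> * CM * c\<close>, equal to \<open>\<eta> / 2\<close>.\<close>
  define \<epsilon> where "\<epsilon> = \<eta> / (160 * c * CM)"
  have CM: "CM \<ge> 1" using one_le_exp_iff[of "24::real"] unfolding CM_def by linarith
  have h: "0 < h" "h \<le> 1 / 8" using CM by (auto simp: h_def field_simps)
  have c0: "c > 0" using K h by (simp add: c_def)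
  have \<epsilon>0: "\<epsilon> > 0" using \<eta> c0 CM by (simp add: \<epsilon>_def)
  \<comment> \<open>All requirements are expressed through \<open>\<tau>\<close> alone, with
    \<open>c * \<tau>\<^sup>2\<close> in place of \<open>y\<close>, so that one threshold serves for
    the window, the primes up to \<open>w\<close>, the second moment error, and the position of the
    gap between \<open>x / 2\<close> and \<open>x\<close>.\<close>
  define large where "large \<tau> \<longleftrightarrow>
      exp (\<tau> / 2) * exp (\<tau> / 8) * (c * \<tau>\<^sup>2 + 3) + exp (\<tau> / 8) + c * \<tau>\<^sup>2 + 1 \<le> exp \<tau> - 1 \<and>
      2 * ln 4 * sqrt (c * \<tau>\<^sup>2 / ln (c * \<tau>\<^sup>2)) \<le> \<tau> / 8 \<and>
      2 \<le> sqrt (c * \<tau>\<^sup>2 / ln (c * \<tau>\<^sup>2)) \<and> 80 \<le> \<tau> \<and>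
      2 * exp (\<tau> / 40) / (exp (\<tau> / 2) - 1) +
        3 * exp (\<tau> / 20) * (exp (\<tau> / 20) * ((\<tau> / 20)\<^sup>2 / (exp \<tau> - 1))) \<le> \<eta> / 2 \<and>
      2 + exp \<tau> + c * \<tau>\<^sup>2 \<le> exp (8 * \<tau>) / 2 \<and> max X0 (2 * exp 2) \<le> exp (8 * \<tau>)" for \<tau> :: real
  have "eventually large at_top"
    unfolding large_def using c0 \<eta> by (intro eventually_conj eventually_ge_at_top; real_asymp)
  then obtain \<tau>1 where \<tau>1: "\<And>\<tau>. \<tau> \<ge> \<tau>1 \<Longrightarrow> large \<tau>"
    unfolding eventually_at_top_linorder by blast
  obtain y where y0: "y \<ge> max (c * (max \<tau>1 0)\<^sup>2) 3" and y: "y \<ge> 2" "real (W y) \<le> \<epsilon> * (y / ln y)"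
    by (rule W_small[OF exc \<epsilon>0])
  have lny1: "ln y \<ge> 1" using y0 exp_le by (subst ln_ge_iff) auto
  define \<tau> where "\<tau> = sqrt (y / c)"
  have y\<tau>: "y = c * \<tau>\<^sup>2" using y(1) c0 by (simp add: \<tau>_def)
  have "(max \<tau>1 0)\<^sup>2 \<le> y / c" using y0 c0 by (simp add: pos_le_divide_eq mult.commute)
  then have "max \<tau>1 0 \<le> \<tau>" unfolding \<tau>_def by (rule real_le_rsqrt)
  then have "\<tau> \<ge> \<tau>1" by simp
  note \<tau>1 = \<tau>1[OF this, unfolded large_def, folded y\<tau>]
  have e1: "exp (\<tau> / 2) * exp (\<tau> / 8) * (y + 3) + exp (\<tau> / 8) + y + 1 \<le> exp \<tau> - 1"
    and e2: "2 * ln 4 * sqrt (y / ln y) \<le> \<tau> / 8" and e3: "2 \<le> sqrt (y / ln y)" and e4: "80 \<le> \<tau>"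
    and e5: "2 * exp (\<tau> / 40) / (exp (\<tau> / 2) - 1) +
        3 * exp (\<tau> / 20) * (exp (\<tau> / 20) * ((\<tau> / 20)\<^sup>2 / (exp \<tau> - 1))) \<le> \<eta> / 2"
    and e6: "2 + exp \<tau> + y \<le> exp (8 * \<tau>) / 2" and e7: "X0 \<le> exp (8 * \<tau>)" "2 * exp 2 \<le> exp (8 * \<tau>)"
    using \<tau>1 by auto
  define L where "L = \<tau> / h"
  define x where "x = exp L"
  have "8 * \<tau> * h \<le> \<tau>" using h e4 mult_left_mono[of h "1 / 8" "8 * \<tau>"] by simp
  then have L8: "8 * \<tau> \<le> L" using h by (simp add: L_def field_simps)
  then have x8: "exp (8 * \<tau>) \<le> x" by (simp add: x_def)
  have lnx: "ln x = L" by (simp add: x_def)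
  have KL: "K * (ln x)\<^sup>2 = y" unfolding lnx y\<tau> using h by (simp add: L_def c_def power_divide)
  define w where "w = nat \<lfloor>sqrt (y / ln y)\<rfloor>"
  define P where "P = \<Prod>{p. prime p \<and> p \<le> w}"
  define Q where "Q = nat \<lceil>y\<rceil> + 1"
  define U where "U = nat \<lfloor>exp \<tau>\<rfloor>"
  define N where "N = nat \<lfloor>exp (\<tau> / 2)\<rfloor>"
  \<comment> \<open>Proportional to \<open>\<tau>\<close>, so that the expected number of survivors,
    a small multiple of \<open>\<tau>\<close>, is small against \<open>n\<close>; the constant 40
    keeps \<open>2 ^ n\<close> well below \<open>N\<close> and \<open>2 ^ (4 * n)\<close> well below
    \<open>U\<close>.\<close>
  define n where "n = nat \<lfloor>\<tau> / 40\<rfloor>"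
  \<comment> \<open>Starting at \<open>x / 2\<close> ensures that every integer of the gap is sieved
    by all primes up to the \<open>Z\<close> belonging to \<open>ln (x / 2)\<close>.\<close>
  define b where "b = \<lceil>x / 2\<rceil>"
  have lny: "ln y > 0" using y by simp
  have wr: "real w \<le> sqrt (y / ln y)" unfolding w_def using e3 by (intro of_nat_floor) linarith
  have w2: "w \<ge> 2" unfolding w_def using e3 by (simp add: le_nat_floor)
  have U: "real U \<le> exp \<tau>" "exp \<tau> - 1 < real U" unfolding U_def by (simp_all add: of_nat_floor)
  have exp\<tau>: "exp \<tau> \<ge> 1 + \<tau>" by (rule exp_ge_add_one_self)
  have U2: "U \<ge> 2" using U exp\<tau> e4 by linarith
  have exp\<tau>2: "exp (\<tau> / 2) \<ge> 1 + \<tau> / 2" by (rule exp_ge_add_one_self)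
  have N: "real N \<le> exp (\<tau> / 2)" "exp (\<tau> / 2) - 1 \<le> real N"
    unfolding N_def by (simp, linarith)
  then have N1: "N \<ge> 1" using exp\<tau>2 e4 by linarith
  have n: "real n \<le> \<tau> / 40" "\<tau> / 80 \<le> real n" "n \<ge> 1" unfolding n_def using e4 by linarith+
  have nU: "2 * n \<le> U" using n U exp\<tau> by linarith
  have l4: "1 \<le> 2 * ln (4::real)" using ln_mono[of 2 "4::real"] ln2_ge_two_thirds by linarith
  have Pr: "real P \<le> exp (\<tau> / 8)"
  proof -
    have "real P \<le> exp (2 * ln 4 * real w)" unfolding P_def by (rule prod_primes_le)
    also have "2 * ln 4 * real w \<le> 2 * ln 4 * sqrt (y / ln y)" using wr by (intro mult_left_mono) auto
    also have "\<dots> \<le> \<tau> / 8" by (rule e2)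
    finally show ?thesis by simp
  qed
  have Qr: "real Q \<le> y + 2" using y by (simp add: Q_def) linarith
  have wU: "w \<le> U"
  proof -
    have "1 * sqrt (y / ln y) \<le> 2 * ln 4 * sqrt (y / ln y)" using l4 e3 by (intro mult_right_mono) linarith+
    then have "real w < real U" using wr e2 e4 U exp\<tau> by linarith
    then show ?thesis by simp
  qed
  have window: "real (N * P * Q) + real P + y < real U"
  proof -
    have "real (N * P * Q) \<le> exp (\<tau> / 2) * exp (\<tau> / 8) * (y + 2)"
      unfolding of_nat_mult using N Pr Qr y by (intro mult_mono) auto
    also have "\<dots> \<le> exp (\<tau> / 2) * exp (\<tau> / 8) * (y + 3)" by (intro mult_left_mono) auto
    finally show ?thesis using Pr e1 U by linarith
  qed
  have x2: "exp 2 \<le> x / 2" using e7(2) x8 by linarith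
  have lnx2: "ln (x / 2) \<ge> L - 1"
    using ln2_le_25_over_36 x_def by (simp add: ln_div)
  have L640: "L \<ge> 640" using L8 e4 by linarith
  let ?S = "{z. euler_prod z \<le> ln (x / 2)}"
  have "z \<le> nat \<lceil>x\<rceil>" if "z \<in> ?S" for z
  proof -
    have "ln (real z + 1) \<le> ln (x / 2)" using that euler_prod_ge[of z] by simp
    then have "real z + 1 \<le> x / 2" using x_def by (subst (asm) ln_le_cancel_iff) auto
    then show ?thesis using x_def by linarith
  qed
  then have finS: "finite ?S" by (meson finite_nat_set_iff_bounded_le)
  have S0: "0 \<in> ?S"
  proof -
    have "{p. prime p \<and> p \<le> (0::nat)} = {}" by auto
    then have "euler_prod 0 = 1" unfolding euler_prod_def by (simp only: prod.empty)
    then show ?thesis using lnx2 L640 by simp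
  qed
  \<comment> \<open>The last level whose product is at most \<open>ln (x / 2)\<close>. One more step
    at most doubles the product, so maximality yields
    \<open>L / 4 \<le> euler_prod Z\<close>.\<close>
  define Z where "Z = Max ?S"
  have Z1: "euler_prod Z \<le> ln (x / 2)" using Max_in[OF finS] S0 unfolding Z_def by blast
  have "Suc Z \<notin> ?S" using Max_ge[OF finS, of "Suc Z"] unfolding Z_def by auto
  then have "ln (x / 2) \<le> euler_prod (Suc Z)" by simp
  then have Z2: "L / 4 \<le> euler_prod Z" using euler_prod_Suc_le[of Z] lnx2 L640 by linarith
  have VU: "euler_prod U \<le> L / 8"
  proof -
    have "euler_prod U \<le> CM * ln (real U)" unfolding CM_def using euler_prod_le[OF U2] by simp
    also have "\<dots> \<le> CM * ln (exp \<tau>)" using U U2 CM by (intro mult_left_mono ln_mono) auto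
    also have "\<dots> = L / 8" using CM by (simp add: L_def h_def)
    finally show ?thesis .
  qed
  have half: "2 * euler_prod U \<le> euler_prod Z" using VU Z2 by linarith
  have UZ: "U \<le> Z"
  proof (rule ccontr)
    assume "\<not> U \<le> Z"
    then have "euler_prod Z \<le> euler_prod U" by (intro euler_prod_mono) simp
    then show False using half euler_prod_pos[of U] by linarith
  qed
  let ?A = "{p. prime p \<and> p \<le> Z}"
  define G where "G a \<longleftrightarrow> (\<exists>s. b \<le> s \<and> s \<le> b + int U \<and> covered_interval ?A a s y)" for a
  have \<alpha>: "2 * real (W y) * (euler_prod w / euler_prod U) / real n \<le> \<eta> / 2"
  proof -
    have "euler_prod w \<le> CM * ln (real w)" unfolding CM_def using euler_prod_le[OF w2] by simp
    also have "\<dots> \<le> CM * (ln y / 2)"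
    proof (rule mult_left_mono)
      have lnw: "ln (real w) \<le> ln (sqrt (y / ln y))" using wr w2 by (intro ln_mono) auto
      have "y / ln y \<le> y" using y lny1 by (simp add: field_simps)
      then have "sqrt (y / ln y) \<le> sqrt y" by (rule real_sqrt_le_mono)
      then have "ln (sqrt (y / ln y)) \<le> ln (sqrt y)" using e3 by (intro ln_mono) linarith+
      with lnw have "ln (real w) \<le> ln (sqrt y)" by (rule order_trans)
      then show "ln (real w) \<le> ln y / 2" using y(1) by (simp add: ln_sqrt)
    qed (use CM in auto)
    finally have Vw: "euler_prod w \<le> CM * (ln y / 2)" .
    have VU': "\<tau> \<le> euler_prod U"
    proof -
      have "ln (exp \<tau>) \<le> ln (real U + 1)" using U by (intro ln_mono) auto
      then show ?thesis using euler_prod_ge[of U] by simp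
    qed
    have "2 * real (W y) * (euler_prod w / euler_prod U) / real n
        \<le> 2 * (\<epsilon> * (y / ln y)) * (CM * (ln y / 2) / \<tau>) / (\<tau> / 80)"
      using y Vw VU' n e4 euler_prod_pos[of w] CM lny \<epsilon>0
      by (intro frac_le mult_mono) (auto intro!: mult_nonneg_nonneg divide_nonneg_nonneg less_imp_le[OF euler_prod_pos])
    also have "\<dots> = 80 * \<epsilon> * CM * c" using lny e4 unfolding y\<tau>
      by (simp add: field_simps power2_eq_square)
    also have "\<dots> = \<eta> / 2" using c0 CM by (simp add: \<epsilon>_def)
    finally show ?thesis .
  qed
  have \<beta>: "2 * 2 ^ n / real N + 3 * 2 ^ (2 * n) * (2 ^ (2 * n) * ((real (2 * n))\<^sup>2 / real U)) \<le> \<eta> / 2"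
  proof -
    have two: "(2::real) ^ k \<le> exp (real k)" for k
    proof -
      have "(2::real) \<le> exp 1" using exp_ge_add_one_self[of 1] by simp
      then have "(2::real) ^ k \<le> exp 1 ^ k" by (intro power_mono) auto
      then show ?thesis by (simp add: exp_of_nat_mult[symmetric])
    qed
    have t1: "(2::real) ^ n \<le> exp (\<tau> / 40)" using order_trans[OF two[of n]] n by simp
    have t2: "(2::real) ^ (2 * n) \<le> exp (\<tau> / 20)" using order_trans[OF two[of "2 * n"]] n by simp
    have "2 * 2 ^ n / real N \<le> 2 * exp (\<tau> / 40) / (exp (\<tau> / 2) - 1)"
      using t1 N exp\<tau>2 e4 by (intro frac_le) auto
    moreover have "3 * 2 ^ (2 * n) * (2 ^ (2 * n) * ((real (2 * n))\<^sup>2 / real U)) \<le>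
        3 * exp (\<tau> / 20) * (exp (\<tau> / 20) * ((\<tau> / 20)\<^sup>2 / (exp \<tau> - 1)))"
      using t2 n U exp\<tau> e4 by (intro mult_mono frac_le power_mono) auto
    ultimately show ?thesis using e5 by linarith
  qed
  have "residue_prob ?A (\<lambda>a. \<not> G a) \<le> 2 * real (W y) * (euler_prod w / euler_prod U) / real n +
      (2 * 2 ^ n / real N + 3 * 2 ^ (2 * n) * (2 ^ (2 * n) * ((real (2 * n))\<^sup>2 / real U)))"
    unfolding G_def w_def
    by (rule residue_prob_no_covered_interval)
       (use y wU UZ N1 nU n window half in \<open>simp_all add: w_def P_def Q_def\<close>)
  also have "\<dots> \<le> \<eta>" using \<alpha> \<beta> by linarith
  finally have bad: "residue_prob ?A (\<lambda>a. \<not> G a) \<le> \<eta>" .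
  have "{a. \<not> G a} = UNIV - {a. G a}" by auto
  then have "residue_prob ?A (\<lambda>a. \<not> G a) = 1 - residue_prob ?A G"
    using measure_pmf.prob_compl[of "{a. G a}" "residue_pmf ?A"] by simp
  with bad have good: "residue_prob ?A G \<ge> 1 - \<eta>" by simp
  obtain E where E: "E \<in> sets random_residues" "\<And>a. a \<in> E \<Longrightarrow> G a"
    "measure random_residues E = residue_prob ?A G"
  proof (rule random_residues_event[of ?A G])
    show "G a'" if "\<And>p. p \<in> ?A \<Longrightarrow> a p = a' p" "G a" for a a'
    proof -
      have "hits ?A a t = hits ?A a' t" for t
        using that(1) unfolding hits_def by (intro bex_cong) auto
      then show ?thesis using that(2) by (simp add: G_def covered_interval_def)
    qed
  qed auto
  have "\<exists>x\<ge>X0. K * (ln x)\<^sup>2 \<le> largest_gap (random_set a) x" if a: "a \<in> E" for a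
  proof -
    obtain s where s: "b \<le> s" "s \<le> b + int U" "covered_interval ?A a s y"
      using E(2)[OF a] by (auto simp: G_def)
    have bx: "x / 2 \<le> real_of_int b" "real_of_int b \<le> x / 2 + 1" unfolding b_def by linarith+
    have sx: "x / 2 \<le> real_of_int s" using s(1) bx by linarith
    have "real_of_int s \<le> real_of_int (b + int U)" using s(2) by (simp only: of_int_le_iff)
    then have sU: "real_of_int s + y \<le> x"
      using bx U e6 x8 unfolding of_int_add of_int_of_nat_eq by linarith
    have "{real_of_int s..real_of_int s + y} \<inter> real ` random_set a = {}"
    proof (rule ccontr)
      assume "\<not> ?thesis"
      then obtain k where k: "k \<in> random_set a" "real_of_int s \<le> real k" "real k \<le> real_of_int s + y" by auto
      have "s \<le> int k" using k(2) by linarith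
      then have "hits ?A a (int k)" using s(3) k(3) by (auto simp: covered_interval_def)
      then obtain p where p: "prime p" "p \<le> Z" "[int k = a p] (mod int p)" by (auto simp: hits_def)
      have "euler_prod p \<le> ln (x / 2)" using euler_prod_mono[OF p(2)] Z1 by linarith
      also have "\<dots> \<le> ln (real k)" using sx k(2) x_def by (intro ln_mono) auto
      finally have "euler_prod p \<le> ln (real k)" .
      moreover have "real k > 0" using sx k(2) x2 exp_gt_zero[of "2::real"] by linarith
      ultimately have "p \<le> sieve_limit (real k)" using p(1) by (intro le_sieve_limit)
      then show False using k(1) p by (auto simp: random_set_def sifted_set_def)
    qed
    moreover have "1 \<le> x / 2" using x2 one_le_exp_iff[of "2::real"] by linarith
    ultimately have "(real_of_int s + y) - real_of_int s \<le> largest_gap (random_set a) x"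
      using sx sU y by (intro largest_gap_ge) auto
    then have "K * (ln x)\<^sup>2 \<le> largest_gap (random_set a) x" unfolding KL by simp
    moreover have "X0 \<le> x" using e7(1) x8 by linarith
    ultimately show ?thesis by blast
  qed
  with E good that show ?thesis by metis
qed

text \<open>For fixed \<open>K\<close> and \<open>X\<close> there are events of probability at least
  \<open>1 - 1 / (i + 1)\<close> for every \<open>i\<close>; their union has probability 1. Natural
  \<open>K\<close> and \<open>X\<close> leave only countably many conditions to intersect.\<close>

lemma AE_random_gap:
  assumes "exceptional_zeros_exist"
  shows "AE a in random_residues.
     Limsup at_top (\<lambda>x::real. ereal (largest_gap (random_set a) x / (ln x)\<^sup>2)) = \<infinity>"
proof -
  interpret prob_space random_residues by (rule prob_space_random_residues)
  let ?Q = "\<lambda>(K::nat) (X::nat) a. \<exists>x\<ge>real X. real (Suc K) * (ln x)\<^sup>2 \<le> largest_gap (random_set a) x"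
  have "AE a in random_residues. ?Q K X a" for K X
  proof -
    have "\<exists>E. E \<in> events \<and> prob E \<ge> 1 - 1 / real (Suc i) \<and> (\<forall>a\<in>E. ?Q K X a)" for i
      by (rule random_gap_event[OF assms, of "real (Suc K)" "1 / real (Suc i)" "real X"]) auto
    then obtain E where E: "\<And>i. E i \<in> events" "\<And>i. prob (E i) \<ge> 1 - 1 / real (Suc i)" "\<And>i a. a \<in> E i \<Longrightarrow> ?Q K X a"
      by metis
    have ev: "(\<Union>i. E i) \<in> events" using E(1) by auto
    have "1 - 1 / real (Suc i) \<le> prob (\<Union>i. E i)" for i
      using E(2)[of i] finite_measure_mono[of "E i" "\<Union>i. E i"] ev by (meson UNIV_I UN_upper order_trans)
    then have "1 \<le> prob (\<Union>i. E i)"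
      by (intro LIMSEQ_le_const2[of "\<lambda>i. 1 - 1 / real (Suc i)"])
         (use tendsto_diff[OF tendsto_const LIMSEQ_inverse_real_of_nat, of 1] in \<open>auto simp: inverse_eq_divide\<close>)
    then have "prob (\<Union>i. E i) = 1" using prob_le_1 antisym by blast
    then have "AE a in random_residues. a \<in> (\<Union>i. E i)" by (rule AE_prob_1)
    then show ?thesis by eventually_elim (use E(3) in blast)
  qed
  then have "AE a in random_residues. \<forall>K X. ?Q K X a" by (simp only: AE_all_countable) blast
  then show ?thesis
  proof eventually_elim
    case (elim a)
    show ?case
    proof (rule Limsup_largest_gap_eqI)
      fix K X :: real
      obtain x where x: "x \<ge> real (nat \<lceil>X\<rceil>)" "real (Suc (nat \<lceil>K\<rceil>)) * (ln x)\<^sup>2 \<le> largest_gap (random_set a) x"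
        using elim by blast
      have "X \<le> x" using x(1) by linarith
      moreover have "K * (ln x)\<^sup>2 \<le> real (Suc (nat \<lceil>K\<rceil>)) * (ln x)\<^sup>2"
        by (intro mult_right_mono) (linarith, simp)
      ultimately show "\<exists>x\<ge>X. K * (ln x)\<^sup>2 \<le> largest_gap (random_set a) x" using x(2) order_trans by blast
    qed
  qed
qed

theorem theorem2p2:
  assumes "exceptional_zeros_exist"
  shows "Liminf at_top (\<lambda>y::real. ereal (real (W y) / (y / ln y))) = 0
    \<and> Limsup at_top (\<lambda>u::real. g u / ereal u) = \<infinity>
    \<and> (AE a in random_residues.
          Limsup at_top (\<lambda>x::real. ereal (largest_gap (random_set a) x / (ln x)\<^sup>2)) = \<infinity>)
    \<and> (prime_gap_conjecture \<longrightarrow>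
          Limsup at_top (\<lambda>x::real. ereal (largest_gap {p. prime p} x / (ln x)\<^sup>2)) = \<infinity>)"
  using Liminf_W[OF assms] Limsup_g[OF assms] AE_random_gap[OF assms] Limsup_prime_gap[OF assms]
  by blast

end
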